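(* Let $d_{\mathrm{in}},d_{\mathrm{out}},T\ge 1$ be integers, $\beta>0$, $U>0$, $d_s$ a positive integer, and suppose $f^{(T)}\in\mathcal{H}^{\beta}_{d_{\mathrm{in}}T,\,d_{\mathrm{out}}}([0,1]^{d_{\mathrm{in}}\times T},U)$. Then for any $I,J\in\mathbb{N}^+$, with depth $L=42(\lfloor\beta\rfloor+1)^2 I\lceil\log_2(8I)\rceil+6d_{\mathrm{in}}T$ and width $d=76(\lfloor\beta\rfloor+1)^2 3^{d_{\mathrm{in}}T}d_{\mathrm{in}}^{\lfloor\beta\rfloor+2}d_{\mathrm{out}}T^{\lfloor\beta\rfloor+1}J\lceil\log_2(8J)\rceil+d_s$, where $d$ is assumed divisible by $d_s$, there exists $\phi\in\mathcal{F}^{(T)}_{d_{\mathrm{in}},d_{\mathrm{out}},d,d_s,L,U}$ such that $$\sup_{\boldsymbol X\in[0,1]^{d_{\mathrm{in}}\times T}}\|\phi(\boldsymbol X)-f^{(T)}(\boldsymbol X)\|_\infty\le 19U(\lfloor\beta\rfloor+1)^2(d_{\mathrm{in}}T)^{\lfloor\beta\rfloor+(\beta\vee1)/2}(JI)^{-2\beta/(d_{\mathrm{in}}T)}.$$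
   Context: ParaRNN class: let $\sigma(x)=\max(x,0)$ act entrywise and let $d_s$ divide $d$. A ParaRNN $\mathcal N$ maps $\boldsymbol X=(\boldsymbol x_1,\dots,\boldsymbol x_T)\in\mathbb{R}^{d_{\mathrm{in}}\times T}$ to $\mathcal N(\boldsymbol X)\in\mathbb{R}^{d_{\mathrm{out}}\times T}$ as $\mathcal N=\mathcal Q\circ\mathcal F\circ\mathcal R_L\circ\cdots\circ\mathcal R_1\circ\mathcal P$, where $\mathcal P$ maps $(\boldsymbol x_t)_{t}$ to $(\boldsymbol P\boldsymbol x_t)_t$ with $\boldsymbol P\in\mathbb{R}^{d\times d_{\mathrm{in}}}$; each recurrent layer $\mathcal R_l$ maps a sequence $(\boldsymbol u_1,\dots,\boldsymbol u_T)$ in $\mathbb{R}^d$ to $(\boldsymbol h_1,\dots,\boldsymbol h_T)$ with $\boldsymbol h_0=\boldsymbol 0$ and $\boldsymbol h_t=\sigma(\boldsymbol W_{h,l}\boldsymbol h_{t-1}+\boldsymbol W_{x,l}\boldsymbol u_t+\boldsymbol b_l)$, where $\boldsymbol W_{x,l}\in\mathbb{R}^{d\times d}$, $\boldsymbol b_l\in\mathbb{R}^d$, and $\boldsymbol W_{h,l}\in\mathbb{R}^{d\times d}$ is block diagonal with $d/d_s$ diagonal blocks of size $d_s\times d_s$; $\mathcal F$ maps $(\boldsymbol u_t)_t$ to $(\sigma(\boldsymbol W_f\boldsymbol u_t+\boldsymbol b_f))_t$ with $\boldsymbol W_f\in\mathbb{R}^{d\times d}$, $\boldsymbol b_f\in\mathbb{R}^d$;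 $\mathcal Q$ maps $(\boldsymbol u_t)_t$ to $(\boldsymbol Q\boldsymbol u_t)_t$ with $\boldsymbol Q\in\mathbb{R}^{d_{\mathrm{out}}\times d}$. $\mathcal N(\boldsymbol X)[t]$ is the $t$-th column. $\mathcal{F}^{(T)}_{d_{\mathrm{in}},d_{\mathrm{out}},d,d_s,L,U}$ is the set of maps $\boldsymbol X\mapsto\mathcal N(\boldsymbol X)[T]$, $\mathbb{R}^{d_{\mathrm{in}}\times T}\to\mathbb{R}^{d_{\mathrm{out}}}$, over all such $\mathcal N$ (arbitrary real weights) satisfying $\sup_{\boldsymbol X\in\mathbb{R}^{d_{\mathrm{in}}\times T},\,1\le t\le T}\|\mathcal N(\boldsymbol X)[t]\|_\infty\le U$. Hölder class: for $\Omega\subset\mathbb{R}^{m}$ and $\beta=k+\omega$ with $k\in\mathbb{N}_0$, $\omega\in(0,1]$, $\mathcal{H}^\beta_{m,n}(\Omega,M)$ is the set of $f=(f_1,\dots,f_n)^\top:\Omega\to\mathbb{R}^n$ such that for each $i$, $\sum_{\|\boldsymbol n\|_1<\beta}\|\partial^{\boldsymbol n}f_i\|_{L^\infty(\Omega)}+\sum_{\|\boldsymbol n\|_1=k}\sup_{\boldsymbol x\ne\boldsymbol y\in\Omega}|\partial^{\boldsymbol n}f_i(\boldsymbol x)-\partial^{\boldsymbol n}f_i(\boldsymbol y)|/\|\boldsymbol x-\boldsymbol y\|^\omega\le M$, with multi-indices $\boldsymbol n\in\mathbb{N}_0^m$. Here $[0,1]^{d_{\mathrm{in}}\times T}$ is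 identified with $[0,1]^{d_{\mathrm{in}}T}$. $\beta\vee1=\max(\beta,1)$. *)

theory Defs
  imports "HOL-Analysis.Analysis"
begin

text \<open>Vectors are functions nat => real (only indices below the stated dimension
are used); matrices are nat => nat => real; sequences are nat (time) => vector,
with time steps 1..T (time 0 carries the initial state h_0 = 0).\<close>

definition relu :: "real \<Rightarrow> real" where
  "relu x = max x 0"

definition mat_vec :: "nat \<Rightarrow> (nat \<Rightarrow> nat \<Rightarrow> real) \<Rightarrow> (nat \<Rightarrow> real) \<Rightarrow> nat \<Rightarrow> real" where
  "mat_vec n A v = (\<lambda>i. \<Sum>j<n. A i j * v j)"

fun rnn_state :: "nat \<Rightarrow> (nat \<Rightarrow> nat \<Rightarrow> real) \<Rightarrow> (nat \<Rightarrow> nat \<Rightarrow> real) \<Rightarrow> (nat \<Rightarrow> real)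
    \<Rightarrow> (nat \<Rightarrow> nat \<Rightarrow> real) \<Rightarrow> nat \<Rightarrow> nat \<Rightarrow> real" where
  "rnn_state d Wh Wx b u 0 = (\<lambda>_. 0)"
| "rnn_state d Wh Wx b u (Suc t) =
     (\<lambda>i. relu (mat_vec d Wh (rnn_state d Wh Wx b u t) i + mat_vec d Wx (u (Suc t)) i + b i))"

record pararnn =
  rnn_P :: "nat \<Rightarrow> nat \<Rightarrow> real"
  rnn_layers :: "((nat \<Rightarrow> nat \<Rightarrow> real) \<times> (nat \<Rightarrow> nat \<Rightarrow> real) \<times> (nat \<Rightarrow> real)) list"
  rnn_Wf :: "nat \<Rightarrow> nat \<Rightarrow> real"
  rnn_bf :: "nat \<Rightarrow> real"
  rnn_Q :: "nat \<Rightarrow> nat \<Rightarrow> real"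

text \<open>Input X is indexed as X (i, t), i < d_in, 1 <= t <= T. Output: time => vector.
Layers are applied in list order (first element = R_1).\<close>
definition pararnn_eval :: "nat \<Rightarrow> nat \<Rightarrow> pararnn \<Rightarrow> (nat \<times> nat \<Rightarrow> real) \<Rightarrow> nat \<Rightarrow> nat \<Rightarrow> real" where
  "pararnn_eval din d N X =
     (let u0 = (\<lambda>t. mat_vec din (rnn_P N) (\<lambda>i. X (i, t)));
          uL = foldl (\<lambda>u (Wh, Wx, b). rnn_state d Wh Wx b u) u0 (rnn_layers N);
          uF = (\<lambda>t i. relu (mat_vec d (rnn_Wf N) (uL t) i + rnn_bf N i))
      in (\<lambda>t. mat_vec d (rnn_Q N) (uF t)))"

definition block_diag :: "nat \<Rightarrow> nat \<Rightarrow> (nat \<Rightarrow> nat \<Rightarrow> real) \<Rightarrow> bool" where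
  "block_diag d ds W \<longleftrightarrow> (\<forall>i<d. \<forall>j<d. i div ds \<noteq> j div ds \<longrightarrow> W i j = 0)"

definition pararnn_class :: "nat \<Rightarrow> nat \<Rightarrow> nat \<Rightarrow> nat \<Rightarrow> nat \<Rightarrow> real \<Rightarrow> nat
    \<Rightarrow> ((nat \<times> nat \<Rightarrow> real) \<Rightarrow> nat \<Rightarrow> real) set" where
  "pararnn_class din dout d ds L U T =
     {\<phi>. \<exists>N. length (rnn_layers N) = L
          \<and> (\<forall>(Wh, Wx, b) \<in> set (rnn_layers N). block_diag d ds Wh)
          \<and> (\<forall>X t i. 1 \<le> t \<and> t \<le> T \<and> i < dout \<longrightarrow> \<bar>pararnn_eval din d N X t i\<bar> \<le> U)
          \<and> \<phi> = (\<lambda>X. pararnn_eval din d N X T)}"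

definition cube :: "'a set \<Rightarrow> ('a \<Rightarrow> real) set" where
  "cube I = {x. (\<forall>p\<in>I. 0 \<le> x p \<and> x p \<le> 1) \<and> (\<forall>p. p \<notin> I \<longrightarrow> x p = 0)}"

definition has_partial :: "('a \<Rightarrow> real) set \<Rightarrow> 'a \<Rightarrow> (('a \<Rightarrow> real) \<Rightarrow> real) \<Rightarrow> ('a \<Rightarrow> real) \<Rightarrow> bool" where
  "has_partial \<Omega> j g x \<longleftrightarrow>
     (\<exists>D. ((\<lambda>s. g (x(j := s))) has_real_derivative D) (at (x j) within {s. x(j := s) \<in> \<Omega>}))"

definition partial :: "('a \<Rightarrow> real) set \<Rightarrow> 'a \<Rightarrow> (('a \<Rightarrow> real) \<Rightarrow> real) \<Rightarrow> ('a \<Rightarrow> real) \<Rightarrow> real" where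
  "partial \<Omega> j g x =
     (SOME D. ((\<lambda>s. g (x(j := s))) has_real_derivative D) (at (x j) within {s. x(j := s) \<in> \<Omega>}))"

fun pdiff :: "('a \<Rightarrow> real) set \<Rightarrow> 'a list \<Rightarrow> (('a \<Rightarrow> real) \<Rightarrow> real) \<Rightarrow> ('a \<Rightarrow> real) \<Rightarrow> real" where
  "pdiff \<Omega> [] g = g"
| "pdiff \<Omega> (j # js) g = partial \<Omega> j (pdiff \<Omega> js g)"

definition multi_indices :: "'a set \<Rightarrow> ('a \<Rightarrow> nat) set" where
  "multi_indices I = {n. \<forall>p. p \<notin> I \<longrightarrow> n p = 0}"

text \<open>Canonical list of differentiation directions for multi-index n, w.r.t. a fixed
enumeration cs (a distinct list) of the coordinate set set cs.\<close>
definition mi_list :: "'a list \<Rightarrow> ('a \<Rightarrow> nat) \<Rightarrow> 'a list" where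
  "mi_list cs n = concat (map (\<lambda>j. replicate (n j) j) cs)"

definition mi_deriv :: "'a list \<Rightarrow> ('a \<Rightarrow> nat) \<Rightarrow> (('a \<Rightarrow> real) \<Rightarrow> real) \<Rightarrow> ('a \<Rightarrow> real) \<Rightarrow> real" where
  "mi_deriv I n g = pdiff (cube (set I)) (mi_list I n) g"

definition mi_deriv_exists :: "'a list \<Rightarrow> ('a \<Rightarrow> nat) \<Rightarrow> (('a \<Rightarrow> real) \<Rightarrow> real) \<Rightarrow> bool" where
  "mi_deriv_exists I n g \<longleftrightarrow>
     (\<forall>x\<in>cube (set I). \<forall>m < length (mi_list I n).
        has_partial (cube (set I)) (mi_list I n ! m) (pdiff (cube (set I)) (drop (Suc m) (mi_list I n)) g) x)"

definition eucl_dist :: "'a set \<Rightarrow> ('a \<Rightarrow> real) \<Rightarrow> ('a \<Rightarrow> real) \<Rightarrow> real" where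
  "eucl_dist I x y = sqrt (\<Sum>p\<in>I. (x p - y p)\<^sup>2)"

text \<open>beta = k + omega with k in N_0, omega in (0,1].\<close>
definition holder_k :: "real \<Rightarrow> nat" where
  "holder_k \<beta> = nat (\<lceil>\<beta>\<rceil> - 1)"

definition holder_omega :: "real \<Rightarrow> real" where
  "holder_omega \<beta> = \<beta> - real (holder_k \<beta>)"

definition holder_class :: "'a list \<Rightarrow> nat \<Rightarrow> real \<Rightarrow> real
    \<Rightarrow> (('a \<Rightarrow> real) \<Rightarrow> nat \<Rightarrow> real) set" where
  "holder_class I nout \<beta> M =
     {f. distinct I \<and> (\<forall>i<nout.
        (\<forall>n\<in>multi_indices (set I). real (sum n (set I)) < \<beta> \<longrightarrow> mi_deriv_exists I n (\<lambda>x. f x i))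
      \<and> (\<Sum>n\<in>{n\<in>multi_indices (set I). real (sum n (set I)) < \<beta>}.
            SUP x\<in>cube (set I). ereal \<bar>mi_deriv I n (\<lambda>x. f x i) x\<bar>)
        + (\<Sum>n\<in>{n\<in>multi_indices (set I). sum n (set I) = holder_k \<beta>}.
            SUP x\<in>cube (set I). SUP y\<in>cube (set I) - {x}.
              ereal (\<bar>mi_deriv I n (\<lambda>x. f x i) x - mi_deriv I n (\<lambda>x. f x i) y\<bar>
                     / eucl_dist (set I) x y powr holder_omega \<beta>))
        \<le> ereal M)}"

end

theory Submission
  imports Defs "HOL-Computational_Algebra.Polynomial"
begin

text \<open>With its recurrence switched off a layer is an ordinary ReLU layer acting at each time, and one
  layer with distinct diagonal decay rates makes the final state an invertible linear image of all
  inputs; so it suffices to approximate each component of \<open>f\<close> by a feed-forward ReLU network of the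
  final state, clipped to \<open>[-U, U]\<close> by the last layer.  Cut the cube into \<open>K ^ D\<close> cells with
  \<open>K = \<lfloor>(J I) powr (2 / D)\<rfloor>\<close>, hence at most \<open>(J I)\<^sup>2\<close> cells, and use on each the Taylor polynomial at the
  centre.  A coefficient is a table lookup: the cell number is split into an address of one of
  \<open>J\<^sup>2 I\<close> stored integers, each of which packs \<open>I\<close> coefficients, and a position; the digits are then
  extracted by repeatedly reducing the integer modulo smaller powers.  Products come from a
  piecewise linear squaring scheme with \<open>2 J\<close> pieces per layer.  The digit extraction fails only next
  to the cell boundaries; taking the median over small shifts, one coordinate after the other,
  repairs this at the cost of the factor \<open>3 ^ D\<close> in the width.\<close>

section \<open>ReLU networks as sets of reachable functions\<close>

text \<open>Width about \<open>J\<close> and depth about \<open>I\<close> provide only about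
  \<open>J^2 * I\<close> weights, whereas the rate calls for about \<open>(J * I)^2\<close>
  independent coefficients; each weight must therefore carry about \<open>I\<close> of them, which
  is why integers are packed and unpacked. Digits have radix \<open>2 * J\<close>: one layer with a
  few times \<open>J\<close> units tests \<open>2 * J\<close> thresholds at once and removes a whole
  digit. Precision \<open>(2 * J) powr (- m)\<close> thus costs \<open>m\<close> layers with
  \<open>m = 2 * (\<lfloor>\<beta>\<rfloor> + 1) * \<lceil>log 2 (8 * I)\<rceil>\<close>, and no
  logarithm of \<open>J\<close> enters the depth. Squaring with \<open>2 * J\<close> pieces gains a
  factor \<open>(2 * J)^2\<close> per layer, so lookup and multiplication errors reach the target
  rate together. The floor functions are discontinuous, hence no ReLU network can be right
  everywhere; but as weights are unrestricted, the bad strips may be as thin as desired, and the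
  shifts of the median then cost an arbitrarily small extra error. Features that must survive a
  layer are kept nonnegative; signed ones are stored as \<open>(c + 1) / 2\<close> or as positive
  and negative parts.\<close>

inductive_set aff :: "'x set \<Rightarrow> ('x \<Rightarrow> real) set \<Rightarrow> ('x \<Rightarrow> real) set"
  for G :: "'x set" and S :: "('x \<Rightarrow> real) set" where
  aff_base: "f \<in> S \<Longrightarrow> f \<in> aff G S"
| aff_const: "(\<lambda>_. c) \<in> aff G S"
| aff_add: "f \<in> aff G S \<Longrightarrow> g \<in> aff G S \<Longrightarrow> (\<lambda>x. f x + g x) \<in> aff G S"
| aff_scale: "f \<in> aff G S \<Longrightarrow> (\<lambda>x. c * f x) \<in> aff G S"
| aff_cong: "f \<in> aff G S \<Longrightarrow> (\<And>x. x \<in> G \<Longrightarrow> g x = f x) \<Longrightarrow> g \<in> aff G S"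

lemma aff_diff: "f \<in> aff G S \<Longrightarrow> g \<in> aff G S \<Longrightarrow> (\<lambda>x. f x - g x) \<in> aff G S"
  using aff_add[OF _ aff_scale[of g G S "-1"], of f] by simp

lemma aff_minus: "f \<in> aff G S \<Longrightarrow> (\<lambda>x. - f x) \<in> aff G S"
  using aff_scale[of f G S "-1"] by simp

lemma aff_scale_right: "f \<in> aff G S \<Longrightarrow> (\<lambda>x. f x * c) \<in> aff G S"
  using aff_scale[of f G S c] by (simp add: mult.commute)

lemma aff_divide: "f \<in> aff G S \<Longrightarrow> (\<lambda>x. f x / c) \<in> aff G S"
  using aff_scale[of f G S "1/c"] by simp

lemma aff_sum:
  assumes "\<And>i. i \<in> A \<Longrightarrow> f i \<in> aff G S"
  shows "(\<lambda>x. \<Sum>i\<in>A. f i x) \<in> aff G S"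
proof (cases "finite A")
  case True
  then show ?thesis using assms
    by (induction A rule: finite_induct) (auto intro: aff_const aff_add)
next
  case False
  then show ?thesis by (simp add: aff_const)
qed

lemmas aff_intros = aff_const aff_add aff_diff aff_minus aff_scale aff_scale_right aff_divide aff_sum

lemma aff_trans: "h \<in> aff G A \<Longrightarrow> A \<subseteq> aff G S \<Longrightarrow> h \<in> aff G S"
  by (induction rule: aff.induct) (auto intro: aff.intros)

lemma aff_mono: "A \<subseteq> B \<Longrightarrow> aff G A \<subseteq> aff G B"
  using aff_trans aff_base by blast

lemma aff_subset: "S \<subseteq> aff G S"
  by (auto intro: aff_base)

lemma aff_comp:
  assumes "h \<in> aff G S" "\<And>x. x \<in> G' \<Longrightarrow> \<tau> x \<in> G"
  shows "h \<circ> \<tau> \<in> aff G' ((\<lambda>f. f \<circ> \<tau>) ` S)"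
  using assms(1)
proof (induction rule: aff.induct)
  case (aff_base f)
  then show ?case by (auto intro: aff.aff_base)
next
  case (aff_const c)
  have "(\<lambda>_. c) \<circ> \<tau> = (\<lambda>_. c)" by auto
  then show ?case by (auto intro: aff.aff_const)
next
  case (aff_add f g)
  have "(\<lambda>x. f x + g x) \<circ> \<tau> = (\<lambda>x. (f \<circ> \<tau>) x + (g \<circ> \<tau>) x)" by auto
  then show ?case using aff.aff_add[OF aff_add.IH] by simp
next
  case (aff_scale f c)
  have "(\<lambda>x. c * f x) \<circ> \<tau> = (\<lambda>x. c * (f \<circ> \<tau>) x)" by auto
  then show ?case using aff.aff_scale[OF aff_scale.IH] by simp
next
  case (aff_cong f g)
  show ?case by (rule aff.aff_cong[OF aff_cong.IH]) (use aff_cong assms(2) in auto)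
qed

text \<open>Features are functions of the network input, and every identity is only required on \<open>G\<close>;
  this lets exact digit extraction be stated away from the bad set, while \<open>reach_extend\<close> extends the
  resulting network to all inputs.\<close>

fun reach :: "'x set \<Rightarrow> nat \<Rightarrow> nat \<Rightarrow> ('x \<Rightarrow> real) set \<Rightarrow> ('x \<Rightarrow> real) set \<Rightarrow> bool" where
  "reach G W 0 S B \<longleftrightarrow> B \<subseteq> aff G S"
| "reach G W (Suc l) S B \<longleftrightarrow>
     (\<exists>A. finite A \<and> card A \<le> W \<and> (\<forall>g\<in>A. \<exists>h\<in>aff G S. \<forall>x\<in>G. g x = relu (h x)) \<and> reach G W l A B)"

text \<open>Affine maps before and after a network are absorbed into the weights of the adjacent
  layers; only the ReLU units per layer are counted.\<close>

lemma reach_weaken: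
  "reach G W l S B \<Longrightarrow> W \<le> W' \<Longrightarrow> S \<subseteq> aff G S' \<Longrightarrow> B' \<subseteq> aff G B \<Longrightarrow> reach G W' l S' B'"
proof (induction l arbitrary: S S')
  case 0
  then show ?case by simp (meson aff_trans subsetD subsetI)
next
  case (Suc l)
  then obtain A where A: "finite A" "card A \<le> W"
    "\<forall>g\<in>A. \<exists>h\<in>aff G S. \<forall>x\<in>G. g x = relu (h x)" "reach G W l A B" by auto
  have "reach G W' l A B'"
    using Suc.IH[OF A(4) Suc.prems(2) aff_subset Suc.prems(4)] .
  moreover have "\<forall>g\<in>A. \<exists>h\<in>aff G S'. \<forall>x\<in>G. g x = relu (h x)"
    using A(3) Suc.prems(3) aff_trans by meson
  ultimately show ?case using A Suc.prems(2) by (auto intro!: exI[of _ A])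
qed

lemma reach_width: "reach G W l S B \<Longrightarrow> W \<le> W' \<Longrightarrow> reach G W' l S B"
  by (rule reach_weaken) (auto intro: aff_base)

lemma reach_out: "reach G W l S B \<Longrightarrow> B' \<subseteq> aff G B \<Longrightarrow> reach G W l S B'"
  by (rule reach_weaken) (auto intro: aff_base)

lemma reach_in: "reach G W l S B \<Longrightarrow> S \<subseteq> aff G S' \<Longrightarrow> reach G W l S' B"
  by (rule reach_weaken) (auto intro: aff_base)

lemma reach_trans:
  "reach G W l S A \<Longrightarrow> reach G W l' A B \<Longrightarrow> reach G W (l + l') S B"
proof (induction l arbitrary: S)
  case 0
  then show ?case using reach_in by (metis add_0 reach.simps(1))
next
  case (Suc l)
  then show ?case by (metis add_Suc reach.simps(2))
qed

lemma reach_Un: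
  "reach G W1 l S A \<Longrightarrow> reach G W2 l S' B \<Longrightarrow> reach G (W1 + W2) l (S \<union> S') (A \<union> B)"
proof (induction l arbitrary: S S')
  case 0
  then show ?case using aff_mono[of S "S \<union> S'" G] aff_mono[of S' "S \<union> S'" G] by auto
next
  case (Suc l)
  obtain C where C: "finite C" "card C \<le> W1"
    "\<forall>g\<in>C. \<exists>h\<in>aff G S. \<forall>x\<in>G. g x = relu (h x)" "reach G W1 l C A" using Suc.prems by auto
  obtain E where E: "finite E" "card E \<le> W2"
    "\<forall>g\<in>E. \<exists>h\<in>aff G S'. \<forall>x\<in>G. g x = relu (h x)" "reach G W2 l E B" using Suc.prems by auto
  have "card (C \<union> E) \<le> W1 + W2" using card_Un_le[of C E] C(2) E(2) by linarith
  moreover have "\<forall>g\<in>C \<union> E. \<exists>h\<in>aff G (S \<union> S'). \<forall>x\<in>G. g x = relu (h x)"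
    using C(3) E(3) aff_mono[of S "S \<union> S'" G] aff_mono[of S' "S \<union> S'" G] by blast
  ultimately show ?case using C(1) E(1) Suc.IH[OF C(4) E(4)]
    by (auto intro!: exI[of _ "C \<union> E"])
qed

lemma reach_par:
  "reach G W1 l S A \<Longrightarrow> reach G W2 l S B \<Longrightarrow> reach G (W1 + W2) l S (A \<union> B)"
  using reach_Un[of G W1 l S A W2 S B] by simp

lemma reach_unit: "h \<in> aff G S \<Longrightarrow> reach G 1 1 S {\<lambda>x. relu (h x)}"
  by (auto intro!: exI[of _ "{\<lambda>x. relu (h x)}"] intro: aff_base)

text \<open>ReLU is the identity on nonnegative values, so remembering a feature costs one unit per
  layer. This is why nonnegativity on \<open>G\<close> recurs as a side condition.\<close>

lemma reach_carry:
  assumes "h \<in> aff G S" "\<And>x. x \<in> G \<Longrightarrow> 0 \<le> h x"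
  shows "reach G 1 l S {h}"
  using assms(1)
proof (induction l arbitrary: S)
  case 0
  then show ?case by simp
next
  case (Suc l)
  have "\<exists>h'\<in>aff G S. \<forall>x\<in>G. h x = relu (h' x)"
    using Suc.prems assms(2) by (intro bexI[of _ h]) (auto simp: relu_def)
  moreover have "reach G 1 l {h} {h}" using Suc.IH aff_base[of h "{h}" G] by auto
  ultimately show ?case by (auto intro!: exI[of _ "{h}"])
qed

lemma reach_empty: "reach G 0 l S {}"
proof (induction l arbitrary: S)
  case (Suc l)
  then show ?case by (auto intro!: exI[of _ "{}"])
qed simp

lemma reach_UN:
  assumes "finite A" "\<And>i. i \<in> A \<Longrightarrow> reach G (W i) l S (B i)"
  shows "reach G (\<Sum>i\<in>A. W i) l S (\<Union>i\<in>A. B i)"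
  using assms
proof (induction A rule: finite_induct)
  case empty
  then show ?case by (simp add: reach_empty)
next
  case (insert a A)
  have "reach G (W a + (\<Sum>i\<in>A. W i)) l S (B a \<union> (\<Union>i\<in>A. B i))"
    by (rule reach_par) (use insert in auto)
  then show ?case using insert by simp
qed

lemma reach_UN_const:
  assumes "finite A" "\<And>i. i \<in> A \<Longrightarrow> reach G W l S (B i)"
  shows "reach G (card A * W) l S (\<Union>i\<in>A. B i)"
  using reach_UN[OF assms(1), of G "\<lambda>_. W" l S B] assms(2) by simp

lemma reach_units:
  assumes "finite A" "\<And>i. i \<in> A \<Longrightarrow> h i \<in> aff G S"
  shows "reach G (card A) 1 S ((\<lambda>i x. relu (h i x)) ` A)"
  using reach_UN_const[OF assms(1), of G 1 1 S "\<lambda>i. {\<lambda>x. relu (h i x)}"] reach_unit[OF assms(2)]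
  by (simp add: UNION_singleton_eq_range)

lemma reach_carries:
  assumes "finite A" "\<And>i. i \<in> A \<Longrightarrow> h i \<in> aff G S" "\<And>i x. i \<in> A \<Longrightarrow> x \<in> G \<Longrightarrow> 0 \<le> h i x"
  shows "reach G (card A) l S (h ` A)"
  using reach_UN_const[OF assms(1), of G 1 l S "\<lambda>i. {h i}"] reach_carry[OF assms(2,3)]
  by (simp add: UNION_singleton_eq_range)

text \<open>Isolates the last hidden layer: its features are few and nonnegative, whereas
  \<open>B\<close> may contain arbitrarily many signed affine combinations of them.\<close>

lemma reach_mid:
  "reach G W (Suc l) S B \<Longrightarrow> \<exists>A. finite A \<and> card A \<le> W \<and> (\<forall>g\<in>A. \<forall>x\<in>G. 0 \<le> g x)
     \<and> reach G W (Suc l) S A \<and> B \<subseteq> aff G A"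
proof (induction l arbitrary: S)
  case 0
  then obtain A where A: "finite A" "card A \<le> W"
    "\<forall>g\<in>A. \<exists>h\<in>aff G S. \<forall>x\<in>G. g x = relu (h x)" "B \<subseteq> aff G A" by auto
  have "\<forall>g\<in>A. \<forall>x\<in>G. 0 \<le> g x" using A(3) by (metis max.cobounded2 relu_def)
  moreover have "reach G W (Suc 0) S A" using A aff_subset[of A G] by auto
  ultimately show ?case using A(1,2,4) by (intro exI[of _ A] conjI)
next
  case (Suc l)
  obtain A where A: "finite A" "card A \<le> W"
    "\<forall>g\<in>A. \<exists>h\<in>aff G S. \<forall>x\<in>G. g x = relu (h x)" "reach G W (Suc l) A B"
    using Suc.prems by (subst (asm) reach.simps(2)) (elim exE conjE)
  obtain A' where A': "finite A'" "card A' \<le> W" "\<forall>g\<in>A'. \<forall>x\<in>G. 0 \<le> g x"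
     "reach G W (Suc l) A A'" "B \<subseteq> aff G A'" using Suc.IH[OF A(4)] by (elim exE conjE)
  have "reach G W (Suc (Suc l)) S A'"
    by (subst reach.simps(2), rule exI[of _ A]) (intro conjI A(1-3) A'(4))
  then show ?case using A'(1-3,5) by (intro exI[of _ A'] conjI)
qed

text \<open>Copying the last hidden layer rather than the outputs adds depth without adding width. A
  hidden layer must exist, hence \<open>1 \<le> l\<close>: the inputs in \<open>S\<close> may be
  signed or more than \<open>W\<close> in number.\<close>

lemma reach_pad:
  assumes "reach G W l S B" "1 \<le> l" "l \<le> l'"
  shows "reach G W l' S B"
proof -
  obtain A where A: "finite A" "card A \<le> W" "\<forall>g\<in>A. \<forall>x\<in>G. 0 \<le> g x"
    "reach G W l S A" "B \<subseteq> aff G A"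
    using reach_mid[of G W "l - 1" S B] assms by auto
  have "reach G (card A) (l' - l) A (id ` A)"
    by (rule reach_carries) (use A in \<open>auto intro: aff_base\<close>)
  then have "reach G W (l' - l) A B"
    by (rule reach_weaken) (use A in \<open>auto intro: aff_base\<close>)
  then show ?thesis using reach_trans[OF A(4)] assms(3) by fastforce
qed

lemma reach_subdomain:
  "reach G W l S B \<Longrightarrow> G' \<subseteq> G \<Longrightarrow> reach G' W l S B"
proof (induction l arbitrary: S)
  case 0
  have "aff G S \<subseteq> aff G' S"
  proof
    fix h assume "h \<in> aff G S" then show "h \<in> aff G' S"
      by (induction rule: aff.induct) (use 0 in \<open>auto intro: aff.intros\<close>)
  qed
  then show ?case using 0 by auto
next
  case (Suc l)
  have *: "aff G S \<subseteq> aff G' S"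
  proof
    fix h assume "h \<in> aff G S" then show "h \<in> aff G' S"
      by (induction rule: aff.induct) (use Suc.prems in \<open>auto intro: aff.intros\<close>)
  qed
  obtain A where A: "finite A" "card A \<le> W"
    "\<forall>g\<in>A. \<exists>h\<in>aff G S. \<forall>x\<in>G. g x = relu (h x)" "reach G W l A B" using Suc.prems by auto
  have "\<forall>g\<in>A. \<exists>h\<in>aff G' S. \<forall>x\<in>G'. g x = relu (h x)" using A(3) * Suc.prems(2) by blast
  then show ?case using A Suc.IH[OF A(4)] Suc.prems(2) by auto
qed

text \<open>The same weights fed with \<open>\<tau> x\<close> compute the composed functions; this
  yields the shifted copies entering the medians.\<close>

lemma reach_comp:
  assumes "\<And>x. x \<in> G' \<Longrightarrow> \<tau> x \<in> G"
  shows "reach G W l S B \<Longrightarrow> reach G' W l ((\<lambda>f. f \<circ> \<tau>) ` S) ((\<lambda>f. f \<circ> \<tau>) ` B)"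
proof (induction l arbitrary: S)
  case 0
  then have "B \<subseteq> aff G S" by simp
  then show ?case unfolding reach.simps using assms by (intro image_subsetI aff_comp) auto
next
  case (Suc l)
  obtain A where A: "finite A" "card A \<le> W"
    "\<forall>g\<in>A. \<exists>h\<in>aff G S. \<forall>x\<in>G. g x = relu (h x)" "reach G W l A B" using Suc.prems by auto
  have "\<forall>g\<in>(\<lambda>f. f \<circ> \<tau>) ` A. \<exists>h\<in>aff G' ((\<lambda>f. f \<circ> \<tau>) ` S). \<forall>x\<in>G'. g x = relu (h x)"
  proof safe
    fix g assume "g \<in> A"
    then obtain h where h: "h \<in> aff G S" "\<forall>x\<in>G. g x = relu (h x)" using A(3) by blast
    show "\<exists>h\<in>aff G' ((\<lambda>f. f \<circ> \<tau>) ` S). \<forall>x\<in>G'. (g \<circ> \<tau>) x = relu (h x)"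
      using aff_comp[OF h(1) assms] h(2) assms by (intro bexI[of _ "h \<circ> \<tau>"]) auto
  qed
  moreover have "card ((\<lambda>f. f \<circ> \<tau>) ` A) \<le> W" using card_image_le[OF A(1)] A(2) le_trans by blast
  ultimately show ?case using finite_imageI[OF A(1)] Suc.IH[OF A(4)]
    by (subst reach.simps(2)) (intro exI[of _ "(\<lambda>f. f \<circ> \<tau>) ` A"] conjI)
qed

section \<open>Extending a network from the good set to all inputs\<close>

lemma aff_extend:
  assumes "h \<in> aff G S" "\<And>f. f \<in> S \<Longrightarrow> \<exists>f'\<in>S'. \<forall>x\<in>G. f' x = f x"
  shows "\<exists>h'\<in>aff UNIV S'. \<forall>x\<in>G. h' x = h x"
  using assms(1)
proof (induction rule: aff.induct)
  case (aff_base f)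
  then show ?case using assms(2) aff.aff_base by blast
next
  case (aff_const c)
  then show ?case using aff.aff_const by fastforce
next
  case (aff_add f g)
  then obtain f' g' where "f' \<in> aff UNIV S'" "g' \<in> aff UNIV S'" "\<forall>x\<in>G. f' x = f x" "\<forall>x\<in>G. g' x = g x"
    by blast
  then show ?case by (intro bexI[OF _ aff.aff_add[of f' _ _ g']]) auto
next
  case (aff_scale f c)
  then obtain f' where "f' \<in> aff UNIV S'" "\<forall>x\<in>G. f' x = f x" by blast
  then show ?case by (intro bexI[OF _ aff.aff_scale[of f']]) auto
next
  case (aff_cong f g)
  then show ?case by fastforce
qed

text \<open>The affine maps are chosen by their behaviour on \<open>G\<close> and then applied
  everywhere; \<open>E g\<close> is whatever that network computes off \<open>G\<close>. The medians
  evaluate networks at such points too.\<close>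

lemma reach_extend:
  assumes "\<And>f. f \<in> S \<Longrightarrow> \<exists>f'\<in>S'. \<forall>x\<in>G. f' x = f x"
  shows "reach G W l S B \<Longrightarrow> \<exists>E. (\<forall>g\<in>B. \<forall>x\<in>G. E g x = g x) \<and> reach UNIV W l S' (E ` B)"
  using assms
proof (induction l arbitrary: S S')
  case 0
  then have "\<forall>g\<in>B. \<exists>h'. h' \<in> aff UNIV S' \<and> (\<forall>x\<in>G. h' x = g x)"
    using aff_extend[of _ G S S'] by (simp add: subset_iff) blast
  then obtain E where "\<forall>g\<in>B. E g \<in> aff UNIV S' \<and> (\<forall>x\<in>G. E g x = g x)"
    by metis
  then show ?case by (intro exI[of _ E]) auto
next
  case (Suc l)
  obtain A where A: "finite A" "card A \<le> W"
    "\<forall>g\<in>A. \<exists>h\<in>aff G S. \<forall>x\<in>G. g x = relu (h x)" "reach G W l A B" using Suc.prems(1) by auto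
  have "\<forall>g\<in>A. \<exists>h'. h' \<in> aff UNIV S' \<and> (\<forall>x\<in>G. g x = relu (h' x))"
    using A(3) aff_extend[of _ G S S', OF _ Suc.prems(2)] by metis
  then obtain H where H: "\<forall>g\<in>A. H g \<in> aff UNIV S' \<and> (\<forall>x\<in>G. g x = relu (H g x))" by metis
  define A' where "A' = (\<lambda>g x. relu (H g x)) ` A"
  have "\<exists>E. (\<forall>g\<in>B. \<forall>x\<in>G. E g x = g x) \<and> reach UNIV W l A' (E ` B)"
    by (rule Suc.IH[OF A(4)]) (use H in \<open>fastforce simp: A'_def\<close>)
  then obtain E where "\<forall>g\<in>B. \<forall>x\<in>G. E g x = g x" "reach UNIV W l A' (E ` B)" by blast
  moreover have "finite A'" "card A' \<le> W"
    using A(1,2) card_image_le[OF A(1), of "\<lambda>g x. relu (H g x)"] by (auto simp: A'_def)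
  moreover have "\<forall>g\<in>A'. \<exists>h\<in>aff UNIV S'. \<forall>x\<in>UNIV. g x = relu (h x)"
    using H by (auto simp: A'_def)
  ultimately show ?case by auto
qed

declare reach.simps(2) [simp del]

section \<open>Floor functions, tables and digit extraction\<close>

lemma aff_eq: "f \<in> S \<Longrightarrow> (\<And>x. x \<in> G \<Longrightarrow> g x = f x) \<Longrightarrow> g \<in> aff G S"
  by (rule aff_cong[OF aff_base])

text \<open>The floor counts the thresholds \<open>c * j\<close> passed by \<open>u\<close>. As
  \<open>u\<close> avoids the open intervals of length \<open>\<delta>\<close> below the thresholds,
  each jump is a ramp, the difference of two units divided by \<open>\<delta>\<close>. A layer
  handles \<open>n\<close> thresholds and carries \<open>u\<close> and the count, hence width
  \<open>2 * n + 2\<close>.\<close>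

lemma reach_floor:
  fixes u :: "'x \<Rightarrow> real" and n M :: nat and c \<delta> :: real
  assumes c: "c > 0" and \<delta>: "\<delta> > 0"
    and nn: "\<And>x. x \<in> G \<Longrightarrow> 0 \<le> u x"
    and lt: "\<And>x. x \<in> G \<Longrightarrow> u x < c * real (n * M)"
    and gap: "\<And>x j::nat. x \<in> G \<Longrightarrow> u x \<le> c * real j - \<delta> \<or> c * real j \<le> u x"
  shows "reach G (2*n+2) M {u} {u, \<lambda>x. real (nat \<lfloor>u x / c\<rfloor>)}"
proof -
  define st where "st j x = (if c * real j \<le> u x then 1 else 0 :: real)" for j :: nat and x
  define F where "F i x = (\<Sum>j\<in>{0<..n*i}. st j x)" for i x
  have st: "st j x = (relu (u x - c * real j + \<delta>) - relu (u x - c * real j)) / \<delta>"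
    if "x \<in> G" for j x
    using gap[OF that, of j] \<delta> by (auto simp: st_def relu_def max_def)
  have F_nn: "0 \<le> F i x" for i x by (auto simp: F_def st_def intro: sum_nonneg)
  have reach: "reach G (2*n+2) i {u} {u, F i}" for i
  proof (induction i)
    case 0
    have "F 0 = (\<lambda>_. 0)" by (auto simp: F_def)
    then show ?case by (auto intro: aff_base aff_const)
  next
    case (Suc i)
    define A where "A = {n*i<..n*i+n}"
    let ?p = "\<lambda>j x. relu (u x - c * real j + \<delta>)" and ?q = "\<lambda>j x. relu (u x - c * real j)"
    have "reach G ((1 + 1) + (card A + card A)) 1 {u, F i} (({u} \<union> {F i}) \<union> (?p ` A \<union> ?q ` A))"
      by (intro reach_par reach_carry reach_units)
        (use F_nn nn in \<open>auto simp: A_def intro!: aff_intros intro: aff_base\<close>)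
    moreover have "{u, F (Suc i)} \<subseteq> aff G (({u} \<union> {F i}) \<union> (?p ` A \<union> ?q ` A))"
    proof -
      have "{0<..n*Suc i} = {0<..n*i} \<union> A" by (auto simp: A_def)
      then have "F (Suc i) x = F i x + (\<Sum>j\<in>A. st j x)" for x
        by (simp add: F_def) (subst sum.union_disjoint; auto simp: A_def)
      then have "F (Suc i) x = F i x + (\<Sum>j\<in>A. (?p j x - ?q j x) / \<delta>)" if "x \<in> G" for x
        using st[OF that] by simp
      moreover have "(\<lambda>x. F i x + (\<Sum>j\<in>A. (?p j x - ?q j x) / \<delta>))
          \<in> aff G (({u} \<union> {F i}) \<union> (?p ` A \<union> ?q ` A))"
        by (intro aff_intros; rule aff_base; blast)
      ultimately have "F (Suc i) \<in> aff G (({u} \<union> {F i}) \<union> (?p ` A \<union> ?q ` A))"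
        using aff_cong by blast
      then show ?thesis by (auto intro: aff_base)
    qed
    ultimately have "reach G ((1 + 1) + (card A + card A)) 1 {u, F i} {u, F (Suc i)}"
      by (rule reach_out)
    then have "reach G (2*n+2) 1 {u, F i} {u, F (Suc i)}"
      by (rule reach_width) (simp add: A_def)
    from reach_trans[OF Suc.IH this] show ?case by simp
  qed
  have "F M x = real (nat \<lfloor>u x / c\<rfloor>)" if "x \<in> G" for x
  proof -
    have "{j\<in>{0<..n*M}. c * real j \<le> u x} = {0<..nat \<lfloor>u x / c\<rfloor>}"
    proof -
      have "c * real j \<le> u x \<longleftrightarrow> j \<le> nat \<lfloor>u x / c\<rfloor>" for j :: nat
        using c nn[OF that] by (simp add: le_nat_iff le_floor_iff field_simps)
      moreover have "j \<le> n * M" if "c * real j \<le> u x" for j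
      proof -
        have "c * real j < c * real (n * M)" using that lt[OF \<open>x \<in> G\<close>] by linarith
        then have "real j < real (n * M)" using c by (simp only: mult_less_cancel_left_pos)
        then show ?thesis by linarith
      qed
      ultimately show ?thesis by auto
    qed
    then show ?thesis by (simp add: F_def st_def sum.If_cases Int_def)
  qed
  then have "(\<lambda>x. real (nat \<lfloor>u x / c\<rfloor>)) \<in> aff G {u, F M}"
    by (intro aff_eq[of "F M"]) auto
  then have "{u, \<lambda>x. real (nat \<lfloor>u x / c\<rfloor>)} \<subseteq> aff G {u, F M}"
    by (auto intro: aff_base)
  with reach[of M] show ?thesis by (rule reach_out)
qed

section \<open>Lookup tables and arithmetic on integers\<close>

lemma relu_hat:
  "relu (real a - (real b - 1)) - 2 * relu (real a - real b) + relu (real a - (real b + 1)) =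
   (if a = b then 1 else 0)"
  by (cases a b rule: linorder_cases) (auto simp: relu_def max_def)

text \<open>Second differences of ReLU at integer knots are indicators on integers. Neighbouring
  indicators share knots, so a block of \<open>n\<close> arguments takes \<open>n + 2\<close> units,
  used jointly by all tables in \<open>Q\<close>; each table adds a single accumulator, and one unit
  carries \<open>v\<close>.\<close>

lemma reach_table:
  fixes v :: "'x \<Rightarrow> nat" and g :: "'q \<Rightarrow> nat \<Rightarrow> real"
  assumes Q: "finite Q" and lt: "\<And>x. x \<in> G \<Longrightarrow> v x < n * M"
    and nn: "\<And>q a. q \<in> Q \<Longrightarrow> 0 \<le> g q a"
  shows "reach G (n + 3 + card Q) M {\<lambda>x. real (v x)} ((\<lambda>q x. g q (v x)) ` Q)"
proof -
  let ?v = "\<lambda>x. real (v x)"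
  define P where "P i q x = (if v x < n * i then g q (v x) else 0)" for i q x
  have reach: "reach G (n + 3 + card Q) i {?v} (insert ?v (P i ` Q))" for i
  proof (induction i)
    case 0
    have "P 0 q = (\<lambda>_. 0)" for q by (auto simp: P_def)
    then show ?case by (auto intro: aff_base aff_const)
  next
    case (Suc i)
    define r where "r = (\<lambda>j x. relu (?v x - (real (n*i) - 1 + real j)))"
    let ?S = "insert ?v (P i ` Q)" and ?A = "{..n+1}"
    let ?B = "r ` ?A \<union> ({?v} \<union> P i ` Q)"
    have "reach G (card ?A + (1 + card Q)) 1 ?S ?B"
      unfolding r_def
      by (intro reach_par reach_carry reach_units reach_carries Q)
        (use nn in \<open>auto simp: P_def intro!: aff_intros intro: aff_base\<close>)
    moreover have "insert ?v (P (Suc i) ` Q) \<subseteq> aff G ?B"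
    proof -
      have "P (Suc i) q \<in> aff G ?B" if q: "q \<in> Q" for q
      proof (rule aff_cong)
        let ?h = "\<lambda>x. P i q x + (\<Sum>c<n. g q (n*i+c) * (r c x - 2 * r (c+1) x + r (c+2) x))"
        have "r j \<in> aff G ?B" if "j \<le> n + 1" for j
          by (rule aff_base) (use that in blast)
        moreover have "P i q \<in> aff G ?B" by (rule aff_base) (use q in blast)
        ultimately show "?h \<in> aff G ?B" by (intro aff_intros) auto
        fix x
        have "r c x - 2 * r (c+1) x + r (c+2) x = (if v x = n*i+c then 1 else 0)" for c
        proof -
          have "real (n*i) - 1 + real c = real (n*i+c) - 1" "real (n*i) - 1 + real (c+1) = real (n*i+c)"
            "real (n*i) - 1 + real (c+2) = real (n*i+c) + 1" by auto
          then show ?thesis using relu_hat[of "v x" "n*i+c"] unfolding r_def by presburger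
        qed
        then have "(\<Sum>c<n. g q (n*i+c) * (r c x - 2 * r (c+1) x + r (c+2) x)) =
          (\<Sum>c<n. if v x = n*i+c then g q (n*i+c) else 0)"
          by (intro sum.cong refl) (simp only: mult_1_right mult_zero_right split: if_split, simp)
        also have "\<dots> = (if n*i \<le> v x \<and> v x < n*i+n then g q (v x) else 0)"
        proof (cases "n*i \<le> v x \<and> v x < n*i+n")
          case True
          then have "(v x = n*i+c) = (c = v x - n*i)" for c by auto
          moreover have "v x - n*i < n" using True by auto
          ultimately show ?thesis using True by (simp add: sum.delta)
        qed (auto intro!: sum.neutral)
        finally show "P (Suc i) q x = ?h x" by (auto simp: P_def)
      qed
      then show ?thesis by (auto intro: aff_base)
    qed
    ultimately have "reach G (card ?A + (1 + card Q)) 1 ?S (insert ?v (P (Suc i) ` Q))"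
      by (rule reach_out)
    then have "reach G (n + 3 + card Q) 1 ?S (insert ?v (P (Suc i) ` Q))"
      by (rule reach_width) simp
    from reach_trans[OF Suc.IH this] show ?case by simp
  qed
  have "(\<lambda>x. g q (v x)) \<in> aff G (insert ?v (P M ` Q))" if "q \<in> Q" for q
    by (rule aff_eq[of "P M q"]) (use that lt in \<open>auto simp: P_def\<close>)
  then show ?thesis by (intro reach_out[OF reach[of M]]) auto
qed

lemma nat_floor_div: "nat \<lfloor>real a / real b\<rfloor> = a div b"
  by (simp add: floor_divide_of_nat_eq)

lemma real_mod_eq: "real (a mod c) = real a - real c * real (a div c)"
  by (metis add_diff_cancel_left' mult_div_mod_eq of_nat_add of_nat_mult)

lemma reach_divmod:
  fixes v :: "'x \<Rightarrow> nat"
  assumes c: "c > 0" and lt: "\<And>x. x \<in> G \<Longrightarrow> v x < c * (n * M)"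
  shows "reach G (2*n+2) M {\<lambda>x. real (v x)} {\<lambda>x. real (v x div c), \<lambda>x. real (v x mod c)}"
proof -
  have "reach G (2*n+2) M {\<lambda>x. real (v x)} {\<lambda>x. real (v x), \<lambda>x. real (nat \<lfloor>real (v x) / real c\<rfloor>)}"
  \<comment> \<open>Integers below a threshold stay a full unit below it, so ramps of length 1 are
    exact on all of \<open>G\<close>.\<close>
  proof (rule reach_floor[where \<delta> = 1])
    fix x j assume "x \<in> G"
    show "real (v x) < real c * real (n * M)" using lt[OF \<open>x \<in> G\<close>]
      by (metis of_nat_less_iff of_nat_mult)
    show "real (v x) \<le> real c * real j - 1 \<or> real c * real j \<le> real (v x)"
    proof (cases "v x < c * j")
      case True
      then have "real (v x + 1) \<le> real (c * j)" by linarith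
      then show ?thesis by simp
    next
      case False
      then have "real (c * j) \<le> real (v x)" by linarith
      then show ?thesis by simp
    qed
  qed (use c in auto)
  then show ?thesis
  proof (rule reach_out)
    have "(\<lambda>x. real (v x mod c)) \<in> aff G {\<lambda>x. real (v x), \<lambda>x. real (v x div c)}"
      by (rule aff_cong[of "\<lambda>x. real (v x) - real c * real (v x div c)"])
        (auto intro!: aff_intros intro: aff_base simp: real_mod_eq)
    then show "{\<lambda>x. real (v x div c), \<lambda>x. real (v x mod c)}
      \<subseteq> aff G {\<lambda>x. real (v x), \<lambda>x. real (nat \<lfloor>real (v x) / real c\<rfloor>)}"
      by (auto simp: nat_floor_div intro: aff_base)
  qed
qed

text \<open>Each layer strips the leading digit in radix \<open>r\<close>: the quotient by the next
  lower power is below \<open>r\<close>, so \<open>r\<close> thresholds in one layer determine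
  it.\<close>

lemma reach_mod:
  fixes z :: "'x \<Rightarrow> nat"
  assumes r: "r > 0" and lt: "\<And>x. x \<in> G \<Longrightarrow> z x < r ^ e"
  shows "i \<le> e \<Longrightarrow> reach G (2*r+2) i {\<lambda>x. real (z x)} {\<lambda>x. real (z x mod r ^ (e - i))}"
proof (induction i)
  case 0
  then show ?case using lt by (auto intro!: aff_eq[of "\<lambda>x. real (z x)"])
next
  case (Suc i)
  let ?c = "r ^ (e - Suc i)"
  have e: "r ^ (e - i) = ?c * r" using Suc.prems by (metis Suc_diff_Suc less_eq_Suc_le power_Suc mult.commute)
  have "reach G (2*r+2) 1 {\<lambda>x. real (z x mod r ^ (e - i))}
     {\<lambda>x. real (z x mod r ^ (e - i) div ?c), \<lambda>x. real (z x mod r ^ (e - i) mod ?c)}"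
    by (rule reach_divmod) (use r e in auto)
  then have "reach G (2*r+2) 1 {\<lambda>x. real (z x mod r ^ (e - i))} {\<lambda>x. real (z x mod ?c)}"
    by (rule reach_out) (use e in \<open>auto simp: mod_mod_cancel intro: aff_base\<close>)
  from reach_trans[OF Suc.IH this] Suc.prems show ?case by simp
qed

text \<open>The base \<open>r ^ m\<close> digits of \<open>z\<close> are stripped from the top; when the counter reaches \<open>b\<close>, the
  remaining fraction (whose leading digit is the wanted one) is added to the output.\<close>

lemma reach_select_digit:
  fixes z b :: "'x \<Rightarrow> nat"
  assumes r: "r > 0" and z: "\<And>x. x \<in> G \<Longrightarrow> z x < (r^m) ^ M" and b: "\<And>x. x \<in> G \<Longrightarrow> b x < M"
  shows "reach G (2*r+6) (M*(m+2)) {\<lambda>x. real (z x), \<lambda>x. real (b x)}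
    {\<lambda>x. real (z x mod (r^m)^(M - b x)) / real ((r^m)^(M - b x))}"
proof -
  define y where "y j x = real (z x mod (r^m)^(M-j)) / real ((r^m)^(M-j))" for j x
  define out where "out j x = (if b x < j then y (b x) x else 0)" for j x
  let ?z = "\<lambda>j x. real (z x mod (r^m)^(M-j))" and ?b = "\<lambda>x. real (b x)"
  have y01: "0 \<le> y j x" "y j x \<le> 1" for j x
    using r by (auto simp: y_def divide_le_eq_1 simp del: of_nat_power intro!: less_imp_le)
  have out_nn: "0 \<le> out j x" for j x using y01 by (auto simp: out_def)
  \<comment> \<open>A round takes \<open>m + 2\<close> layers: one for the indicator of
    \<open>b x = j\<close>, one for the gated addition, and \<open>m\<close> to remove one digit in
    radix \<open>r ^ m\<close>.\<close>
  have reach: "j \<le> M \<Longrightarrow> reach G (2*r+6) (j*(m+2)) {\<lambda>x. real (z x), ?b} {?z j, ?b, out j}" for j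
  proof (induction j)
    case 0
    have "out 0 = (\<lambda>_. 0)" by (auto simp: out_def)
    moreover have "?z 0 \<in> aff G {\<lambda>x. real (z x), ?b}"
      by (rule aff_eq[of "\<lambda>x. real (z x)"]) (use z in auto)
    ultimately show ?case by (auto intro: aff_base aff_const)
  next
    case (Suc j)
    let ?ind = "\<lambda>x. if b x = j then 1 else 0 :: real"
    let ?S = "{?z j, ?b, out j}"
    have "reach G (1+(1+1)+(1+(1+1))) 1 ?S
       (({\<lambda>x. relu (?b x - (real j - 1))} \<union> ({\<lambda>x. relu (?b x - real j)} \<union> {\<lambda>x. relu (?b x - (real j + 1))}))
         \<union> ({?z j} \<union> ({?b} \<union> {out j})))" (is "reach _ _ _ _ ?B")
      by (intro reach_par reach_unit reach_carry) (use out_nn in \<open>auto intro!: aff_intros intro: aff_base\<close>)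
    moreover have ind: "?ind \<in> aff G ?B"
      by (rule aff_cong[of "\<lambda>x. relu (?b x - (real j - 1)) - 2 * relu (?b x - real j) + relu (?b x - (real j + 1))"])
        ((intro aff_intros; rule aff_base; blast), simp only: relu_hat)
    have "{?z j, ?b, out j, ?ind} \<subseteq> aff G ?B"
      by (intro insert_subset[THEN iffD2] conjI ind empty_subsetI; rule aff_base; blast)
    ultimately have "reach G (1+(1+1)+(1+(1+1))) 1 ?S {?z j, ?b, out j, ?ind}"
      by (rule reach_out)
    then have 1: "reach G 6 1 ?S {?z j, ?b, out j, ?ind}"
      by (rule reach_width) simp
    \<comment> \<open>Since \<open>y j\<close> lies in \<open>[0, 1]\<close>, the unit
      \<open>relu (y j x + ind - 1)\<close> equals \<open>y j x\<close> when \<open>b x = j\<close>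
      and vanishes otherwise, so the product with the indicator is exact.\<close>
    have "reach G (1+(1+(1+1))) 1 {?z j, ?b, out j, ?ind}
       ({\<lambda>x. relu (y j x + ?ind x - 1)} \<union> ({?z j} \<union> ({?b} \<union> {out j})))" (is "reach _ _ _ _ ?C")
      unfolding y_def
      by (intro reach_par reach_unit reach_carry)
        (use out_nn in \<open>auto simp: y_def intro!: aff_intros intro: aff_base\<close>)
    moreover have out: "out (Suc j) \<in> aff G ?C"
    proof (rule aff_cong)
      show "(\<lambda>x. out j x + relu (y j x + ?ind x - 1)) \<in> aff G ?C"
        by (rule aff_add) (auto intro: aff_base)
      show "out (Suc j) x = out j x + relu (y j x + ?ind x - 1)" for x
        using y01[of j x] by (auto simp: out_def relu_def max_def)
    qed
    have "{?z j, ?b, out (Suc j)} \<subseteq> aff G ?C"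
      by (intro insert_subset[THEN iffD2] conjI out empty_subsetI; rule aff_base; blast)
    ultimately have "reach G (1+(1+(1+1))) 1 {?z j, ?b, out j, ?ind} {?z j, ?b, out (Suc j)}"
      by (rule reach_out)
    then have 2: "reach G 4 1 {?z j, ?b, out j, ?ind} {?z j, ?b, out (Suc j)}"
      by (rule reach_width) simp
    have e: "(r^m)^(M-j) = r ^ (m*(M-j))" "(r^m)^(M-Suc j) = r ^ (m*(M-j) - m)"
      using Suc.prems by (simp_all add: power_mult[symmetric] diff_mult_distrib2 add.commute)
    have mj: "m \<le> m*(M-j)" using Suc.prems by (cases "M - j") auto
    have "reach G (2*r+2) m {\<lambda>x. real (z x mod r ^ (m*(M-j)))}
      {\<lambda>x. real (z x mod r ^ (m*(M-j)) mod r ^ (m*(M-j) - m))}"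
      by (rule reach_mod[OF r _ mj]) (use r in auto)
    then have "reach G (2*r+2) m {?z j} {?z (Suc j)}"
      by (simp add: e mod_mod_cancel le_imp_power_dvd)
    then have "reach G (2*r+2) m {?z j, ?b, out (Suc j)} {?z (Suc j)}"
      by (rule reach_in) (auto intro: aff_base)
    then have "reach G (2*r+2+(1+1)) m {?z j, ?b, out (Suc j)} ({?z (Suc j)} \<union> ({?b} \<union> {out (Suc j)}))"
      by (intro reach_par reach_carry) (use out_nn in \<open>auto intro: aff_base\<close>)
    then have "reach G (2*r+6) m {?z j, ?b, out (Suc j)} ({?z (Suc j)} \<union> ({?b} \<union> {out (Suc j)}))"
      by (rule reach_width) simp
    then have 3: "reach G (2*r+6) m {?z j, ?b, out (Suc j)} {?z (Suc j), ?b, out (Suc j)}"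
      by (simp only: Un_insert_left Un_empty_left)
    have "reach G (2*r+6) (1+(1+m)) ?S {?z (Suc j), ?b, out (Suc j)}"
      by (rule reach_trans[OF reach_width[OF 1] reach_trans[OF reach_width[OF 2] 3]]) simp_all
    then have "reach G (2*r+6) (m+2) ?S {?z (Suc j), ?b, out (Suc j)}" by (simp only: add.commute) simp
    from reach_trans[OF Suc.IH this] Suc.prems have
      "reach G (2*r+6) (j*(m+2) + (m+2)) {\<lambda>x. real (z x), ?b} {?z (Suc j), ?b, out (Suc j)}" by simp
    then show ?case by (simp only: mult_Suc add.commute)
  qed
  show ?thesis
    by (rule reach_out[OF reach[of M]])
      (use b in \<open>auto simp: out_def y_def intro!: aff_eq[of "out M"]\<close>)
qed

text \<open>The most significant digit comes first, matching the removal from the top: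
  \<open>d 0 * B ^ M\<close> is put above the number encoding the remaining digits.\<close>

lemma exists_digits:
  assumes "\<And>j. d j < (B::nat)"
  shows "\<exists>Z < B ^ M. \<forall>j < M. Z mod B ^ (M - j) div B ^ (M - Suc j) = d j"
  using assms
proof (induction M arbitrary: d)
  case 0
  then show ?case by auto
next
  case (Suc M)
  obtain Z where Z: "Z < B ^ M" "\<And>j. j < M \<Longrightarrow> Z mod B ^ (M - j) div B ^ (M - Suc j) = d (Suc j)"
    using Suc.IH[of "\<lambda>j. d (Suc j)"] Suc.prems by auto
  let ?Z = "d 0 * B ^ M + Z"
  have "?Z < Suc (d 0) * B ^ M" using Z(1) by simp
  also have "\<dots> \<le> B * B ^ M" using Suc.prems[of 0] by (intro mult_right_mono) auto
  finally have lt: "?Z < B ^ Suc M" by simp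
  have "?Z mod B ^ (Suc M - j) div B ^ (Suc M - Suc j) = d j" if "j < Suc M" for j
  proof (cases j)
    case 0
    moreover have "B ^ M \<noteq> 0" using Z(1) by linarith
    ultimately show ?thesis using lt Z(1) by (simp del: power_eq_0_iff power_not_zero)
  next
    case (Suc i)
    have "B ^ (M - i) dvd d 0 * B ^ M" by (simp add: le_imp_power_dvd)
    then have "?Z mod B ^ (M - i) = Z mod B ^ (M - i)" by (metis dvd_imp_mod_0 mod_add_left_eq add_0)
    then show ?thesis using Z(2)[of i] that Suc by simp
  qed
  then show ?case using lt by blast
qed

text \<open>With \<open>v = a * (N * M) + q * M + b\<close>, the address \<open>a\<close> takes
  \<open>N * M\<close> values and owns \<open>N\<close> integers of \<open>M\<close> digits in radix
  \<open>B\<close>. One table fetches all \<open>N\<close> integers, another decodes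
  \<open>q\<close> and \<open>b\<close>; then \<open>q\<close> selects the integer and
  \<open>b\<close> its digit. The output keeps the lower digits as well: \<open>B * y\<close> and
  \<open>B * t\<close> both lie between the wanted digit and its successor, which gives the error
  \<open>1 / B\<close>.\<close>

lemma reach_lookup:
  fixes v :: "'x \<Rightarrow> nat" and t :: "nat \<Rightarrow> real"
  assumes N: "N \<ge> 1" and M: "M \<ge> 1" and B: "B = (2*N)^m"
    and v: "\<And>x. x \<in> G \<Longrightarrow> v x < (N*M)^2" and t: "\<And>i. 0 \<le> t i" "\<And>i. t i \<le> 1"
  shows "\<exists>y. reach G (4*N+7) (M*(m+4)+1) {\<lambda>x. real (v x)} {y} \<and>
    (\<forall>x\<in>G. 0 \<le> y x \<and> y x \<le> 1 \<and> \<bar>y x - t (v x)\<bar> \<le> 1 / real B)"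
proof -
  have B0: "B > 0" using N B by simp
  \<comment> \<open>The minimum treats \<open>t i = 1\<close>, where the floor would be
    \<open>B\<close>, which is not a digit.\<close>
  define dg where "dg i = min (nat \<lfloor>real B * t i\<rfloor>) (B - 1)" for i
  have dg: "dg i < B" "real (dg i) \<le> real B * t i" "real B * t i \<le> real (dg i) + 1" for i
  proof -
    show "dg i < B" using B0 by (auto simp: dg_def)
    have nn: "0 \<le> real B * t i" using t by simp
    have le: "real B * t i \<le> real B" using t(2)[of i] by (simp add: mult_left_le)
    have "real (nat \<lfloor>real B * t i\<rfloor>) \<le> real B * t i" using nn by linarith
    then show "real (dg i) \<le> real B * t i"
      unfolding dg_def by (meson min.cobounded1 of_nat_le_iff order_trans)
    show "real B * t i \<le> real (dg i) + 1"
      using nn le B0 by (auto simp: dg_def min_def of_nat_diff)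
  qed
  have "\<exists>Z < B ^ M. \<forall>j < M. Z mod B ^ (M - j) div B ^ (M - Suc j) = dg (a * (N*M) + (q * M + j))" for a q
    by (rule exists_digits) (rule dg)
  then obtain Z where Z: "\<And>a q. Z a q < B ^ M"
    "\<And>a q j. j < M \<Longrightarrow> Z a q mod B ^ (M - j) div B ^ (M - Suc j) = dg (a * (N*M) + (q * M + j))"
    by metis
  define a where "a x = v x div (N*M)" for x
  define c where "c x = v x mod (N*M)" for x
  define q where "q x = c x div M" for x
  define b where "b x = c x mod M" for x
  define z where "z x = Z (a x) (q x)" for x
  have NM: "N * M > 0" using N M by simp
  have a: "a x < N * M" if "x \<in> G" for x
    using v[OF that] NM by (auto simp: a_def less_mult_imp_div_less power2_eq_square)
  have c: "c x < N * M" for x using NM by (auto simp: c_def)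
  have q: "q x < N" for x using c[of x] by (simp add: q_def less_mult_imp_div_less)
  have b: "b x < M" for x using M by (simp add: b_def)
  have vx: "v x = a x * (N*M) + (q x * M + b x)" for x
    unfolding a_def b_def c_def q_def by (simp only: div_mult_mod_eq)
  let ?a = "\<lambda>x. real (a x)" and ?c = "\<lambda>x. real (c x)"
  have 1: "reach G (4*N+7) M {\<lambda>x. real (v x)} {?a, ?c}"
    unfolding a_def c_def
    by (rule reach_width[OF reach_divmod[of _ G v N M]]) (use NM v in \<open>auto simp: power2_eq_square\<close>)
  \<comment> \<open>For \<open>p < N\<close> this is the indicator of \<open>q = p\<close>; the
    extra table \<open>p = N\<close> returns the digit position \<open>b\<close>.\<close>
  define g where "g = (\<lambda>p i. if p = N then real (i mod M) else if i div M = p then 1 else 0)"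
  define U where "U = (\<lambda>p x. real (Z (a x) p)) ` {..<N} \<union> (\<lambda>p x. g p (c x)) ` {..N}"
  have "reach G ((N + 3 + card {..<N}) + (N + 3 + card {..N})) M {?a, ?c} U"
    unfolding U_def
  proof (rule reach_par)
    have "reach G (N + 3 + card {..<N}) M {?a} ((\<lambda>p x. real (Z (a x) p)) ` {..<N})"
      by (rule reach_table[where g = "\<lambda>p a. real (Z a p)"]) (use a in auto)
    then show "reach G (N + 3 + card {..<N}) M {?a, ?c} ((\<lambda>p x. real (Z (a x) p)) ` {..<N})"
      by (rule reach_in) (auto intro: aff_base)
    have "reach G (N + 3 + card {..N}) M {?c} ((\<lambda>p x. g p (c x)) ` {..N})"
      by (rule reach_table) (use c in \<open>auto simp: g_def\<close>)
    then show "reach G (N + 3 + card {..N}) M {?a, ?c} ((\<lambda>p x. g p (c x)) ` {..N})"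
      by (rule reach_in) (auto intro: aff_base)
  qed
  then have 2: "reach G (4*N+7) M {?a, ?c} U" by (rule reach_width) simp
  \<comment> \<open>A multiplexer: every stored integer is below \<open>B ^ M\<close>, so
    subtracting \<open>B ^ M\<close> silences all of them except the one whose indicator adds it
    back.\<close>
  let ?h = "\<lambda>p x. relu (real (Z (a x) p) + real (B^M) * g p (c x) - real (B^M))"
  have ZU: "(\<lambda>x. real (Z (a x) p)) \<in> aff G U" "(\<lambda>x. g p (c x)) \<in> aff G U" if "p < N" for p
    using that by (auto simp: U_def intro!: aff_base)
  have gN: "(\<lambda>x. g N (c x)) \<in> aff G U" by (auto simp: U_def intro!: aff_base)
  have "reach G (card {..<N} + 1) 1 U (?h ` {..<N} \<union> {\<lambda>x. g N (c x)})"
    by (intro reach_par reach_units reach_carry aff_diff aff_add aff_scale aff_const ZU gN)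
      (auto simp: g_def)
  moreover have "{\<lambda>x. real (z x), \<lambda>x. real (b x)} \<subseteq> aff G (?h ` {..<N} \<union> {\<lambda>x. g N (c x)})"
  proof -
    have "(\<lambda>x. \<Sum>p<N. ?h p x) \<in> aff G (?h ` {..<N} \<union> {\<lambda>x. g N (c x)})"
      by (intro aff_sum aff_base) blast
    moreover have "(\<Sum>p<N. ?h p x) = real (z x)" for x
    proof -
      have "?h p x = (if q x = p then real (z x) else 0)" if "p < N" for p
        using Z(1)[of "a x" p] that
        by (auto simp: g_def q_def[symmetric] z_def relu_def max_def simp del: of_nat_power
            dest: less_imp_le)
      then have "(\<Sum>p<N. ?h p x) = (\<Sum>p<N. if q x = p then real (z x) else 0)" by simp
      also have "\<dots> = real (z x)" using q[of x] by (simp add: sum.delta)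
      finally show ?thesis .
    qed
    ultimately have "(\<lambda>x. real (z x)) \<in> aff G (?h ` {..<N} \<union> {\<lambda>x. g N (c x)})" by simp
    moreover have "(\<lambda>x. real (b x)) \<in> aff G (?h ` {..<N} \<union> {\<lambda>x. g N (c x)})"
      by (rule aff_eq[of "\<lambda>x. g N (c x)"]) (auto simp: g_def b_def)
    ultimately show ?thesis by simp
  qed
  ultimately have "reach G (card {..<N} + 1) 1 U {\<lambda>x. real (z x), \<lambda>x. real (b x)}" by (rule reach_out)
  then have 3: "reach G (4*N+7) 1 U {\<lambda>x. real (z x), \<lambda>x. real (b x)}"
    by (rule reach_width) simp
  define y where "y x = real (z x mod B^(M - b x)) / real (B^(M - b x))" for x
  have "reach G (2*(2*N)+6) (M*(m+2)) {\<lambda>x. real (z x), \<lambda>x. real (b x)} {y}"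
    unfolding y_def B
    by (rule reach_select_digit) (use N Z(1) b in \<open>auto simp: z_def B\<close>)
  then have 4: "reach G (4*N+7) (M*(m+2)) {\<lambda>x. real (z x), \<lambda>x. real (b x)} {y}"
    by (rule reach_width) simp
  have "reach G (4*N+7) (M + (M + (1 + M*(m+2)))) {\<lambda>x. real (v x)} {y}"
    by (rule reach_trans[OF 1 reach_trans[OF 2 reach_trans[OF 3 4]]])
  moreover have "M + (M + (1 + M*(m+2))) = M*(m+4)+1" by (simp add: algebra_simps)
  ultimately have R: "reach G (4*N+7) (M*(m+4)+1) {\<lambda>x. real (v x)} {y}" by simp
  have "0 \<le> y x \<and> y x \<le> 1 \<and> \<bar>y x - t (v x)\<bar> \<le> 1 / real B" for x
  proof -
    define w where "w = z x mod B^(M - b x)"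
    define P where "P = B^(M - Suc (b x))"
    define D where "D = dg (v x)"
    have P: "B^(M - b x) = B * P" "P > 0" using b[of x] B0
      by (auto simp: P_def Suc_diff_Suc simp flip: power_Suc)
    have "w div P = D" using Z(2)[OF b[of x], of "a x" "q x"] by (simp add: w_def P_def z_def D_def vx[symmetric])
    then have "D * P \<le> w" "w < (D + 1) * P" using P(2) div_mult_mod_eq[of w P] mod_less_divisor[OF P(2), of w]
      by (auto simp: algebra_simps)
    then have "real D * real P \<le> real w" "real w \<le> (real D + 1) * real P"
      by (metis of_nat_le_iff of_nat_mult, metis of_nat_le_iff of_nat_mult of_nat_Suc Suc_eq_plus1 less_imp_le add.commute)
    then have "real D \<le> real w / real P" "real w / real P \<le> real D + 1"
      using P(2) by (auto simp: field_simps)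
    moreover have "y x = real w / real (B * P)" unfolding y_def w_def P(1)[symmetric] ..
    then have "real B * y x = real w / real P" using B0 by simp
    ultimately have "\<bar>real B * y x - real B * t (v x)\<bar> \<le> 1" using dg(2,3)[of "v x"] by (simp add: D_def abs_le_iff)
    then have "real B * \<bar>y x - t (v x)\<bar> \<le> 1"
      by (metis abs_mult abs_of_nat right_diff_distrib)
    then have "\<bar>y x - t (v x)\<bar> \<le> 1 / real B" using B0 by (simp add: field_simps)
    moreover have "w < B^(M - b x)" using B0 by (simp add: w_def)
    then have "real w \<le> real (B^(M - b x))" by (simp only: of_nat_le_iff)
    then have "y x \<le> 1" using B0 by (auto simp: y_def w_def[symmetric] divide_le_eq_1 simp del: of_nat_power)
    moreover have "0 \<le> y x" by (simp add: y_def)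
    ultimately show ?thesis by blast
  qed
  with R show ?thesis by blast
qed

section \<open>Squares and products\<close>

text \<open>Interpolating \<open>bump\<close> linearly at the points \<open>j / n\<close> leaves exactly the error
  \<open>bump (zig n y) / n\<^sup>2\<close>, so iterating the zigzag yields the square with error of order \<open>n ^ (-2 m)\<close>.\<close>

definition zig :: "nat \<Rightarrow> real \<Rightarrow> real" where
  "zig n y = (let i = nat \<lfloor>real n * y\<rfloor>; w = real n * y - real i in if even i then w else 1 - w)"

definition bump :: "real \<Rightarrow> real" where
  "bump y = y - y\<^sup>2"

definition bump_pl :: "nat \<Rightarrow> real \<Rightarrow> real" where
  "bump_pl n y = bump y - bump (zig n y) / real n ^ 2"

text \<open>At \<open>w = 1\<close> the floor already jumps to \<open>Suc i\<close> with fractional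
  part 0; the change of parity makes both readings agree, which is the continuity of the
  zigzag.\<close>

lemma zig_cell:
  assumes "n \<ge> 1" "0 \<le> w" "w \<le> 1"
  shows "zig n ((real i + w) / real n) = (if even i then w else 1 - w)"
proof -
  have y: "real n * ((real i + w) / real n) = real i + w" using assms by simp
  show ?thesis
  proof (cases "w = 1")
    case True
    then have "nat \<lfloor>real i + w\<rfloor> = Suc i" by (metis floor_of_nat nat_int of_nat_Suc add.commute)
    then show ?thesis unfolding zig_def y using True by (auto simp: Let_def)
  next
    case False
    then have "\<lfloor>real i + w\<rfloor> = int i" using assms by (intro floor_unique) auto
    then show ?thesis unfolding zig_def y by (auto simp: Let_def)
  qed
qed

lemma cell_coords:
  assumes "n \<ge> 1" "0 \<le> y" "y \<le> 1"
  obtains i :: nat and w where "i < n" "0 \<le> w" "w \<le> 1" "y = (real i + w) / real n"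
proof (cases "y = 1")
  case True
  with that[of "n - 1" 1] assms show ?thesis by (auto simp: of_nat_diff)
next
  case False
  define i where "i = nat \<lfloor>real n * y\<rfloor>"
  have "real n * y < real n" using assms False by simp
  then have "i < n" using assms by (simp add: i_def nat_less_iff floor_less_iff)
  moreover have "0 \<le> real n * y" using assms by simp
  then have "real i \<le> real n * y" "real n * y \<le> real i + 1" unfolding i_def by linarith+
  ultimately show ?thesis using that[of i "real n * y - real i"] assms by auto
qed

lemma zig_bounds:
  assumes "n \<ge> 1" "0 \<le> y" "y \<le> 1"
  shows "0 \<le> zig n y" "zig n y \<le> 1"
  by (rule cell_coords[OF assms]; use zig_cell[OF assms(1)] in auto)+

lemma zig_iter_bounds:
  assumes "n \<ge> 1" "0 \<le> y" "y \<le> 1"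
  shows "0 \<le> (zig n ^^ i) y \<and> (zig n ^^ i) y \<le> 1"
  using assms zig_bounds[OF assms(1)] by (induction i) auto

lemma zig_affine_on_cells:
  assumes "n \<ge> 1" "0 \<le> w" "w \<le> 1"
  shows "zig n ((real i + w) / real n) = (1 - w) * zig n (real i / real n) + w * zig n (real (Suc i) / real n)"
  using zig_cell[OF assms, of i] zig_cell[OF assms(1), of 0 i] zig_cell[OF assms(1), of 0 "Suc i"]
  by simp

text \<open>On a cell, \<open>bump\<close> has quadratic part \<open>- w^2 / n^2\<close>, and
  subtracting \<open>(w - w^2) / n^2\<close> cancels it. The reflection in odd cells is harmless
  because \<open>bump (1 - w) = bump w\<close>.\<close>

lemma bump_pl_affine_on_cells:
  assumes "n \<ge> 1" "0 \<le> w" "w \<le> 1"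
  shows "bump_pl n ((real i + w) / real n) =
    (1 - w) * bump_pl n (real i / real n) + w * bump_pl n (real (Suc i) / real n)"
proof -
  have b: "bump (zig n ((real i + w) / real n)) = w - w\<^sup>2" "bump (zig n (real i / real n)) = 0"
    "bump (zig n (real (Suc i) / real n)) = 0"
    using zig_cell[OF assms, of i] zig_cell[OF assms(1), of 0 i] zig_cell[OF assms(1), of 0 "Suc i"]
    by (auto simp: bump_def power2_eq_square algebra_simps)
  show ?thesis unfolding bump_pl_def b using assms(1)
    by (simp add: bump_def power2_eq_square field_simps)
qed

lemma bump_bounds: "0 \<le> y \<Longrightarrow> y \<le> 1 \<Longrightarrow> 0 \<le> bump y" "bump y \<le> 1/4"
proof -
  show "0 \<le> bump y" if "0 \<le> y" "y \<le> 1"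
    using that mult_left_le[of y y] by (simp add: bump_def power2_eq_square)
  have "0 \<le> (y - 1/2)\<^sup>2" by simp
  then show "bump y \<le> 1/4" by (simp add: bump_def power2_eq_square field_simps)
qed

text \<open>At the nodes it agrees with \<open>bump\<close>, which is nonnegative on the unit
  interval, and it is affine in between. The sign makes the square approximations decrease with
  \<open>m\<close>.\<close>

lemma bump_pl_nonneg:
  assumes "n \<ge> 1" "0 \<le> y" "y \<le> 1"
  shows "0 \<le> bump_pl n y"
proof (rule cell_coords[OF assms])
  fix i w assume iw: "i < n" "0 \<le> w" "w \<le> 1" "y = (real i + w) / real n"
  have "0 \<le> bump_pl n (real j / real n)" if "j \<le> n" for j
  proof -
    have "bump (zig n (real j / real n)) = 0"
      using zig_cell[OF assms(1), of 0 j] by (auto simp: bump_def)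
    then show ?thesis using that assms(1) by (auto simp: bump_pl_def intro!: bump_bounds)
  qed
  then have "0 \<le> bump_pl n (real i / real n)" "0 \<le> bump_pl n (real (Suc i) / real n)"
    using iw(1) by (auto simp del: of_nat_Suc)
  then show ?thesis using iw bump_pl_affine_on_cells[OF assms(1) iw(2,3), of i]
    by (simp del: of_nat_Suc)
qed

text \<open>Scaled by \<open>n\<close>, the difference of the units at consecutive knots measures
  the part of cell \<open>j\<close> lying below \<open>h x\<close>; weighting these parts with the
  increments \<open>?D j\<close> of \<open>g\<close> telescopes to \<open>g (h x)\<close>.\<close>

lemma piecewise_affine_reach:
  fixes g :: "real \<Rightarrow> real" and h :: "'x \<Rightarrow> real"
  assumes n: "n \<ge> 1" and h: "\<And>x. x \<in> G \<Longrightarrow> 0 \<le> h x \<and> h x \<le> 1"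
    and g: "\<And>i w. 0 \<le> w \<Longrightarrow> w \<le> 1 \<Longrightarrow>
      g ((real i + w) / real n) = (1 - w) * g (real i / real n) + w * g (real (Suc i) / real n)"
  shows "(\<lambda>x. g (h x)) \<in> aff G ((\<lambda>j x. relu (h x - real j / real n)) ` {..n})" (is "_ \<in> aff G ?S")
proof (rule aff_cong)
  let ?r = "\<lambda>j y. relu (y - real j / real n)"
  let ?D = "\<lambda>j. g (real (Suc j) / real n) - g (real j / real n)"
  let ?F = "\<lambda>y. g 0 + (\<Sum>j<n. (?D j * real n) * (?r j y - ?r (Suc j) y))"
  have "(\<lambda>x. relu (h x - real j / real n)) \<in> aff G ?S" if "j \<le> n" for j
    by (rule aff_base) (use that in blast)
  then show "(\<lambda>x. ?F (h x)) \<in> aff G ?S"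
    by (intro aff_add aff_const aff_sum aff_scale aff_diff) (simp_all del: of_nat_Suc)
  fix x assume "x \<in> G"
  obtain i w where iw: "i < n" "0 \<le> w" "w \<le> 1" "h x = (real i + w) / real n"
    using cell_coords[OF n] h[OF \<open>x \<in> G\<close>] by metis
  have r: "real n * (?r j (h x) - ?r (Suc j) (h x)) = (if j < i then 1 else if j = i then w else 0)" for j
  proof -
    have *: "?r j (h x) = relu (real i + w - real j) / real n" for j
      using n unfolding iw(4) by (simp add: relu_def diff_divide_distrib[symmetric] max_def divide_le_0_iff)
    have "real n * (?r j (h x) - ?r (Suc j) (h x)) = relu (real i + w - real j) - relu (real i + w - real (Suc j))"
      unfolding * using n by (simp add: field_simps)
    also have "\<dots> = (if j < i then 1 else if j = i then w else 0)"
      using iw(2,3) by (cases j i rule: linorder_cases) (auto simp: relu_def max_def)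
    finally show ?thesis .
  qed
  have "?F (h x) = g 0 + (\<Sum>j<n. ?D j * (if j < i then 1 else if j = i then w else 0))"
    by (simp only: mult.assoc r)
  also have "(\<Sum>j<n. ?D j * (if j < i then 1 else if j = i then w else 0)) =
     (\<Sum>j\<in>{..<i} \<union> {i}. ?D j * (if j < i then 1 else if j = i then w else 0))"
    by (rule sum.mono_neutral_right) (use iw in auto)
  also have "\<dots> = (\<Sum>j<i. ?D j) + ?D i * w"
    by (subst sum.union_disjoint) auto
  also have "(\<Sum>j<i. ?D j) = g (real i / real n) - g 0"
    using sum_lessThan_telescope[of "\<lambda>j. g (real j / real n)" i] by simp
  finally show "g (h x) = ?F (h x)" unfolding iw(4) using g[OF iw(2,3), of i] by (simp add: algebra_simps)
qed

text \<open>The closed form exhibits the error; the network follows the recursion in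
  \<open>m\<close>, which starts at \<open>y\<close> because \<open>y^2 + bump y = y\<close> and
  subtracts one interpolant per layer.\<close>

definition sqr_approx :: "nat \<Rightarrow> nat \<Rightarrow> real \<Rightarrow> real" where
  "sqr_approx n m y = y\<^sup>2 + bump ((zig n ^^ m) y) / real n ^ (2 * m)"

lemma sqr_approx_Suc:
  "sqr_approx n (Suc m) y = sqr_approx n m y - bump_pl n ((zig n ^^ m) y) / real n ^ (2 * m)"
  by (simp add: sqr_approx_def bump_pl_def diff_divide_distrib power2_eq_square)

lemma sqr_approx_bounds:
  assumes "n \<ge> 1" "0 \<le> y" "y \<le> 1"
  shows "y\<^sup>2 \<le> sqr_approx n m y" "sqr_approx n m y \<le> y\<^sup>2 + 1 / (4 * real n ^ (2 * m))"
    "0 \<le> sqr_approx n m y" "sqr_approx n m y \<le> 1"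
proof -
  have b: "0 \<le> bump ((zig n ^^ m) y)" "bump ((zig n ^^ m) y) \<le> 1/4"
    using bump_bounds zig_iter_bounds[OF assms] by auto
  show 1: "y\<^sup>2 \<le> sqr_approx n m y" using b by (simp add: sqr_approx_def)
  then show "0 \<le> sqr_approx n m y" by (meson order_trans zero_le_power2)
  have "bump ((zig n ^^ m) y) / real n ^ (2 * m) \<le> (1/4) / real n ^ (2 * m)"
    using b by (intro divide_right_mono) auto
  then show "sqr_approx n m y \<le> y\<^sup>2 + 1 / (4 * real n ^ (2 * m))" by (simp add: sqr_approx_def)
  \<comment> \<open>The values decrease in \<open>m\<close> from \<open>y\<close>, hence never leave
    the unit interval; exact bounds rather than bounds up to an error let products be
    chained.\<close>
  have "sqr_approx n m y \<le> y"
  proof (induction m)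
    case 0
    then show ?case by (simp add: sqr_approx_def bump_def)
  next
    case (Suc m)
    have "0 \<le> bump_pl n ((zig n ^^ m) y) / real n ^ (2 * m)"
      using bump_pl_nonneg[OF assms(1)] zig_iter_bounds[OF assms] by auto
    then show ?case using Suc by (simp add: sqr_approx_Suc)
  qed
  then show "sqr_approx n m y \<le> 1" using assms by simp
qed

lemma reach_sqr:
  fixes h :: "'x \<Rightarrow> real"
  assumes n: "n \<ge> 1" and h: "\<And>x. x \<in> G \<Longrightarrow> 0 \<le> h x \<and> h x \<le> 1"
  shows "reach G (n + 2) m {h} {\<lambda>x. sqr_approx n m (h x)}"
proof -
  define z where "z m x = (zig n ^^ m) (h x)" for m x
  define s where "s m x = sqr_approx n m (h x)" for m x
  have z: "0 \<le> z m x \<and> z m x \<le> 1" if "x \<in> G" for m x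
    using zig_iter_bounds[OF n] h[OF that] by (simp add: z_def)
  have s: "0 \<le> s m x" if "x \<in> G" for m x
    using sqr_approx_bounds(3)[OF n] h[OF that] by (simp add: s_def)
  have "reach G (n + 2) m {h} {z m, s m}"
  proof (induction m)
    case 0
    have "z 0 = h" "s 0 = h" by (auto simp: z_def s_def sqr_approx_def bump_def)
    then show ?case by (auto intro: aff_base)
  next
    case (Suc m)
    let ?R = "(\<lambda>j x. relu (z m x - real j / real n)) ` {..n}"
    have "reach G (card {..n} + 1) 1 {z m, s m} (?R \<union> {s m})"
      by (intro reach_par reach_units reach_carry aff_diff aff_const) (use s in \<open>auto intro: aff_base\<close>)
    moreover have "{z (Suc m), s (Suc m)} \<subseteq> aff G (?R \<union> {s m})"
    proof -
      have "(\<lambda>x. zig n (z m x)) \<in> aff G ?R" "(\<lambda>x. bump_pl n (z m x)) \<in> aff G ?R"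
        using piecewise_affine_reach[OF n z, where g = "zig n"] zig_affine_on_cells[OF n]
          piecewise_affine_reach[OF n z, where g = "bump_pl n"] bump_pl_affine_on_cells[OF n] by auto
      then have zb: "(\<lambda>x. zig n (z m x)) \<in> aff G (?R \<union> {s m})"
          "(\<lambda>x. bump_pl n (z m x)) \<in> aff G (?R \<union> {s m})"
        using aff_mono[of ?R "?R \<union> {s m}" G] by blast+
      have "z (Suc m) = (\<lambda>x. zig n (z m x))"
        "s (Suc m) = (\<lambda>x. s m x - bump_pl n (z m x) / real n ^ (2 * m))"
        by (auto simp: z_def s_def sqr_approx_Suc)
      moreover have "(\<lambda>x. s m x - bump_pl n (z m x) / real n ^ (2 * m)) \<in> aff G (?R \<union> {s m})"
        by (intro aff_diff aff_divide zb aff_base) simp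
      ultimately show ?thesis using zb by simp
    qed
    ultimately have "reach G (card {..n} + 1) 1 {z m, s m} {z (Suc m), s (Suc m)}" by (rule reach_out)
    then have "reach G (n + 2) 1 {z m, s m} {z (Suc m), s (Suc m)}" by (rule reach_width) simp
    from reach_trans[OF Suc.IH this] show ?case by simp
  qed
  then show ?thesis by (rule reach_out) (auto simp: s_def[abs_def] intro!: aff_base)
qed

section \<open>Products by polarisation\<close>

definition mul_approx :: "nat \<Rightarrow> nat \<Rightarrow> real \<Rightarrow> real \<Rightarrow> real" where
  "mul_approx n m a b = sqr_approx n m (\<bar>a + b\<bar> / 2) - sqr_approx n m (\<bar>a - b\<bar> / 2)"

text \<open>Halving keeps both arguments of the square in \<open>[0, 1]\<close>. Both square errors
  are one-sided, in \<open>[0, 1 / (4 * n ^ (2 * m))]\<close>, so their difference does not double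
  the bound.\<close>

lemma mul_approx_bounds:
  assumes "n \<ge> 1" "\<bar>a\<bar> \<le> 1" "\<bar>b\<bar> \<le> 1"
  shows "\<bar>mul_approx n m a b\<bar> \<le> 1" "\<bar>mul_approx n m a b - a * b\<bar> \<le> 1 / (4 * real n ^ (2 * m))"
proof -
  have p: "0 \<le> \<bar>a + b\<bar> / 2" "\<bar>a + b\<bar> / 2 \<le> 1" and q: "0 \<le> \<bar>a - b\<bar> / 2" "\<bar>a - b\<bar> / 2 \<le> 1"
    using assms by auto
  note P = sqr_approx_bounds[OF assms(1) p, of m] and Q = sqr_approx_bounds[OF assms(1) q, of m]
  show "\<bar>mul_approx n m a b\<bar> \<le> 1" using P Q by (auto simp: mul_approx_def abs_le_iff)
  have "(\<bar>a + b\<bar> / 2)\<^sup>2 - (\<bar>a - b\<bar> / 2)\<^sup>2 = a * b"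
    by (simp add: power_divide power2_eq_square field_simps)
  then show "\<bar>mul_approx n m a b - a * b\<bar> \<le> 1 / (4 * real n ^ (2 * m))"
    using P(1,2) Q(1,2) unfolding mul_approx_def by linarith
qed

lemma reach_mul:
  fixes a b :: "'x \<Rightarrow> real"
  assumes n: "n \<ge> 1" and ab: "a \<in> aff G S" "b \<in> aff G S"
    and bd: "\<And>x. x \<in> G \<Longrightarrow> \<bar>a x\<bar> \<le> 1 \<and> \<bar>b x\<bar> \<le> 1"
  shows "reach G (2*n+4) (m+1) S {\<lambda>x. mul_approx n m (a x) (b x)}"
proof -
  let ?p = "\<lambda>x. \<bar>a x + b x\<bar> / 2" and ?q = "\<lambda>x. \<bar>a x - b x\<bar> / 2"
  have "reach G 2 1 S {\<lambda>x. \<bar>h x\<bar> / 2}" if h: "h \<in> aff G S" for h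
  proof -
    have "reach G (1 + 1) 1 S ({\<lambda>x. relu (h x)} \<union> {\<lambda>x. relu (- h x)})"
      by (intro reach_par reach_unit h aff_minus)
    moreover have "{\<lambda>x. \<bar>h x\<bar> / 2} \<subseteq> aff G ({\<lambda>x. relu (h x)} \<union> {\<lambda>x. relu (- h x)})"
    proof -
      have "(\<lambda>x. (relu (h x) + relu (- h x)) / 2) \<in> aff G ({\<lambda>x. relu (h x)} \<union> {\<lambda>x. relu (- h x)})"
        by (intro aff_divide aff_add; rule aff_base; blast)
      moreover have "(relu (h x) + relu (- h x)) / 2 = \<bar>h x\<bar> / 2" for x by (auto simp: relu_def)
      ultimately show ?thesis by simp
    qed
    ultimately have "reach G (1 + 1) 1 S {\<lambda>x. \<bar>h x\<bar> / 2}" by (rule reach_out)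
    then show ?thesis by (rule reach_width) simp
  qed
  then have "reach G (2 + 2) 1 S ({?p} \<union> {?q})"
    by (intro reach_par) (use ab aff_add aff_diff in blast)+
  then have 1: "reach G (2*n+4) 1 S ({?p} \<union> {?q})" by (rule reach_width) simp
  have "reach G ((n+2) + (n+2)) m ({?p} \<union> {?q}) ({\<lambda>x. sqr_approx n m (?p x)} \<union> {\<lambda>x. sqr_approx n m (?q x)})"
    by (rule reach_Un; rule reach_sqr[OF n]) (use bd in \<open>fastforce\<close>)+
  moreover have "{\<lambda>x. mul_approx n m (a x) (b x)} \<subseteq> aff G ({\<lambda>x. sqr_approx n m (?p x)} \<union> {\<lambda>x. sqr_approx n m (?q x)})"
  proof -
    have "(\<lambda>x. sqr_approx n m (?p x) - sqr_approx n m (?q x))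
       \<in> aff G ({\<lambda>x. sqr_approx n m (?p x)} \<union> {\<lambda>x. sqr_approx n m (?q x)})"
      by (intro aff_diff; rule aff_base; blast)
    then show ?thesis by (simp add: mul_approx_def)
  qed
  ultimately have "reach G ((n+2) + (n+2)) m ({?p} \<union> {?q}) {\<lambda>x. mul_approx n m (a x) (b x)}"
    by (rule reach_out)
  then have 2: "reach G (2*n+4) m ({?p} \<union> {?q}) {\<lambda>x. mul_approx n m (a x) (b x)}"
    by (rule reach_width) simp
  from reach_trans[OF 1 2] show ?thesis by (simp only: add.commute)
qed

fun chain_approx :: "nat \<Rightarrow> nat \<Rightarrow> ('c \<Rightarrow> 'x \<Rightarrow> real) \<Rightarrow> ('x \<Rightarrow> real) \<Rightarrow> 'c list \<Rightarrow> 'x \<Rightarrow> real" where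
  "chain_approx n m s p [] x = p x"
| "chain_approx n m s p (c # w) x = mul_approx n m (chain_approx n m s p w x) (s c x)"

text \<open>Partial products stay exactly within \<open>[-1, 1]\<close> and factors have absolute
  value at most 1, so earlier errors are never amplified and every multiplication only adds its
  own.\<close>

lemma chain_approx_bounds:
  assumes n: "n \<ge> 1" and p: "\<bar>p x\<bar> \<le> 1" and s: "\<And>c. c \<in> set w \<Longrightarrow> \<bar>s c x\<bar> \<le> 1"
  shows "\<bar>chain_approx n m s p w x\<bar> \<le> 1 \<and>
    \<bar>chain_approx n m s p w x - q * (\<Prod>c\<leftarrow>w. s c x)\<bar> \<le> \<bar>p x - q\<bar> + real (length w) / (4 * real n ^ (2 * m))"
  using s
proof (induction w)
  case Nil
  then show ?case using p by simp
next
  case (Cons c w)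
  let ?C = "chain_approx n m s p w x" and ?P = "q * (\<Prod>c\<leftarrow>w. s c x)"
  have IH: "\<bar>?C\<bar> \<le> 1" "\<bar>?C - ?P\<bar> \<le> \<bar>p x - q\<bar> + real (length w) / (4 * real n ^ (2 * m))"
    using Cons by auto
  have sc: "\<bar>s c x\<bar> \<le> 1" using Cons.prems by simp
  note M = mul_approx_bounds[OF n IH(1) sc, of m]
  have "\<bar>?C * s c x - ?P * s c x\<bar> = \<bar>?C - ?P\<bar> * \<bar>s c x\<bar>" by (simp add: abs_mult left_diff_distrib[symmetric])
  also have "\<dots> \<le> \<bar>?C - ?P\<bar>" using sc by (simp add: mult_left_le)
  finally have "\<bar>mul_approx n m ?C (s c x) - ?P * s c x\<bar> \<le> \<bar>?C - ?P\<bar> + 1 / (4 * real n ^ (2 * m))"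
    using M(2) by linarith
  then show ?case using M(1) IH(2) by (simp add: add_divide_distrib mult_ac)
qed

text \<open>The factors \<open>2 * t - 1\<close> are signed; carrying the nonnegative
  \<open>t\<close> instead takes one unit per coordinate, shared by all occurrences in the
  word.\<close>

lemma reach_chain:
  fixes t :: "'c \<Rightarrow> 'x \<Rightarrow> real"
  assumes n: "n \<ge> 1" and C: "finite C" and t: "\<And>c x. c \<in> C \<Longrightarrow> x \<in> G \<Longrightarrow> 0 \<le> t c x \<and> t c x \<le> 1"
    and p: "\<And>x. x \<in> G \<Longrightarrow> \<bar>p x\<bar> \<le> 1"
  shows "set w \<subseteq> C \<Longrightarrow> reach G (2*n + 4 + card C) (length w * (m+1)) (insert p (t ` C))
     (insert (chain_approx n m (\<lambda>c x. 2 * t c x - 1) p w) (t ` C))"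
proof (induction w)
  case Nil
  have "chain_approx n m (\<lambda>c x. 2 * t c x - 1) p [] = p" by auto
  then show ?case using aff_subset[of "insert p (t ` C)" G] by simp
next
  case (Cons c w)
  let ?s = "\<lambda>c x. 2 * t c x - 1"
  let ?S = "insert (chain_approx n m ?s p w) (t ` C)"
  have c: "c \<in> C" and w: "set w \<subseteq> C" using Cons.prems by auto
  have s: "\<bar>?s c x\<bar> \<le> 1" if "c \<in> C" "x \<in> G" for c x using t[OF that] by auto
  have "reach G ((2*n+4) + card C) (m+1) ?S
     ({\<lambda>x. mul_approx n m (chain_approx n m ?s p w x) (?s c x)} \<union> t ` C)"
  proof (intro reach_par reach_mul reach_carries n C)
    show "chain_approx n m ?s p w \<in> aff G ?S" by (rule aff_base) simp
    show "?s c \<in> aff G ?S" using c by (intro aff_diff aff_scale aff_const aff_base) simp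
    show "\<bar>chain_approx n m ?s p w x\<bar> \<le> 1 \<and> \<bar>?s c x\<bar> \<le> 1" if "x \<in> G" for x
      using chain_approx_bounds[where n = n and p = p and x = x and w = w and s = ?s and m = m] n p s c w that by blast
  qed (use t in \<open>auto intro: aff_base\<close>)
  then have "reach G (2*n+4 + card C) (m+1) ?S (insert (chain_approx n m ?s p (c # w)) (t ` C))"
    by (simp add: chain_approx.simps(2)[abs_def])
  note R = reach_trans[OF Cons.IH[OF w] this]
  have "length (c # w) * (m+1) = length w * (m+1) + (m+1)" by simp
  then show ?case using R by (simp only:)
qed

section \<open>Taylor expansion of Hoelder functions\<close>

text \<open>Subtracting the term of order \<open>m\<close> turns the highest derivative into the
  increment \<open>G m s - G m a\<close>, so the ordinary Taylor bound of order \<open>m - 1\<close>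
  applies with \<open>B\<close> in place of a bound on \<open>G m\<close>.\<close>

lemma taylor_real:
  fixes G :: "nat \<Rightarrow> real \<Rightarrow> real"
  assumes d: "\<And>i s. i < m \<Longrightarrow> s \<in> {0..1} \<Longrightarrow> (G i has_real_derivative G (Suc i) s) (at s within {0..1})"
    and B: "\<And>s. s \<in> closed_segment a b \<Longrightarrow> \<bar>G m s - G m a\<bar> \<le> B"
    and ab: "a \<in> {0..1}" "b \<in> {0..1}"
  shows "\<bar>G 0 b - (\<Sum>i\<le>m. G i a * (b - a) ^ i / fact i)\<bar> \<le> B * \<bar>b - a\<bar> ^ m"
proof (cases m)
  case 0
  then show ?thesis using B[of b] by simp
next
  case (Suc n)
  define F where "F i s = G i s - G m a * (s - a) ^ (m - i) / fact (m - i)" for i s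
  let ?S = "closed_segment a b"
  have S: "?S \<subseteq> {0..1}" using ab by (simp add: closed_segment_subset)
  have dF: "(F i has_real_derivative F (Suc i) s) (at s within ?S)" if "s \<in> ?S" "i \<le> n" for i s
  proof -
    have e: "m - i = Suc (m - Suc i)" using that Suc by simp
    have dG: "(G i has_real_derivative G (Suc i) s) (at s within ?S)"
      using d[of i s] that Suc S by (intro DERIV_subset[OF _ S]) auto
    have "((\<lambda>s. G m a * (s - a) ^ Suc (m - Suc i) / fact (Suc (m - Suc i))) has_real_derivative
        G m a * (s - a) ^ (m - Suc i) / fact (m - Suc i)) (at s within ?S)"
      by (rule derivative_eq_intros refl | simp)+
    then show ?thesis unfolding F_def[abs_def] e by (rule DERIV_diff[OF dG])
  qed
  have "norm (F 0 b - (\<Sum>i\<le>n. F i a * (b - a) ^ i / fact i)) \<le> B * norm (b - a) ^ Suc n / fact n"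
  proof (rule field_Taylor[where S = ?S])
    show "norm (F (Suc n) s) \<le> B" if "s \<in> ?S" for s using B[OF that] Suc by (simp add: F_def)
  qed (use dF in auto)
  moreover have "F 0 b - (\<Sum>i\<le>n. F i a * (b - a) ^ i / fact i) = G 0 b - (\<Sum>i\<le>m. G i a * (b - a) ^ i / fact i)"
  proof -
    have "F i a = G i a" if "i \<le> n" for i using that Suc by (simp add: F_def)
    then have "(\<Sum>i\<le>n. F i a * (b - a) ^ i / fact i) = (\<Sum>i\<le>n. G i a * (b - a) ^ i / fact i)" by simp
    then show ?thesis using Suc by (simp add: F_def)
  qed
  moreover have "B * \<bar>b - a\<bar> ^ Suc n / fact n \<le> B * \<bar>b - a\<bar> ^ Suc n"
  proof -
    have "0 \<le> B" using B[of a] by auto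
    moreover have "1 \<le> (fact n :: real)" by (rule fact_ge_1)
    ultimately show ?thesis
      using frac_le[of "B * \<bar>b - a\<bar> ^ Suc n" "B * \<bar>b - a\<bar> ^ Suc n" 1 "fact n"] by simp
  qed
  ultimately show ?thesis using Suc by simp
qed

lemma cube_update:
  assumes "x \<in> cube A" "c \<in> A"
  shows "x(c := s) \<in> cube A \<longleftrightarrow> s \<in> {0..1}"
  using assms by (auto simp: cube_def)

section \<open>Multi-indices and the words of differentiation directions\<close>

lemma finite_multi_indices_le:
  assumes "finite A"
  shows "finite {n \<in> multi_indices A. sum n A \<le> k}"
proof (rule finite_subset)
  show "{n \<in> multi_indices A. sum n A \<le> k} \<subseteq> {n. \<forall>x. (x \<in> A \<longrightarrow> n x \<in> {..k}) \<and> (x \<notin> A \<longrightarrow> n x = 0)}"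
  proof
    fix n assume n: "n \<in> {n \<in> multi_indices A. sum n A \<le> k}"
    have "n x \<le> k" if "x \<in> A" for x
      using member_le_sum[OF that, of n] n assms by simp
    then show "n \<in> {n. \<forall>x. (x \<in> A \<longrightarrow> n x \<in> {..k}) \<and> (x \<notin> A \<longrightarrow> n x = 0)}"
      using n by (simp add: multi_indices_def)
  qed
  show "finite {n. \<forall>x. (x \<in> A \<longrightarrow> n x \<in> {..k}) \<and> (x \<notin> A \<longrightarrow> n x = (0::nat))}"
    by (rule finite_set_of_finite_funs) (use assms in auto)
qed

lemma mi_list_Nil_iff: "(\<And>p. p \<in> set xs \<Longrightarrow> n p = 0) \<Longrightarrow> mi_list xs n = []"
  by (induction xs) (auto simp: mi_list_def)

lemma mi_list_append: "mi_list (xs @ ys) n = mi_list xs n @ mi_list ys n"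
  by (simp add: mi_list_def)

lemma mi_list_Cons: "mi_list (c # xs) n = replicate (n c) c @ mi_list xs n"
  by (simp add: mi_list_def)

lemma mi_list_cong: "(\<And>p. p \<in> set xs \<Longrightarrow> n p = m p) \<Longrightarrow> mi_list xs n = mi_list xs m"
  by (induction xs) (auto simp: mi_list_def)

lemma set_mi_list: "set (mi_list xs n) \<subseteq> set xs"
  by (auto simp: mi_list_def)

lemma length_mi_list: "distinct xs \<Longrightarrow> length (mi_list xs n) = sum n (set xs)"
  by (induction xs) (auto simp: mi_list_def)

lemma prod_mi_list: "distinct xs \<Longrightarrow> (\<Prod>c\<leftarrow>mi_list xs n. h c) = (\<Prod>c\<in>set xs. h c ^ n c)"
  by (induction xs) (auto simp: mi_list_def prod_list_replicate map_replicate)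

lemma mi_list_inj:
  assumes "distinct xs"
  shows "inj_on (mi_list xs) (multi_indices (set xs))"
proof
  fix n m assume nm: "n \<in> multi_indices (set xs)" "m \<in> multi_indices (set xs)" "mi_list xs n = mi_list xs m"
  have cnt: "count_list (mi_list xs n) p = (if p \<in> set xs then n p else 0)" for n p
  proof -
    have "count_list (replicate i a) p = (if a = p then i else 0)" for i a by (induction i) auto
    then show ?thesis using assms by (induction xs) (auto simp: mi_list_def)
  qed
  show "n = m"
  proof
    fix p show "n p = m p"
      using cnt[of n p] cnt[of m p] nm by (auto simp: multi_indices_def split: if_splits)
  qed
qed

text \<open>Multi-indices inject into words of length at most \<open>k\<close> over the coordinates.
  The resulting count is the factor \<open>(k + 1) * D ^ k\<close> in width and error.\<close>

lemma card_multi_indices_le: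
  assumes "distinct xs" "xs \<noteq> []"
  shows "card {n \<in> multi_indices (set xs). sum n (set xs) \<le> k} \<le> (k + 1) * length xs ^ k"
proof -
  let ?M = "{n \<in> multi_indices (set xs). sum n (set xs) \<le> k}"
  have "card ?M = card (mi_list xs ` ?M)"
    using mi_list_inj[OF assms(1)] by (intro card_image[symmetric]) (auto intro: inj_on_subset)
  also have "\<dots> \<le> card {w. set w \<subseteq> set xs \<and> length w \<le> k}"
    by (intro card_mono finite_lists_length_le)
      (auto simp: length_mi_list[OF assms(1)] dest: subsetD[OF set_mi_list])
  also have "\<dots> = (\<Sum>i\<le>k. length xs ^ i)"
    by (subst card_lists_length_le) (auto simp: distinct_card[OF assms(1)])
  also have "\<dots> \<le> (\<Sum>i\<le>k. length xs ^ k)"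
    using assms(2) by (intro sum_mono power_increasing) (auto simp: Suc_le_eq)
  finally show ?thesis by simp
qed

section \<open>Constants extracted from the Hoelder norm of one component\<close>

locale holder_function =
  fixes cs :: "'a list" and g :: "('a \<Rightarrow> real) \<Rightarrow> real" and \<beta> U :: real
  assumes dist: "distinct cs" and ne: "cs \<noteq> []" and \<beta>: "\<beta> > 0"
    and exist: "\<And>n. n \<in> multi_indices (set cs) \<Longrightarrow> real (sum n (set cs)) < \<beta> \<Longrightarrow> mi_deriv_exists cs n g"
    and norm: "(\<Sum>n\<in>{n\<in>multi_indices (set cs). real (sum n (set cs)) < \<beta>}.
            SUP x\<in>cube (set cs). ereal \<bar>mi_deriv cs n g x\<bar>)
        + (\<Sum>n\<in>{n\<in>multi_indices (set cs). sum n (set cs) = holder_k \<beta>}.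
            SUP x\<in>cube (set cs). SUP y\<in>cube (set cs) - {x}.
              ereal (\<bar>mi_deriv cs n g x - mi_deriv cs n g y\<bar>
                     / eucl_dist (set cs) x y powr holder_omega \<beta>))
        \<le> ereal U"
begin

definition "k = holder_k \<beta>"
definition "\<omega> = holder_omega \<beta>"
definition "\<Omega> = cube (set cs)"
abbreviation "MI \<equiv> multi_indices (set cs)"
abbreviation "D \<equiv> \<lambda>n. mi_deriv cs n g"

lemma k: "real k < \<beta>" "\<beta> \<le> real k + 1" and \<omega>: "0 < \<omega>" "\<omega> \<le> 1" "\<beta> = real k + \<omega>"
proof -
  have "real k = real_of_int (\<lceil>\<beta>\<rceil> - 1)" using \<beta> by (simp add: k_def holder_k_def)
  then show "real k < \<beta>" "\<beta> \<le> real k + 1" by linarith+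
  then show "0 < \<omega>" "\<omega> \<le> 1" "\<beta> = real k + \<omega>" by (auto simp: \<omega>_def holder_omega_def k_def[symmetric])
qed

lemma less_\<beta>_iff: "real m < \<beta> \<longleftrightarrow> m \<le> k"
  using k by linarith

lemma finite_MI: "finite {n\<in>MI. sum n (set cs) \<le> j}"
  by (rule finite_multi_indices_le) simp

lemma finite_MI_eq: "finite {n\<in>MI. sum n (set cs) = j}"
  by (rule finite_subset[OF _ finite_MI[of j]]) auto

lemma zero_in: "(\<lambda>_. 0) \<in> \<Omega>"
  by (simp add: \<Omega>_def cube_def)

text \<open>Retains that the constants \<open>H n\<close> sum to at most \<open>U\<close>, which is
  stronger than each being at most \<open>U\<close>; the Taylor bound then has no factor for the
  number of multi-indices.\<close>

lemma seminorm_exists: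
  shows "\<exists>H. (\<forall>n. 0 \<le> H n) \<and> (\<Sum>n\<in>{n\<in>MI. sum n (set cs) = k}. H n) \<le> U \<and>
    (\<forall>n\<in>MI. sum n (set cs) = k \<longrightarrow> (\<forall>x\<in>\<Omega>. \<forall>y\<in>\<Omega>. \<bar>D n x - D n y\<bar> \<le> H n * eucl_dist (set cs) x y powr \<omega>))"
    and deriv_bound: "\<And>n x. n \<in> MI \<Longrightarrow> sum n (set cs) \<le> k \<Longrightarrow> x \<in> \<Omega> \<Longrightarrow> \<bar>D n x\<bar> \<le> U"
proof -
  let ?A = "{n\<in>MI. sum n (set cs) \<le> k}" and ?B = "{n\<in>MI. sum n (set cs) = k}"
  define a where "a n = (SUP x\<in>\<Omega>. ereal \<bar>D n x\<bar>)" for n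
  define b where "b n = (SUP x\<in>\<Omega>. SUP y\<in>\<Omega> - {x}. ereal (\<bar>D n x - D n y\<bar> / eucl_dist (set cs) x y powr \<omega>))" for n
  have ab: "sum a ?A + sum b ?B \<le> ereal U"
    using norm unfolding a_def b_def \<Omega>_def \<omega>_def k_def[symmetric] less_\<beta>_iff .
  have a0: "0 \<le> a n" for n
    unfolding a_def by (rule SUP_upper2[OF zero_in]) simp
  \<comment> \<open>A second point of the cube: the inner supremum at the origin ranges over a
    nonempty set, hence is not minus infinity.\<close>
  define e where "e = (\<lambda>p. if p = hd cs then 1 else 0 :: real)"
  have e: "e \<in> \<Omega> - {\<lambda>_. 0}" using ne by (auto simp: e_def \<Omega>_def cube_def fun_eq_iff)
  have b0: "0 \<le> b n" for n
    unfolding b_def by (rule SUP_upper2[OF zero_in], rule SUP_upper2[OF e]) simp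
  have sa: "0 \<le> sum a ?A" and sb: "0 \<le> sum b ?B" using a0 b0 by (auto intro: sum_nonneg)
  have aU: "sum a ?A \<le> ereal U" using ab sb by (meson add_increasing2 order_trans order_refl)
  have bU: "sum b ?B \<le> ereal U" using ab sa by (meson add_increasing order_trans order_refl)
  show "\<bar>D n x\<bar> \<le> U" if "n \<in> MI" "sum n (set cs) \<le> k" "x \<in> \<Omega>" for n x
  proof -
    have "ereal \<bar>D n x\<bar> \<le> a n" unfolding a_def by (rule SUP_upper[OF that(3)])
    also have "a n = sum a {n}" by simp
    also have "\<dots> \<le> sum a ?A" by (rule sum_mono2) (use that a0 finite_MI in auto)
    finally show ?thesis using aU by (meson ereal_less_eq(3) order_trans)
  qed
  define H where "H n = (if n \<in> ?B then real_of_ereal (b n) else 0)" for n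
  have Hb: "ereal (H n) = b n" if "n \<in> ?B" for n
  proof -
    have "sum b {n} \<le> sum b ?B" by (rule sum_mono2) (use that b0 finite_MI_eq in auto)
    then have "b n \<le> sum b ?B" by simp
    then have "b n \<le> ereal U" using bU order_trans by blast
    then have "\<bar>b n\<bar> \<noteq> \<infinity>" using b0[of n] by auto
    then show ?thesis using that by (simp add: H_def ereal_real)
  qed
  have "\<forall>n. 0 \<le> H n" using b0 by (auto simp: H_def real_of_ereal_pos)
  moreover have "ereal (sum H ?B) \<le> ereal U"
  proof -
    have "(\<Sum>n\<in>?B. ereal (H n)) = sum b ?B" by (rule sum.cong) (use Hb in auto)
    then show ?thesis using bU by simp
  qed
  then have "sum H ?B \<le> U" by simp
  moreover have "\<bar>D n x - D n y\<bar> \<le> H n * eucl_dist (set cs) x y powr \<omega>"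
    if n: "n \<in> MI" "sum n (set cs) = k" and xy: "x \<in> \<Omega>" "y \<in> \<Omega>" for n x y
  proof (cases "x = y")
    case True
    then show ?thesis by (simp add: eucl_dist_def)
  next
    case False
    then obtain p where px: "x p \<noteq> y p" by (auto simp: fun_eq_iff)
    have "p \<in> set cs" by (rule ccontr) (use px xy in \<open>simp add: \<Omega>_def cube_def\<close>)
    note p = this px
    have "0 < (\<Sum>p\<in>set cs. (x p - y p)\<^sup>2)" by (rule sum_pos2[OF _ p(1)]) (use p in auto)
    then have E: "0 < eucl_dist (set cs) x y powr \<omega>" by (simp add: eucl_dist_def)
    have "ereal (\<bar>D n x - D n y\<bar> / eucl_dist (set cs) x y powr \<omega>) \<le> b n"
      unfolding b_def by (rule SUP_upper2[OF xy(1)], rule SUP_upper2[of y]) (use xy False in auto)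
    also have "\<dots> = ereal (H n)" using Hb n by simp
    finally show ?thesis using E by (simp add: divide_le_eq)
  qed
  ultimately show "\<exists>H. (\<forall>n. 0 \<le> H n) \<and> (\<Sum>n\<in>?B. H n) \<le> U \<and>
    (\<forall>n\<in>MI. sum n (set cs) = k \<longrightarrow> (\<forall>x\<in>\<Omega>. \<forall>y\<in>\<Omega>. \<bar>D n x - D n y\<bar> \<le> H n * eucl_dist (set cs) x y powr \<omega>))"
    by blast
qed

lemma U_nonneg: "0 \<le> U"
proof -
  have "(\<lambda>_. 0) \<in> MI" by (simp add: multi_indices_def)
  from deriv_bound[OF this _ zero_in] show ?thesis by simp
qed

text \<open>\<open>partial\<close> is a choice, meaningful only where a derivative exists; the
  assumed existence is used at the moved point \<open>x(c := s)\<close>. The line through the cube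
  in direction \<open>c\<close> is the unit interval, so end points get one-sided
  derivatives.\<close>

lemma has_partial_derivative:
  assumes n: "n \<in> MI" "sum n (set cs) \<le> k" and l: "mi_list cs n = c # w" and x: "x \<in> \<Omega>"
    and s: "s \<in> {0..1}" and w: "w = mi_list cs n'"
  shows "((\<lambda>s. D n' (x(c := s))) has_real_derivative D n (x(c := s))) (at s within {0..1})"
proof -
  have c: "c \<in> set cs" using set_mi_list[of cs n] l by auto
  let ?y = "x(c := s)"
  have y: "?y \<in> \<Omega>" using x c s cube_update[of x "set cs" c s] by (simp add: \<Omega>_def)
  have "mi_deriv_exists cs n g" using exist n less_\<beta>_iff by blast
  then have "has_partial \<Omega> c (pdiff \<Omega> w g) ?y"
    using y l unfolding mi_deriv_exists_def \<Omega>_def by (metis drop0 drop_Suc_Cons length_greater_0_conv list.discI nth_Cons_0)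
  then have "((\<lambda>s. pdiff \<Omega> w g (?y(c := s))) has_real_derivative partial \<Omega> c (pdiff \<Omega> w g) ?y)
     (at (?y c) within {s. ?y(c := s) \<in> \<Omega>})"
    unfolding has_partial_def partial_def by (rule someI_ex)
  moreover have "{s. ?y(c := s) \<in> \<Omega>} = {0..1}"
    using cube_update[OF x[unfolded \<Omega>_def] c] by (simp only: fun_upd_upd \<Omega>_def Collect_mem_eq)
  ultimately show ?thesis by (simp add: mi_deriv_def l w \<Omega>_def[symmetric])
qed

lemma D_zero: "D (\<lambda>_. 0) = g"
  by (simp add: mi_deriv_def mi_list_Nil_iff)

text \<open>For \<open>k = 0\<close> this is the Hoelder condition; otherwise the first derivative
  is bounded by \<open>U\<close> and \<open>\<delta> \<le> \<delta> powr \<omega>\<close>. It prices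
  the shift of one coordinate in the median.\<close>

lemma line_increment_bound:
  assumes x: "x \<in> \<Omega>" and c: "c \<in> set cs" and s: "s \<in> {0..1}" and \<delta>: "0 < \<delta>" "\<delta> \<le> 1" "\<bar>s - x c\<bar> \<le> \<delta>"
  shows "\<bar>g (x(c := s)) - g x\<bar> \<le> U * \<delta> powr \<omega>"
proof (cases "k = 0")
  case True
  obtain H where H: "\<And>n. 0 \<le> H n" "(\<Sum>n\<in>{n\<in>MI. sum n (set cs) = k}. H n) \<le> U"
    "\<And>n x y. n\<in>MI \<Longrightarrow> sum n (set cs) = k \<Longrightarrow> x\<in>\<Omega> \<Longrightarrow> y\<in>\<Omega> \<Longrightarrow> \<bar>D n x - D n y\<bar> \<le> H n * eucl_dist (set cs) x y powr \<omega>"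
    using seminorm_exists by blast
  let ?z = "\<lambda>_::'a. 0::nat"
  have z: "?z \<in> MI" "sum ?z (set cs) = k" using True by (auto simp: multi_indices_def)
  have "H ?z = sum H {?z}" by simp
  also have "\<dots> \<le> (\<Sum>n\<in>{n\<in>MI. sum n (set cs) = k}. H n)"
    by (rule sum_mono2[OF finite_MI_eq]) (use z H(1) in auto)
  finally have HU: "H ?z \<le> U" using H(2) by simp
  have y: "x(c := s) \<in> \<Omega>" using x c s cube_update[of x "set cs" c s] by (simp add: \<Omega>_def)
  have "(\<Sum>p\<in>set cs. ((x(c := s)) p - x p)\<^sup>2) = (\<Sum>p\<in>set cs. if p = c then (s - x c)\<^sup>2 else 0)"
    by (rule sum.cong) auto
  also have "\<dots> = (s - x c)\<^sup>2" using c by simp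
  finally have "eucl_dist (set cs) (x(c := s)) x = \<bar>s - x c\<bar>" by (simp add: eucl_dist_def)
  then have "\<bar>g (x(c := s)) - g x\<bar> \<le> H ?z * \<bar>s - x c\<bar> powr \<omega>"
    using H(3)[OF z y x] by (simp add: D_zero)
  also have "\<dots> \<le> U * \<delta> powr \<omega>"
    using HU H(1)[of ?z] U_nonneg \<delta> \<omega> by (intro mult_mono powr_mono2) auto
  finally show ?thesis .
next
  case False
  define n where "n = (\<lambda>p. if p = c then 1 else 0 :: nat)"
  have "sum n (set cs) = 1" using c by (simp add: n_def)
  then have n: "n \<in> MI" "sum n (set cs) \<le> k" using c False by (auto simp: n_def multi_indices_def)
  have l: "mi_list cs n = [c]"
  proof -
    obtain xs ys where cs: "cs = xs @ c # ys" using c by (meson split_list)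
    have "c \<notin> set xs" "c \<notin> set ys" using dist cs by auto
    then have "mi_list xs n = []" "mi_list ys n = []" by (auto intro!: mi_list_Nil_iff simp: n_def)
    then show ?thesis unfolding cs mi_list_append by (simp add: mi_list_Cons) (simp add: n_def)
  qed
  have d: "((\<lambda>s. g (x(c := s))) has_field_derivative D n (x(c := s))) (at s within {0..1})"
    if "s \<in> {0..1}" for s
    using has_partial_derivative[OF n l x that, of "\<lambda>_. 0"] by (simp add: mi_list_Nil_iff D_zero)
  have y: "x(c := s) \<in> \<Omega>" if "s \<in> {0..1}" for s using x c that cube_update[of x "set cs" c s] by (simp add: \<Omega>_def)
  have "x c \<in> {0..1}" using x c by (auto simp: \<Omega>_def cube_def)
  then have "norm (g (x(c := s)) - g (x(c := x c))) \<le> U * norm (s - x c)"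
    using deriv_bound[OF n y] by (intro field_differentiable_bound[OF _ d]) (use s in auto)
  also have "\<dots> \<le> U * \<delta> powr \<omega>"
  proof -
    have "\<delta> powr 1 \<le> \<delta> powr \<omega>" using \<delta> \<omega> by (intro powr_mono') auto
    then show ?thesis using \<delta> U_nonneg by (intro mult_left_mono) auto
  qed
  finally show ?thesis by simp
qed

section \<open>Taylor expansion one coordinate at a time\<close>

definition replace_coords :: "'a list \<Rightarrow> ('a \<Rightarrow> real) \<Rightarrow> ('a \<Rightarrow> real) \<Rightarrow> 'a \<Rightarrow> real" where
  "replace_coords ys x a = (\<lambda>p. if p \<in> set ys then a p else x p)"

text \<open>Mixed derivatives are only available in the order fixed by \<open>cs\<close> and need not commute.  Expanding
  in the last coordinate first produces exactly these derivatives, and each step only consumes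
  Hoelder seminorms of distinct multi-indices, so that a step costs no more than \<open>U * \<rho> powr \<beta>\<close>.\<close>

lemma taylor_along_suffix:
  assumes H: "\<And>n. 0 \<le> H n" "(\<Sum>n\<in>{n\<in>MI. sum n (set cs) = k}. H n) \<le> U"
    "\<And>n x y. n\<in>MI \<Longrightarrow> sum n (set cs) = k \<Longrightarrow> x\<in>\<Omega> \<Longrightarrow> y\<in>\<Omega> \<Longrightarrow> \<bar>D n x - D n y\<bar> \<le> H n * eucl_dist (set cs) x y powr \<omega>"
    and xa: "x \<in> \<Omega>" "a \<in> \<Omega>" and \<rho>: "0 < \<rho>" "\<And>p. p \<in> set cs \<Longrightarrow> \<bar>x p - a p\<bar> \<le> \<rho>"
  shows "cs = pre @ ys \<Longrightarrow>
    \<bar>g x - (\<Sum>n\<in>{n\<in>multi_indices (set ys). sum n (set ys) \<le> k}.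
       D n (replace_coords ys x a) * (\<Prod>p\<in>set ys. (x p - a p) ^ n p / fact (n p)))\<bar>
    \<le> real (length ys) * (U * \<rho> powr \<beta>)"
proof (induction ys arbitrary: pre)
  case Nil
  have "{n \<in> multi_indices ({} :: 'a set). sum n {} \<le> k} = {\<lambda>_. 0}" by (auto simp: multi_indices_def)
  then show ?case by (simp add: D_zero replace_coords_def)
next
  case (Cons c ys)
  let ?M = "{n\<in>multi_indices (set ys). sum n (set ys) \<le> k}"
  let ?M' = "{n\<in>multi_indices (set (c # ys)). sum n (set (c # ys)) \<le> k}"
  let ?h = "\<lambda>p. x p - a p"
  define w where "w n = (\<Prod>p\<in>set ys. ?h p ^ n p / fact (n p))" for n
  define y where "y = replace_coords ys x a"
  define y' where "y' = replace_coords (c # ys) x a"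
  \<comment> \<open>The order left for \<open>c\<close>, so that \<open>n(c := j n)\<close> has
    order exactly \<open>k\<close> and the remainder involves only its constant
    \<open>H\<close>.\<close>
  define j where "j n = k - sum n (set ys)" for n :: "'a \<Rightarrow> nat"
  have c: "c \<in> set cs" "c \<notin> set ys" "set ys \<subseteq> set cs" using Cons.prems dist by auto
  have y: "y \<in> \<Omega>" using xa by (auto simp: y_def \<Omega>_def cube_def replace_coords_def)
  have y': "y' = y(c := a c)" "y c = x c" using c by (auto simp: y_def y'_def replace_coords_def)
  have finM: "finite ?M" by (rule finite_multi_indices_le) simp
  have IH: "\<bar>g x - (\<Sum>n\<in>?M. D n y * w n)\<bar> \<le> real (length ys) * (U * \<rho> powr \<beta>)"
    using Cons.IH[of "pre @ [c]"] Cons.prems by (simp add: w_def y_def)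
  have sum_upd: "sum (n(c := i)) (set ys) = sum n (set ys)" for n i
    by (rule sum.cong) (use c in auto)
  have MI_upd: "n(c := i) \<in> MI" "sum (n(c := i)) (set cs) = i + sum n (set ys)" if "n \<in> ?M" for n i
  proof -
    show "n(c := i) \<in> MI" using that c by (auto simp: multi_indices_def)
    have "sum (n(c := i)) (set cs) = sum (n(c := i)) (insert c (set ys))"
      by (rule sum.mono_neutral_right) (use that c in \<open>auto simp: multi_indices_def\<close>)
    then show "sum (n(c := i)) (set cs) = i + sum n (set ys)"
      using c sum_upd[of n i] by (simp del: fun_upd_apply) simp
  qed
  have step: "\<bar>D n y - (\<Sum>i\<le>j n. D (n(c := i)) y' * ?h c ^ i / fact i)\<bar>
      \<le> (H (n(c := j n)) * \<rho> powr \<omega>) * \<bar>?h c\<bar> ^ j n" if n: "n \<in> ?M" for n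
  proof -
    define G where "G i s = D (n(c := i)) (y(c := s))" for i s
    have nc: "n c = 0" using n c by (auto simp: multi_indices_def)
    have "\<bar>G 0 (x c) - (\<Sum>i\<le>j n. G i (a c) * (x c - a c) ^ i / fact i)\<bar>
       \<le> (H (n(c := j n)) * \<rho> powr \<omega>) * \<bar>x c - a c\<bar> ^ j n"
    proof (rule taylor_real)
      fix i s assume i: "i < j n" and s: "s \<in> {0..1::real}"
      \<comment> \<open>The exponents on \<open>pre\<close> vanish, so the letters \<open>c\<close>
        lead the word and are the outermost derivatives; raising \<open>i\<close> prepends one more
        of them.\<close>
      have l: "mi_list cs (n(c := i)) = replicate i c @ mi_list ys n" for i
      proof -
        have "mi_list pre (n(c := i)) = []"
          by (rule mi_list_Nil_iff) (use n Cons.prems dist in \<open>auto simp: multi_indices_def\<close>)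
        moreover have "mi_list ys (n(c := i)) = mi_list ys n" by (rule mi_list_cong) (use c in auto)
        ultimately show ?thesis unfolding Cons.prems mi_list_append by (simp add: mi_list_def)
      qed
      show "(G i has_real_derivative G (Suc i) s) (at s within {0..1})"
        unfolding G_def
      proof (rule has_partial_derivative[OF MI_upd(1)[OF n] _ _ y s])
        show "sum (n(c := Suc i)) (set cs) \<le> k" using MI_upd(2)[OF n, of "Suc i"] i by (simp add: j_def)
        show "mi_list cs (n(c := Suc i)) = c # mi_list cs (n(c := i))" by (simp add: l)
      qed simp
    next
      fix s assume s: "s \<in> closed_segment (a c) (x c)"
      have ac: "a c \<in> {0..1}" "x c \<in> {0..1}" using xa c by (auto simp: \<Omega>_def cube_def)
      then have s01: "s \<in> {0..1}" using s closed_segment_subset[of "a c" "{0..1}" "x c"] by auto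
      have sd: "\<bar>s - a c\<bar> \<le> \<rho>"
        using \<rho>(2)[OF c(1)] s by (auto simp: closed_segment_eq_real_ivl split: if_splits)
      have in\<Omega>: "y(c := s) \<in> \<Omega>" "y(c := a c) \<in> \<Omega>"
        using cube_update[of y "set cs" c] y c s01 ac by (auto simp: \<Omega>_def)
      have "(\<Sum>p\<in>set cs. ((y(c := s)) p - (y(c := a c)) p)\<^sup>2) = (\<Sum>p\<in>set cs. if p = c then (s - a c)\<^sup>2 else 0)"
        by (rule sum.cong) auto
      also have "\<dots> = (s - a c)\<^sup>2" using c by simp
      finally have "eucl_dist (set cs) (y(c := s)) (y(c := a c)) = \<bar>s - a c\<bar>" by (simp add: eucl_dist_def)
      then have "\<bar>G (j n) s - G (j n) (a c)\<bar> \<le> H (n(c := j n)) * \<bar>s - a c\<bar> powr \<omega>"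
        using H(3)[OF MI_upd(1)[OF n] _ in\<Omega>, of "j n"] MI_upd(2)[OF n, of "j n"] n by (simp add: G_def j_def)
      also have "\<dots> \<le> H (n(c := j n)) * \<rho> powr \<omega>"
        using sd \<omega> H(1) by (intro mult_left_mono powr_mono2) auto
      finally show "\<bar>G (j n) s - G (j n) (a c)\<bar> \<le> H (n(c := j n)) * \<rho> powr \<omega>" .
    qed (use xa c in \<open>auto simp: \<Omega>_def cube_def\<close>)
    moreover have "G 0 (x c) = D n y" using y'(2) nc by (simp add: G_def fun_upd_idem)
    moreover have "G i (a c) = D (n(c := i)) y'" for i by (simp add: G_def y')
    ultimately show ?thesis by simp
  qed
  have w_le: "\<bar>w n\<bar> \<le> \<rho> ^ sum n (set ys)" for n
  proof -
    have "\<bar>w n\<bar> = (\<Prod>p\<in>set ys. \<bar>?h p\<bar> ^ n p / fact (n p))" by (simp add: w_def abs_prod power_abs)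
    also have "\<dots> \<le> (\<Prod>p\<in>set ys. \<rho> ^ n p)"
    proof (rule prod_mono, intro conjI)
      fix p assume p: "p \<in> set ys"
      have "\<bar>?h p\<bar> ^ n p / fact (n p) \<le> \<rho> ^ n p / 1"
        using \<rho>(2)[of p] p c \<rho>(1) by (intro frac_le power_mono) auto
      then show "\<bar>?h p\<bar> ^ n p / fact (n p) \<le> \<rho> ^ n p" by simp
    qed simp
    finally show ?thesis by (simp add: power_sum)
  qed
  have powr_\<beta>: "\<rho> powr \<beta> = \<rho> ^ k * \<rho> powr \<omega>"
    using \<rho>(1) by (subst \<omega>(3)) (simp add: powr_add powr_realpow)
  let ?T = "\<lambda>n. \<Sum>i\<le>j n. D (n(c := i)) y' * ?h c ^ i / fact i"
  have "\<bar>(\<Sum>n\<in>?M. D n y * w n) - (\<Sum>n\<in>?M. ?T n * w n)\<bar> \<le> (\<Sum>n\<in>?M. \<bar>D n y - ?T n\<bar> * \<bar>w n\<bar>)"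
    unfolding sum_subtractf[symmetric] left_diff_distrib[symmetric]
    by (rule order_trans[OF sum_abs]) (simp add: abs_mult)
  also have "\<dots> \<le> (\<Sum>n\<in>?M. H (n(c := j n)) * \<rho> powr \<beta>)"
  proof (rule sum_mono)
    fix n assume n: "n \<in> ?M"
    have "\<bar>?h c\<bar> ^ j n \<le> \<rho> ^ j n" using \<rho>(2)[OF c(1)] by (intro power_mono) auto
    then have "\<bar>D n y - ?T n\<bar> \<le> (H (n(c := j n)) * \<rho> powr \<omega>) * \<rho> ^ j n"
      using step[OF n] H(1) by (meson mult_left_mono mult_nonneg_nonneg order_trans powr_ge_zero)
    then have "\<bar>D n y - ?T n\<bar> * \<bar>w n\<bar> \<le> ((H (n(c := j n)) * \<rho> powr \<omega>) * \<rho> ^ j n) * \<rho> ^ sum n (set ys)"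
      using w_le[of n] H(1) \<rho>(1) by (intro mult_mono) auto
    also have "\<dots> = H (n(c := j n)) * \<rho> powr \<beta>"
      using n by (simp add: powr_\<beta> j_def power_add[symmetric] mult_ac)
    finally show "\<bar>D n y - ?T n\<bar> * \<bar>w n\<bar> \<le> H (n(c := j n)) * \<rho> powr \<beta>" .
  qed
  also have "\<dots> = (\<Sum>n\<in>?M. H (n(c := j n))) * \<rho> powr \<beta>" by (simp add: sum_distrib_right)
  also have "\<dots> \<le> U * \<rho> powr \<beta>"
  proof (rule mult_right_mono)
    have inj: "inj_on (\<lambda>n. n(c := j n)) ?M"
    proof
      fix n m assume nm: "n \<in> ?M" "m \<in> ?M" "n(c := j n) = m(c := j m)"
      then have "(n(c := j n))(c := 0) = (m(c := j m))(c := 0)" by simp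
      moreover have "n c = 0" "m c = 0" using nm c by (auto simp: multi_indices_def)
      ultimately show "n = m" by (simp add: fun_upd_idem)
    qed
    have "(\<Sum>n\<in>?M. H (n(c := j n))) = sum H ((\<lambda>n. n(c := j n)) ` ?M)"
      using sum.reindex[OF inj, of H] by simp
    also have "\<dots> \<le> (\<Sum>n\<in>{n\<in>MI. sum n (set cs) = k}. H n)"
    proof (rule sum_mono2[OF finite_MI_eq])
      show "(\<lambda>n. n(c := j n)) ` ?M \<subseteq> {n\<in>MI. sum n (set cs) = k}"
        using MI_upd by (auto simp: j_def)
    qed (use H in auto)
    finally show "(\<Sum>n\<in>?M. H (n(c := j n))) \<le> U" using H(2) by linarith
  qed simp
  finally have err: "\<bar>(\<Sum>n\<in>?M. D n y * w n) - (\<Sum>n\<in>?M. ?T n * w n)\<bar> \<le> U * \<rho> powr \<beta>" .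
  have "(\<Sum>n\<in>?M. ?T n * w n) = (\<Sum>(n, i)\<in>Sigma ?M (\<lambda>n. {..j n}). D (n(c := i)) y' * ?h c ^ i / fact i * w n)"
    by (subst sum.Sigma[symmetric]) (use finM in \<open>auto simp: sum_distrib_right\<close>)
  also have "\<dots> = (\<Sum>n\<in>?M'. D n y' * (\<Prod>p\<in>set (c # ys). ?h p ^ n p / fact (n p)))"
  \<comment> \<open>Splitting off the exponent of \<open>c\<close> matches pairs
    \<open>(n, i)\<close> with the multi-indices on \<open>c # ys\<close>.\<close>
  proof (rule sum.reindex_bij_witness[where i = "\<lambda>n. (n(c := 0), n c)" and j = "\<lambda>(n, i). n(c := i)"])
    fix u assume "u \<in> Sigma ?M (\<lambda>n. {..j n})"
    then obtain n i where u: "u = (n, i)" "n \<in> ?M" "i \<le> j n" by auto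
    have nc: "n c = 0" using u c by (auto simp: multi_indices_def)
    show "(((case u of (n, i) \<Rightarrow> n(c := i))(c := 0)), (case u of (n, i) \<Rightarrow> n(c := i)) c) = u"
      using u nc by (simp add: fun_upd_idem)
    show "(case u of (n, i) \<Rightarrow> n(c := i)) \<in> ?M'"
      using u c sum_upd[of n i] by (auto simp: multi_indices_def j_def)
    have "(\<Prod>p\<in>set ys. ?h p ^ (n(c := i)) p / fact ((n(c := i)) p)) = w n"
      unfolding w_def by (rule prod.cong) (use c in auto)
    then show "D (case u of (n, i) \<Rightarrow> n(c := i)) y' *
       (\<Prod>p\<in>set (c # ys). ?h p ^ (case u of (n, i) \<Rightarrow> n(c := i)) p / fact ((case u of (n, i) \<Rightarrow> n(c := i)) p)) =
       (case u of (n, i) \<Rightarrow> D (n(c := i)) y' * ?h c ^ i / fact i * w n)"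
      using u c by simp
  next
    fix n assume n: "n \<in> ?M'"
    show "(case (n(c := 0), n c) of (n, i) \<Rightarrow> n(c := i)) = n" by simp
    show "(n(c := 0), n c) \<in> Sigma ?M (\<lambda>n. {..j n})"
      using n c sum_upd[of n 0] by (auto simp: multi_indices_def j_def)
  qed
  finally have "(\<Sum>n\<in>?M. ?T n * w n) = (\<Sum>n\<in>?M'. D n y' * (\<Prod>p\<in>set (c # ys). ?h p ^ n p / fact (n p)))" .
  then show ?case using IH err unfolding y'_def[symmetric] by (simp add: distrib_right)
qed

text \<open>For \<open>k = 0\<close> the coordinatewise expansion would cost a factor
  \<open>D\<close>, while the target exponent may be only 1/2; there the Euclidean distance is used
  directly. For \<open>k \<ge> 1\<close> one has \<lfloor>\<beta>\<rfloor> \<ge> 1 and the factor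
  \<open>D\<close> fits.\<close>

lemma taylor_bound:
  assumes xa: "x \<in> \<Omega>" "a \<in> \<Omega>" and \<rho>: "0 < \<rho>" "\<And>p. p \<in> set cs \<Longrightarrow> \<bar>x p - a p\<bar> \<le> \<rho>"
  shows "\<bar>g x - (\<Sum>n\<in>{n\<in>MI. sum n (set cs) \<le> k}. D n a * (\<Prod>p\<in>set cs. (x p - a p) ^ n p / fact (n p)))\<bar>
    \<le> real (length cs) powr (if k = 0 then \<beta> / 2 else 1) * (U * \<rho> powr \<beta>)"
proof -
  obtain H where H: "\<And>n. 0 \<le> H n" "(\<Sum>n\<in>{n\<in>MI. sum n (set cs) = k}. H n) \<le> U"
    "\<And>n x y. n\<in>MI \<Longrightarrow> sum n (set cs) = k \<Longrightarrow> x\<in>\<Omega> \<Longrightarrow> y\<in>\<Omega> \<Longrightarrow> \<bar>D n x - D n y\<bar> \<le> H n * eucl_dist (set cs) x y powr \<omega>"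
    using seminorm_exists by blast
  show ?thesis
  proof (cases "k = 0")
    case False
    have "replace_coords cs x a = a"
      using xa by (auto simp: replace_coords_def \<Omega>_def cube_def)
    then show ?thesis using taylor_along_suffix[OF H xa \<rho>, of "[]" cs] False by simp
  next
    case True
    let ?z = "\<lambda>_::'a. 0::nat"
    have z: "?z \<in> MI" "sum ?z (set cs) = k" using True by (auto simp: multi_indices_def)
    have M: "{n\<in>MI. sum n (set cs) \<le> k} = {?z}"
      using True by (auto simp: multi_indices_def fun_eq_iff)
    have M': "{n\<in>MI. sum n (set cs) = k} = {?z}"
      using True by (auto simp: multi_indices_def fun_eq_iff)
    have HU: "H ?z \<le> U" using H(2) unfolding M' by simp
    have "(\<Sum>p\<in>set cs. (x p - a p)\<^sup>2) \<le> (\<Sum>p\<in>set cs. \<rho>\<^sup>2)"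
      using \<rho> by (intro sum_mono) (metis abs_le_square_iff abs_of_pos)
    then have "eucl_dist (set cs) x a \<le> sqrt (real (length cs) * \<rho>\<^sup>2)"
      by (simp add: eucl_dist_def distinct_card[OF dist])
    also have "\<dots> = sqrt (real (length cs)) * \<rho>" using \<rho>(1) by (simp add: real_sqrt_mult)
    finally have e: "eucl_dist (set cs) x a \<le> sqrt (real (length cs)) * \<rho>" .
    have "0 \<le> eucl_dist (set cs) x a" by (simp add: eucl_dist_def sum_nonneg)
    then have "eucl_dist (set cs) x a powr \<omega> \<le> (sqrt (real (length cs)) * \<rho>) powr \<omega>"
      using e \<omega> by (intro powr_mono2) auto
    also have "\<dots> = real (length cs) powr (\<beta> / 2) * \<rho> powr \<beta>"
    proof -
      have "\<omega> = \<beta>" using \<omega>(3) True by linarith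
      then show ?thesis using \<rho>(1) by (simp add: powr_mult powr_half_sqrt[symmetric] powr_powr)
    qed
    finally have E: "eucl_dist (set cs) x a powr \<omega> \<le> real (length cs) powr (\<beta> / 2) * \<rho> powr \<beta>" .
    have "\<bar>g x - g a\<bar> \<le> H ?z * eucl_dist (set cs) x a powr \<omega>"
      using H(3)[OF z xa] by (simp add: D_zero)
    also have "\<dots> \<le> U * (real (length cs) powr (\<beta> / 2) * \<rho> powr \<beta>)"
      using HU H(1)[of ?z] E U_nonneg by (intro mult_mono) auto
    finally show ?thesis using True unfolding M by (simp add: D_zero mult_ac)
  qed
qed

end

section \<open>Median correction\<close>

definition mid3 :: "real \<Rightarrow> real \<Rightarrow> real \<Rightarrow> real" where
  "mid3 a b c = a + b + c - max (max a b) c - min (min a b) c"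

lemma mid3_between:
  assumes "(lo \<le> a \<and> a \<le> hi \<and> lo \<le> b \<and> b \<le> hi) \<or> (lo \<le> a \<and> a \<le> hi \<and> lo \<le> c \<and> c \<le> hi)
    \<or> (lo \<le> b \<and> b \<le> hi \<and> lo \<le> c \<and> c \<le> hi)"
  shows "lo \<le> mid3 a b c \<and> mid3 a b c \<le> hi"
  using assms unfolding mid3_def max_def min_def by (auto split: if_splits)

text \<open>With \<open>a\<close> and \<open>c\<close> passed on as positive and negative parts,
  \<open>max a b = a + relu (b - a)\<close> and \<open>min a b = a - relu (a - b)\<close> are affine
  after one layer; comparing both with \<open>c\<close> takes the second.\<close>

lemma reach_mid3: "reach G 6 2 {a, b, c} {\<lambda>x. mid3 (a x) (b x) (c x)}"
proof -
  let ?S = "{a, b, c}"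
  let ?u = "\<lambda>x. relu (b x - a x)" and ?v = "\<lambda>x. relu (a x - b x)"
  let ?a = "\<lambda>x. relu (a x)" and ?a' = "\<lambda>x. relu (- a x)"
  let ?c = "\<lambda>x. relu (c x)" and ?c' = "\<lambda>x. relu (- c x)"
  have S: "a \<in> aff G ?S" "b \<in> aff G ?S" "c \<in> aff G ?S" by (auto intro: aff_base)
  have 1: "reach G (1+(1+(1+(1+(1+1))))) 1 ?S ({?u} \<union> ({?v} \<union> ({?a} \<union> ({?a'} \<union> ({?c} \<union> {?c'})))))"
    (is "reach _ _ _ _ ?T")
    by (intro reach_par reach_unit aff_diff aff_minus S)
  let ?m = "\<lambda>x. ?a x - ?a' x + ?u x" and ?n = "\<lambda>x. ?a x - ?a' x - ?v x" and ?C = "\<lambda>x. ?c x - ?c' x"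
  let ?B = "\<lambda>x. ?a x - ?a' x + ?u x - ?v x"
  have m: "?m \<in> aff G ?T" and n: "?n \<in> aff G ?T" and C: "?C \<in> aff G ?T"
    by (intro aff_diff aff_add; rule aff_base; blast)+
  have s: "(\<lambda>x. ?a x - ?a' x + ?B x + ?C x - ?m x - ?n x) \<in> aff G ?T"
    by (intro aff_diff aff_add; rule aff_base; blast)
  let ?s = "\<lambda>x. ?a x - ?a' x + ?B x + ?C x - ?m x - ?n x"
  have 2: "reach G (1+(1+(1+1))) 1 ?T ({\<lambda>x. relu (?C x - ?m x)} \<union> ({\<lambda>x. relu (?n x - ?C x)}
     \<union> ({\<lambda>x. relu (?s x)} \<union> {\<lambda>x. relu (- ?s x)})))" (is "reach _ _ _ _ ?V")
    by (intro reach_par reach_unit aff_diff[OF C m] aff_diff[OF n C] aff_minus s)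
  have "reach G 6 1 ?S ?T" by (rule reach_width[OF 1]) simp
  moreover have "reach G 6 1 ?T ?V" by (rule reach_width[OF 2]) simp
  ultimately have R: "reach G 6 (1 + 1) ?S ?V" by (rule reach_trans)
  have F: "(\<lambda>x. relu (?s x) - relu (- ?s x) - relu (?C x - ?m x) + relu (?n x - ?C x)) \<in> aff G ?V"
    by (intro aff_diff aff_add; rule aff_base; blast)
  have r: "relu y - relu (- y) = y" for y by (simp add: relu_def)
  have "mid3 (a x) (b x) (c x) = relu (?s x) - relu (- ?s x) - relu (?C x - ?m x) + relu (?n x - ?C x)" for x
    unfolding r mid3_def by (auto simp: relu_def max_def min_def)
  then have "(\<lambda>x. mid3 (a x) (b x) (c x)) \<in> aff G ?V" using F by simp
  then have "reach G 6 (1 + 1) ?S {\<lambda>x. mid3 (a x) (b x) (c x)}"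
    by (intro reach_out[OF R]) simp
  moreover have "1 + 1 = (2::nat)" by simp
  ultimately show ?thesis by (simp only:)
qed

section \<open>Shifting a single coordinate inside the cube\<close>

definition coords :: "'a set \<Rightarrow> (('a \<Rightarrow> real) \<Rightarrow> real) set" where
  "coords A = (\<lambda>p x. x p) ` A"

definition shift :: "'a \<Rightarrow> real \<Rightarrow> ('a \<Rightarrow> real) \<Rightarrow> 'a \<Rightarrow> real" where
  "shift p s x = x(p := max 0 (min 1 (x p + s)))"

lemma shift_cube: "p \<in> A \<Longrightarrow> x \<in> cube A \<Longrightarrow> shift p s x \<in> cube A"
  unfolding shift_def by (subst cube_update) auto

text \<open>Clamping to the unit interval is \<open>relu (x p + s) - relu (x p + s - 1)\<close>, so
  one layer prepares the shifted input and the given network is reused unchanged.\<close>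

lemma reach_shift:
  assumes A: "finite A" "p \<in> A" and W: "card A + 2 \<le> W" and r: "reach (cube A) W l (coords A) {\<phi>}"
  shows "reach (cube A) W (l + 1) (coords A) {\<lambda>x. \<phi> (shift p s x)}"
proof -
  let ?u = "\<lambda>x. relu (x p + s)" and ?v = "\<lambda>x. relu (x p + s - 1)"
  have p: "(\<lambda>x. x p) \<in> aff G (coords A)" for G using A by (auto simp: coords_def intro: aff_base)
  have "reach (cube A) (card A + (1 + 1)) 1 (coords A) ((\<lambda>p x. x p) ` A \<union> ({?u} \<union> {?v}))" (is "reach _ _ _ _ ?B")
    by (intro reach_par reach_unit reach_carries A aff_diff aff_add aff_const p)
      (auto simp: coords_def cube_def intro: aff_base)
  then have 1: "reach (cube A) W 1 (coords A) ?B" by (rule reach_width) (use W in simp)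
  have "reach (cube A) W l ((\<lambda>f. f \<circ> shift p s) ` coords A) ((\<lambda>f. f \<circ> shift p s) ` {\<phi>})"
    by (rule reach_comp[where \<tau> = "shift p s", OF _ r]) (rule shift_cube[OF A(2)])
  then have "reach (cube A) W l ((\<lambda>f. f \<circ> shift p s) ` coords A) {\<lambda>x. \<phi> (shift p s x)}"
    by (simp only: image_insert image_empty comp_def)
  moreover have "(\<lambda>f. f \<circ> shift p s) ` coords A \<subseteq> aff (cube A) ?B"
  proof safe
    fix f assume "f \<in> coords A"
    then obtain q where q: "q \<in> A" "f = (\<lambda>x. x q)" by (auto simp: coords_def)
    show "f \<circ> shift p s \<in> aff (cube A) ?B"
    proof (cases "q = p")
      case True
      have "(\<lambda>x. ?u x - ?v x) \<in> aff (cube A) ?B" by (intro aff_diff; rule aff_base; blast)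
      moreover have "(f \<circ> shift p s) = (\<lambda>x. ?u x - ?v x)"
        using q True by (auto simp: shift_def relu_def max_def min_def)
      ultimately show ?thesis by simp
    next
      case False
      then have "(f \<circ> shift p s) = (\<lambda>x. x q)" using q by (auto simp: shift_def)
      then show ?thesis using q by (auto intro: aff_base)
    qed
  qed
  ultimately have "reach (cube A) W l ?B {\<lambda>x. \<phi> (shift p s x)}" by (rule reach_in)
  from reach_trans[OF 1 this] show ?thesis by (simp only: add.commute)
qed

text \<open>Three copies side by side, one layer for the shifts and two for the median: one
  coordinate costs a factor 3 in width and three layers.\<close>

lemma reach_median_step:
  assumes A: "finite A" "p \<in> A" and W: "card A + 2 \<le> W" and r: "reach (cube A) W l (coords A) {\<phi>}"
  shows "reach (cube A) (3 * W) (l + 3) (coords A)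
    {\<lambda>x. mid3 (\<phi> (shift p (- s) x)) (\<phi> (shift p 0 x)) (\<phi> (shift p s x))}"
proof -
  let ?f = "\<lambda>s x. \<phi> (shift p s x)"
  have "reach (cube A) (W + (W + W)) (l + 1) (coords A) ({?f (- s)} \<union> ({?f 0} \<union> {?f s}))"
    by (intro reach_par reach_shift assms)
  then have 1: "reach (cube A) (3 * W) (l + 1) (coords A) ({?f (- s)} \<union> ({?f 0} \<union> {?f s}))"
    by (rule reach_width) simp
  have "reach (cube A) (3 * W) 2 {?f (- s), ?f 0, ?f s} {\<lambda>x. mid3 (?f (- s) x) (?f 0 x) (?f s x)}"
    by (rule reach_width[OF reach_mid3]) (use W in simp)
  then have 2: "reach (cube A) (3 * W) 2 ({?f (- s)} \<union> ({?f 0} \<union> {?f s})) {\<lambda>x. mid3 (?f (- s) x) (?f 0 x) (?f s x)}"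
    by (simp only: Un_insert_left Un_empty_left)
  have "l + 1 + 2 = l + 3" by simp
  then show ?thesis using reach_trans[OF 1 2] by (simp only:)
qed

text \<open>Points whose scaled coordinate lies just left of a grid point are those at which the
  steep ramps emulating floor functions are wrong.\<close>

definition near_grid :: "nat \<Rightarrow> real \<Rightarrow> real \<Rightarrow> bool" where
  "near_grid K \<delta> y \<longleftrightarrow> (\<exists>j<K. real j - \<delta> < real K * y \<and> real K * y < real j)"

text \<open>In the scaled coordinate the shifts lie \<delta> or \<open>2 * \<delta>\<close> apart.
  That is too far for one open bad interval of length \<delta>, and too close for two of them, whose
  points differ by more than \<open>1 - \<delta> \<ge> 2 * \<delta>\<close>. At most one shift is
  bad.\<close>

lemma near_grid_shifts:
  assumes y: "0 \<le> y" "y \<le> 1" and \<delta>: "0 < \<delta>" "\<delta> \<le> 1/3" "real K * s = \<delta>"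
  defines "z \<equiv> \<lambda>t. max 0 (min 1 (y + t))"
  shows "(\<not> near_grid K \<delta> (z (- s)) \<and> \<not> near_grid K \<delta> (z 0)) \<or> (\<not> near_grid K \<delta> (z (- s)) \<and> \<not> near_grid K \<delta> (z s))
    \<or> (\<not> near_grid K \<delta> (z 0) \<and> \<not> near_grid K \<delta> (z s))"
proof -
  have K: "real K > 0" using \<delta> by (cases "K = 0") auto
  have s: "s > 0" using K \<delta> by (metis zero_less_mult_pos)
  \<comment> \<open>Clamping cannot create bad points: 0 lies at the open end of a bad interval, and
    none is attached to the right end point as \<open>near_grid\<close> demands
    \<open>j < K\<close>.\<close>
  have exact: "near_grid K \<delta> (y + t)" if "near_grid K \<delta> (z t)" for t
  proof -
    obtain j where j: "j < K" "real j - \<delta> < real K * z t" "real K * z t < real j"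
      using \<open>near_grid K \<delta> (z t)\<close> by (auto simp: near_grid_def)
    have "z t < 1"
    proof -
      have "real j < real K" using j(1) by simp
      then have "real K * z t < real K * 1" using j(3) by linarith
      then show ?thesis using K by (simp only: mult_less_cancel_left_pos)
    qed
    moreover have "z t \<noteq> 0"
    proof
      assume "z t = 0"
      then have "real j < \<delta>" "0 < real j" using j by auto
      then show False using \<delta> by auto
    qed
    ultimately have "z t = y + t" by (auto simp: z_def max_def min_def split: if_splits)
    then show ?thesis using j by (auto simp: near_grid_def)
  qed
  have no2: "False" if t: "near_grid K \<delta> (y + t)" "near_grid K \<delta> (y + t')"
    "real K * t' - real K * t \<ge> \<delta>" "real K * t' - real K * t \<le> 2 * \<delta>" for t t'
  proof -
    obtain i j where i: "real i - \<delta> < real K * (y + t)" "real K * (y + t) < real i"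
      and j: "real j - \<delta> < real K * (y + t')" "real K * (y + t') < real j"
      using t by (auto simp: near_grid_def)
    have "real K * (y + t') - real K * (y + t) = real K * t' - real K * t" by (simp add: algebra_simps)
    then have "real i < real j" "real j < real i + 1" using i j t(3,4) \<delta>(1,2) by linarith+
    then have "real i < real j" "real j < real (i + 1)" by simp_all
    then show False unfolding of_nat_less_iff by simp
  qed
  have "\<not> (near_grid K \<delta> (z (- s)) \<and> near_grid K \<delta> (z 0))"
    using exact[of "- s"] exact[of 0] no2[of "- s" 0] \<delta> by auto
  moreover have "\<not> (near_grid K \<delta> (z (- s)) \<and> near_grid K \<delta> (z s))"
    using exact[of "- s"] exact[of s] no2[of "- s" s] \<delta> by auto
  moreover have "\<not> (near_grid K \<delta> (z 0) \<and> near_grid K \<delta> (z s))"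
    using exact[of 0] exact[of s] no2[of 0 s] \<delta> by auto
  ultimately show ?thesis by blast
qed


section \<open>The piecewise Taylor network\<close>

text \<open>The cap keeps the right endpoint \<open>y = 1\<close> in the last cell.\<close>

definition cell :: "nat \<Rightarrow> real \<Rightarrow> nat" where
  "cell K y = nat \<lfloor>min (real K * y) (real K - 1/2)\<rfloor>"

lemma cell_bounds:
  assumes "K \<ge> 1" "0 \<le> y" "y \<le> 1"
  shows "cell K y < K" "real (cell K y) \<le> real K * y" "real K * y \<le> real (cell K y) + 1"
proof -
  let ?u = "min (real K * y) (real K - 1/2)"
  have K: "real K \<ge> 1" using assms by simp
  have u: "0 \<le> ?u" "?u < real K" using assms K by auto
  have f: "real (cell K y) \<le> ?u" "?u < real (cell K y) + 1" unfolding cell_def using u by linarith+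
  show "cell K y < K" using f u by (metis le_less_trans of_nat_less_iff)
  show "real (cell K y) \<le> real K * y" using f by simp
  show "real K * y \<le> real (cell K y) + 1"
  proof (cases "real K * y \<le> real K - 1/2")
    case True
    then show ?thesis using f by simp
  next
    case False
    then have "real K < real (cell K y) + 3/2" using f by simp
    then have "real K < real (cell K y + 2)" by simp
    then have "K \<le> cell K y + 1" unfolding of_nat_less_iff by simp
    then have "real K \<le> real (cell K y) + 1" by (metis of_nat_1 of_nat_add of_nat_le_iff)
    moreover have "real K * y \<le> real K" using assms by (simp add: mult_left_le)
    ultimately show ?thesis by linarith
  qed
qed

text \<open>Up to \<open>(N * M)^2\<close> cells are too many thresholds to be tested one by one, so
  the cell number is found as two digits in radix \<open>c = N * M\<close>: first with stride
  \<open>c\<close>, then with stride 1 on the remainder, each in \<open>M\<close> layers.\<close>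

lemma reach_cell:
  fixes h :: "'x \<Rightarrow> real"
  assumes N: "N \<ge> 1" and M: "M \<ge> 1" and K: "K \<ge> 1" "K \<le> (N*M)^2" and \<delta>: "0 < \<delta>" "\<delta> \<le> 1/3"
    and h: "\<And>x. x \<in> G \<Longrightarrow> 0 \<le> h x \<and> h x \<le> 1" "\<And>x. x \<in> G \<Longrightarrow> \<not> near_grid K \<delta> (h x)"
  shows "reach G (2*N+4) (1 + 2*M) {h} {\<lambda>x. real (cell K (h x)), \<lambda>x. real K * h x - real (cell K (h x))}"
proof -
  define u where "u x = min (real K * h x) (real K - 1/2)" for x
  define c where "c = N * M"
  define a where "a x = nat \<lfloor>u x / real c\<rfloor>" for x
  define u' where "u' x = u x - real c * real (a x)" for x
  define b where "b x = nat \<lfloor>u' x / 1\<rfloor>" for x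
  have c: "c > 0" using N M by (simp add: c_def)
  have u: "0 \<le> u x" "u x < real K" if "x \<in> G" for x using h(1)[OF that] K by (auto simp: u_def)
  \<comment> \<open>Below \<open>K\<close> this is the absence of \<open>near_grid\<close>; from
    \<open>K\<close> on, the cap \<open>K - 1/2\<close> leaves a margin 1/2, which exceeds
    \<delta>.\<close>
  have gap: "u x \<le> real j - \<delta> \<or> real j \<le> u x" if "x \<in> G" for x and j :: nat
  proof (cases "j < K")
    case True
    then have "real j + 1 \<le> real K" by (metis Suc_leI of_nat_Suc of_nat_le_iff add.commute)
    moreover have "\<not> (real j - \<delta> < real K * h x \<and> real K * h x < real j)"
      using h(2)[OF that] True by (auto simp: near_grid_def)
    ultimately show ?thesis by (auto simp: u_def min_def)
  next
    case False
    then have "real K \<le> real j" by simp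
    then show ?thesis using \<delta> by (auto simp: u_def min_def)
  qed
  have h_aff: "h \<in> aff G {h}" by (rule aff_base) simp
  let ?r = "\<lambda>x. relu (real K * h x - (real K - 1/2))"
  have "reach G (1 + 1) 1 {h} ({h} \<union> {?r})"
    by (intro reach_par reach_carry reach_unit aff_diff aff_scale aff_const h_aff) (use h in auto)
  moreover have "u \<in> aff G ({h} \<union> {?r})"
  proof (rule aff_cong)
    show "(\<lambda>x. real K * h x - ?r x) \<in> aff G ({h} \<union> {?r})"
      by (intro aff_diff aff_scale; rule aff_base; blast)
    show "u x = real K * h x - ?r x" for x by (auto simp: u_def relu_def min_def max_def)
  qed
  then have "{h, u} \<subseteq> aff G ({h} \<union> {?r})"
    by (intro insert_subset[THEN iffD2] conjI empty_subsetI) (auto intro: aff_base)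
  ultimately have 1: "reach G (1 + 1) 1 {h} {h, u}" by (rule reach_out)
  have "reach G (2*N+2) M {u} {u, \<lambda>x. real (nat \<lfloor>u x / real c\<rfloor>)}"
  proof (rule reach_floor[where \<delta> = \<delta>])
    fix x :: 'x and j :: nat assume x: "x \<in> G"
    have "real K \<le> real (c * (N*M))" using K by (simp only: of_nat_le_iff c_def power2_eq_square)
    then show "u x < real c * real (N*M)" using u(2)[OF x] by simp
    show "u x \<le> real c * real j - \<delta> \<or> real c * real j \<le> u x"
      using gap[OF x, of "c * j"] by simp
  qed (use c \<delta> u in auto)
  then have "reach G (2*N+2) M {h, u} {u, \<lambda>x. real (a x)}"
    unfolding a_def by (rule reach_in) (auto intro: aff_base)
  then have "reach G ((2*N+2) + 1) M {h, u} ({u, \<lambda>x. real (a x)} \<union> {h})"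
    by (intro reach_par reach_carry) (use h in \<open>auto intro: aff_base\<close>)
  moreover have u'_aff: "u' \<in> aff G ({u, \<lambda>x. real (a x)} \<union> {h})"
    unfolding u'_def[abs_def] by (intro aff_diff aff_scale; rule aff_base; blast)
  have "{h, \<lambda>x. real (a x), u'} \<subseteq> aff G ({u, \<lambda>x. real (a x)} \<union> {h})"
    by (intro insert_subset[THEN iffD2] conjI empty_subsetI u'_aff; rule aff_base; blast)
  ultimately have 2: "reach G ((2*N+2) + 1) M {h, u} {h, \<lambda>x. real (a x), u'}" by (rule reach_out)
  have u': "0 \<le> u' x" "u' x < real c" if "x \<in> G" for x
  proof -
    have "0 \<le> u x / real c" using u(1)[OF that] by simp
    then have "real (a x) \<le> u x / real c" "u x / real c < real (a x) + 1" unfolding a_def by linarith+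
    then show "0 \<le> u' x" "u' x < real c" using c by (auto simp: u'_def field_simps)
  qed
  have "reach G (2*N+2) M {u'} {u', \<lambda>x. real (nat \<lfloor>u' x / 1\<rfloor>)}"
  proof (rule reach_floor[where \<delta> = \<delta>])
    fix x :: 'x and j :: nat assume x: "x \<in> G"
    show "u' x < 1 * real (N*M)" using u'(2)[OF x] by (simp add: c_def)
    show "u' x \<le> 1 * real j - \<delta> \<or> 1 * real j \<le> u' x"
      using gap[OF x, of "j + c * a x"] by (auto simp: u'_def)
  qed (use \<delta> u' in auto)
  then have "reach G (2*N+2) M {h, \<lambda>x. real (a x), u'} {u', \<lambda>x. real (b x)}"
    unfolding b_def by (rule reach_in) (auto intro: aff_base)
  then have "reach G ((2*N+2) + (1 + 1)) M {h, \<lambda>x. real (a x), u'} ({u', \<lambda>x. real (b x)} \<union> ({h} \<union> {\<lambda>x. real (a x)}))"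
    (is "reach _ _ _ _ ?S")
    by (intro reach_par reach_carry) (use h in \<open>auto intro: aff_base\<close>)
  moreover have "{\<lambda>x. real (cell K (h x)), \<lambda>x. real K * h x - real (cell K (h x))} \<subseteq> aff G ?S"
  proof -
    have eq: "real (cell K (h x)) = real c * real (a x) + real (b x)" if "x \<in> G" for x
    proof -
      have "cell K (h x) = nat \<lfloor>u x\<rfloor>" by (simp add: cell_def u_def)
      also have "u x = u' x + real (c * a x)" by (simp add: u'_def)
      also have "\<lfloor>u' x + real (c * a x)\<rfloor> = \<lfloor>u' x\<rfloor> + int (c * a x)" by linarith
      also have "nat \<dots> = b x + c * a x" using u'(1)[OF that] by (simp add: b_def nat_add_distrib nat_mult_distrib)
      finally show ?thesis by simp
    qed
    have "(\<lambda>x. real c * real (a x) + real (b x)) \<in> aff G ?S" "(\<lambda>x. real K * h x - (real c * real (a x) + real (b x))) \<in> aff G ?S"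
      by (intro aff_diff aff_scale aff_add; rule aff_base; blast)+
    from aff_cong[OF this(1)] aff_cong[OF this(2)] show ?thesis using eq by auto
  qed
  ultimately have 3: "reach G ((2*N+2) + (1 + 1)) M {h, \<lambda>x. real (a x), u'}
      {\<lambda>x. real (cell K (h x)), \<lambda>x. real K * h x - real (cell K (h x))}" by (rule reach_out)
  have "reach G (2*N+4) (1 + (M + M)) {h} {\<lambda>x. real (cell K (h x)), \<lambda>x. real K * h x - real (cell K (h x))}"
    by (rule reach_trans[OF reach_width[OF 1] reach_trans[OF reach_width[OF 2] reach_width[OF 3]]]) auto
  then show ?thesis by (simp only: mult_2)
qed

section \<open>Addresses of cells and networks for single monomials\<close>

fun horner_code :: "nat \<Rightarrow> 'a list \<Rightarrow> ('a \<Rightarrow> nat) \<Rightarrow> nat" where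
  "horner_code K [] \<theta> = 0"
| "horner_code K (c # xs) \<theta> = \<theta> c + K * horner_code K xs \<theta>"

lemma horner_code_less:
  "(\<And>c. c \<in> set xs \<Longrightarrow> \<theta> c < K) \<Longrightarrow> horner_code K xs \<theta> < K ^ length xs"
proof (induction xs)
  case (Cons c xs)
  then have "Suc (horner_code K xs \<theta>) \<le> K ^ length xs" by simp
  then have "K * Suc (horner_code K xs \<theta>) \<le> K * K ^ length xs" by (rule mult_le_mono2)
  then show ?case using Cons.prems[of c] by simp
qed simp

lemma horner_code_inj:
  assumes "horner_code K xs \<theta> = horner_code K xs \<theta>'"
    "\<And>c. c \<in> set xs \<Longrightarrow> \<theta> c < K \<and> \<theta>' c < K" "c \<in> set xs"
  shows "\<theta> c = \<theta>' c"
  using assms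
proof (induction xs)
  case (Cons d xs)
  have d: "\<theta> d < K" "\<theta>' d < K" using Cons.prems(2)[of d] by auto
  have e: "\<theta> d + K * horner_code K xs \<theta> = \<theta>' d + K * horner_code K xs \<theta>'" using Cons.prems(1) by simp
  have "(\<theta> d + K * horner_code K xs \<theta>) mod K = \<theta> d" "(\<theta>' d + K * horner_code K xs \<theta>') mod K = \<theta>' d"
    using d by auto
  then have "\<theta> d = \<theta>' d" using e by metis
  moreover have "horner_code K xs \<theta> = horner_code K xs \<theta>'" using calculation e d by simp
  ultimately show ?case using Cons by auto
qed simp

text \<open>The address is a fixed linear combination of the cell coordinates, so forming it costs
  no layer.\<close>

lemma horner_code_aff:
  "(\<And>c. c \<in> set xs \<Longrightarrow> (\<lambda>x. real (\<theta> x c)) \<in> aff G S) \<Longrightarrow> (\<lambda>x. real (horner_code K xs (\<theta> x))) \<in> aff G S"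
proof (induction xs)
  case Nil
  then show ?case by (simp add: aff_const)
next
  case (Cons c xs)
  then have "(\<lambda>x. real (\<theta> x c) + real K * real (horner_code K xs (\<theta> x))) \<in> aff G S"
    by (intro aff_add aff_scale) auto
  then show ?case by simp
qed

text \<open>\<open>C\<close> may be any bounded function of the cell. It is stored as
  \<open>(C + 1) / 2\<close> in \<open>[0, 1]\<close>, and undoing this doubles the lookup error,
  whence \<open>2 / (2 * N) ^ m\<close>. The factors are the local coordinates rescaled to
  \<open>[-1, 1]\<close>.\<close>

lemma reach_monomial:
  fixes xs :: "'a list" and K :: nat and C :: "('a \<Rightarrow> nat) \<Rightarrow> real"
  defines "\<theta> \<equiv> \<lambda>x p. if p \<in> set xs then cell K (x p) else 0"
  assumes N: "N \<ge> 1" and M: "M \<ge> 1" and xs: "distinct xs" "xs \<noteq> []"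
    and K: "K \<ge> 1" "K ^ length xs \<le> (N*M)^2" and \<delta>: "0 < \<delta>" "\<delta> \<le> 1/3"
    and G: "\<And>x p. x \<in> G \<Longrightarrow> p \<in> set xs \<Longrightarrow> 0 \<le> x p \<and> x p \<le> 1 \<and> \<not> near_grid K \<delta> (x p)"
    and C: "\<And>n. \<bar>C n\<bar> \<le> 1" and w: "set w \<subseteq> set xs"
  shows "\<exists>\<phi>. reach G (12 * N * length xs) (M*(m+6) + 2 + length w * (m+1)) (coords (set xs)) {\<phi>} \<and>
    (\<forall>x\<in>G. \<bar>\<phi> x - C (\<theta> x) * (\<Prod>c\<leftarrow>w. 2 * (real K * x c - real (\<theta> x c)) - 1)\<bar>
      \<le> 2 / (2 * real N) ^ m + real (length w) / (4 * (2 * real N) ^ (2 * m)))"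
proof -
  let ?D = "length xs"
  have D: "?D \<ge> 1" using xs by (simp add: Suc_le_eq)
  have card: "card (set xs) = ?D" by (rule distinct_card[OF xs(1)])
  define t where "t p x = real K * x p - real (\<theta> x p)" for p x
  have \<theta>: "\<theta> x p < K" "0 \<le> t p x \<and> t p x \<le> 1" if "x \<in> G" "p \<in> set xs" for x p
    using cell_bounds[OF K(1), of "x p"] G[OF that] that by (auto simp: \<theta>_def t_def)
  define A where "A = (\<Union>p\<in>set xs. {\<lambda>x. real (\<theta> x p), t p})"
  have "K ^ 1 \<le> K ^ ?D" using K D by (intro power_increasing) auto
  then have KNM: "K \<le> (N*M)^2" using K by simp
  have "reach G (card (set xs) * (2*N+4)) (1 + 2*M) (coords (set xs)) A"
    unfolding A_def
  proof (rule reach_UN_const)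
    fix p assume p: "p \<in> set xs"
    have "reach G (2*N+4) (1 + 2*M) {\<lambda>x. x p} {\<lambda>x. real (cell K (x p)), \<lambda>x. real K * x p - real (cell K (x p))}"
      by (rule reach_cell[OF N M K(1) KNM \<delta>]) (use G p in auto)
    then have "reach G (2*N+4) (1 + 2*M) {\<lambda>x. x p} {\<lambda>x. real (\<theta> x p), t p}"
      using p by (simp add: \<theta>_def t_def[abs_def])
    then show "reach G (2*N+4) (1 + 2*M) (coords (set xs)) {\<lambda>x. real (\<theta> x p), t p}"
      by (rule reach_in) (use p in \<open>auto simp: coords_def intro: aff_base\<close>)
  qed simp
  moreover have "?D * (2*N+4) \<le> 12 * N * ?D"
  proof -
    have "2*N+4 \<le> 12*N" using N by linarith
    then have "?D * (2*N+4) \<le> ?D * (12*N)" by (rule mult_le_mono2)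
    then show ?thesis by (simp only: mult_ac)
  qed
  ultimately have 1: "reach G (12 * N * ?D) (1 + 2*M) (coords (set xs)) A"
    using reach_width unfolding card by blast
  define v where "v x = horner_code K xs (\<theta> x)" for x
  have v: "v x < (N*M)^2" if "x \<in> G" for x
    using horner_code_less[of xs "\<theta> x" K] \<theta>(1)[OF that] K(2) by (fastforce simp: v_def)
  \<comment> \<open>The table is read off any point of \<open>G\<close> with the given address; by
    injectivity of the code the choice is immaterial. Addresses that do not occur get 0.\<close>
  define tab where "tab i = (if i \<in> v ` G then (C (\<theta> (inv_into G v i)) + 1) / 2 else 0)" for i
  have tab01: "0 \<le> tab i" "tab i \<le> 1" for i
    using C[of "\<theta> (inv_into G v i)"] by (auto simp: tab_def abs_le_iff)
  have tab: "tab (v x) = (C (\<theta> x) + 1) / 2" if x: "x \<in> G" for x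
  proof -
    let ?y = "inv_into G v (v x)"
    have y: "?y \<in> G" "v ?y = v x" using x inv_into_into[of "v x" v G] f_inv_into_f[of "v x" v G] by auto
    have "\<theta> ?y p = \<theta> x p" for p
    proof (cases "p \<in> set xs")
      case True
      then show ?thesis using horner_code_inj[of K xs "\<theta> ?y" "\<theta> x" p] y \<theta>(1) x by (simp add: v_def)
    qed (simp add: \<theta>_def)
    then have "\<theta> ?y = \<theta> x" by auto
    then show ?thesis using x by (simp add: tab_def)
  qed
  obtain y where y: "reach G (4*N+7) (M*(m+4)+1) {\<lambda>x. real (v x)} {y}"
    "\<And>x. x \<in> G \<Longrightarrow> 0 \<le> y x \<and> y x \<le> 1 \<and> \<bar>y x - tab (v x)\<bar> \<le> 1 / real ((2*N)^m)"
    using reach_lookup[OF N M refl, where m = m and G = G and v = v and t = tab] v tab01 by blast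
  have vA: "(\<lambda>x. real (v x)) \<in> aff G A"
    unfolding v_def by (rule horner_code_aff) (auto simp: A_def intro: aff_base)
  have "reach G (4*N+7) (M*(m+4)+1) A {y}"
    by (rule reach_in[OF y(1)]) (use vA in simp)
  then have "reach G ((4*N+7) + card (set xs)) (M*(m+4)+1) A ({y} \<union> t ` set xs)"
    by (intro reach_par reach_carries) (use \<theta>(2) in \<open>auto simp: A_def intro: aff_base\<close>)
  moreover define p where "p x = 2 * y x - 1" for x
  have "(\<lambda>x. 2 * y x - 1) \<in> aff G ({y} \<union> t ` set xs)"
    by (intro aff_diff aff_scale aff_const; rule aff_base; blast)
  then have "insert p (t ` set xs) \<subseteq> aff G ({y} \<union> t ` set xs)"
    using aff_subset[of "{y} \<union> t ` set xs" G] unfolding p_def[abs_def] by blast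
  ultimately have "reach G ((4*N+7) + card (set xs)) (M*(m+4)+1) A (insert p (t ` set xs))" by (rule reach_out)
  moreover have w12: "4*N+7 + ?D \<le> 12 * N * ?D"
  proof -
    have "1 * ?D \<le> N * ?D" "N * 1 \<le> N * ?D"
      by (rule mult_le_mono1[OF N], rule mult_le_mono2[OF D])
    moreover have "12 * N * ?D = 12 * (N * ?D)" by simp
    ultimately show ?thesis using N D by linarith
  qed
  ultimately have 2: "reach G (12 * N * ?D) (M*(m+4)+1) A (insert p (t ` set xs))"
    using reach_width unfolding card by blast
  let ?s = "\<lambda>c x. 2 * t c x - 1"
  have p1: "\<bar>p x\<bar> \<le> 1" if "x \<in> G" for x using y(2)[OF that] by (auto simp: p_def abs_le_iff)
  have n: "2 * N \<ge> 1" using N by simp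
  have "reach G (2*(2*N) + 4 + card (set xs)) (length w * (m+1)) (insert p (t ` set xs))
     (insert (chain_approx (2*N) m ?s p w) (t ` set xs))"
    by (rule reach_chain[OF n _ _ p1 w]) (use \<theta>(2) in auto)
  then have "reach G (2*(2*N) + 4 + card (set xs)) (length w * (m+1)) (insert p (t ` set xs)) {chain_approx (2*N) m ?s p w}"
    by (rule reach_out) (auto intro: aff_base)
  moreover have "2*(2*N) + 4 + ?D \<le> 12 * N * ?D" using w12 by simp
  ultimately have 3: "reach G (12 * N * ?D) (length w * (m+1)) (insert p (t ` set xs)) {chain_approx (2*N) m ?s p w}"
    using reach_width unfolding card by blast
  have "(1 + 2*M) + ((M*(m+4)+1) + length w * (m+1)) = M*(m+6) + 2 + length w * (m+1)"
    by (simp add: algebra_simps)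
  then have R: "reach G (12 * N * ?D) (M*(m+6) + 2 + length w * (m+1)) (coords (set xs)) {chain_approx (2*N) m ?s p w}"
    using reach_trans[OF 1 reach_trans[OF 2 3]] by (simp only:)
  have "\<bar>chain_approx (2*N) m ?s p w x - C (\<theta> x) * (\<Prod>c\<leftarrow>w. ?s c x)\<bar>
      \<le> 2 / (2 * real N) ^ m + real (length w) / (4 * (2 * real N) ^ (2 * m))" if x: "x \<in> G" for x
  proof -
    define e where "e = 1 / (2 * real N)^m"
    have "\<bar>y x - (C (\<theta> x) + 1) / 2\<bar> \<le> e" using y(2)[OF x] tab[OF x] by (simp add: e_def)
    then have "2 * \<bar>y x - (C (\<theta> x) + 1) / 2\<bar> \<le> 2 * e" by (rule mult_left_mono) simp
    moreover have "2 * \<bar>y x - (C (\<theta> x) + 1) / 2\<bar> = \<bar>2 * (y x - (C (\<theta> x) + 1) / 2)\<bar>" by (simp only: abs_mult abs_numeral)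
    moreover have "2 * (y x - (C (\<theta> x) + 1) / 2) = p x - C (\<theta> x)"
      by (simp add: p_def add_divide_distrib right_diff_distrib)
    ultimately have "\<bar>p x - C (\<theta> x)\<bar> \<le> 2 * e" by (simp only:)
    then have "\<bar>p x - C (\<theta> x)\<bar> \<le> 2 / (2 * real N)^m" by (simp add: e_def)
    moreover have "\<bar>chain_approx (2*N) m ?s p w x - C (\<theta> x) * (\<Prod>c\<leftarrow>w. ?s c x)\<bar>
      \<le> \<bar>p x - C (\<theta> x)\<bar> + real (length w) / (4 * real (2*N) ^ (2 * m))"
      using chain_approx_bounds[where n = "2*N" and p = p and x = x and w = w and s = ?s and m = m and q = "C (\<theta> x)"]
        n p1[OF x] \<theta>(2)[OF x] w by (fastforce simp: abs_le_iff)
    ultimately show ?thesis by simp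
  qed
  with R show ?thesis unfolding t_def by blast
qed

section \<open>Approximating one component on the whole cube\<close>

context holder_function
begin

text \<open>Coordinates in \<open>ps\<close> are already repaired. For the next one at least two of
  the three shifted points are good, and there \<psi> is close to \<open>g x\<close> up to one
  increment of \<open>g\<close>; a median lies between any bounds obeyed by two of its
  arguments.\<close>

lemma median_correction:
  assumes W: "length cs + 2 \<le> W" and r: "reach \<Omega> W l (coords (set cs)) {\<phi>}"
    and \<delta>: "0 < \<delta>" "\<delta> \<le> 1/3" "real K * s = \<delta>" "s \<le> 1"
    and app: "\<And>x. x \<in> \<Omega> \<Longrightarrow> (\<And>q. q \<in> set cs \<Longrightarrow> \<not> near_grid K \<delta> (x q)) \<Longrightarrow> \<bar>\<phi> x - g x\<bar> \<le> \<epsilon>"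
  shows "set ps \<subseteq> set cs \<Longrightarrow> \<exists>\<psi>. reach \<Omega> (3 ^ length ps * W) (l + 3 * length ps) (coords (set cs)) {\<psi>} \<and>
    (\<forall>x\<in>\<Omega>. (\<forall>q\<in>set cs - set ps. \<not> near_grid K \<delta> (x q)) \<longrightarrow> \<bar>\<psi> x - g x\<bar> \<le> \<epsilon> + real (length ps) * (U * s powr \<omega>))"
proof (induction ps)
  case Nil
  then show ?case using r app by (intro exI[of _ \<phi>]) auto
next
  case (Cons p ps)
  then obtain \<psi> where \<psi>: "reach \<Omega> (3 ^ length ps * W) (l + 3 * length ps) (coords (set cs)) {\<psi>}"
    "\<And>x. x\<in>\<Omega> \<Longrightarrow> (\<forall>q\<in>set cs - set ps. \<not> near_grid K \<delta> (x q)) \<Longrightarrow> \<bar>\<psi> x - g x\<bar> \<le> \<epsilon> + real (length ps) * (U * s powr \<omega>)"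
    by auto
  have p: "p \<in> set cs" using Cons.prems by simp
  have K: "real K > 0" using \<delta> by (cases "K = 0") auto
  have s0: "s > 0" using K \<delta> by (metis zero_less_mult_pos)
  let ?\<psi> = "\<lambda>x. mid3 (\<psi> (shift p (- s) x)) (\<psi> (shift p 0 x)) (\<psi> (shift p s x))"
  have W1: "W \<le> 3 ^ length ps * W" by simp
  have c: "card (set cs) + 2 \<le> 3 ^ length ps * W" using W W1 by (simp only: distinct_card[OF dist])
  have "reach \<Omega> (3 * (3 ^ length ps * W)) (l + 3 * length ps + 3) (coords (set cs)) {?\<psi>}"
    unfolding \<Omega>_def by (rule reach_median_step[OF _ p c \<psi>(1)[unfolded \<Omega>_def]]) simp
  moreover have "3 * (3 ^ length ps * W) = 3 ^ length (p # ps) * W" "l + 3 * length ps + 3 = l + 3 * length (p # ps)"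
    by auto
  ultimately have R: "reach \<Omega> (3 ^ length (p # ps) * W) (l + 3 * length (p # ps)) (coords (set cs)) {?\<psi>}"
    by (simp only:)
  let ?e = "\<epsilon> + real (length (p # ps)) * (U * s powr \<omega>)"
  have "\<bar>?\<psi> x - g x\<bar> \<le> ?e" if x: "x \<in> \<Omega>" and good: "\<forall>q\<in>set cs - set (p # ps). \<not> near_grid K \<delta> (x q)" for x
  proof -
    have xp: "0 \<le> x p" "x p \<le> 1" using x p by (auto simp: \<Omega>_def cube_def)
    have near: "g x - ?e \<le> \<psi> (shift p t x) \<and> \<psi> (shift p t x) \<le> g x + ?e"
      if t: "\<bar>t\<bar> \<le> s" and ng: "\<not> near_grid K \<delta> (max 0 (min 1 (x p + t)))" for t
    proof -
      let ?y = "shift p t x"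
      have y: "?y \<in> \<Omega>" using shift_cube[OF p] x by (simp add: \<Omega>_def)
      have "\<forall>q\<in>set cs - set ps. \<not> near_grid K \<delta> (?y q)"
        using good ng by (auto simp: shift_def)
      from \<psi>(2)[OF y this] have 1: "\<bar>\<psi> ?y - g ?y\<bar> \<le> \<epsilon> + real (length ps) * (U * s powr \<omega>)" .
      have "\<bar>g ?y - g x\<bar> \<le> U * s powr \<omega>"
        unfolding shift_def
        by (rule line_increment_bound[OF x p]) (use s0 \<delta> t xp in auto)
      moreover have "?e = \<epsilon> + real (length ps) * (U * s powr \<omega>) + U * s powr \<omega>"
        by (simp add: algebra_simps)
      ultimately show ?thesis using 1 by linarith
    qed
    have "g x - ?e \<le> ?\<psi> x \<and> ?\<psi> x \<le> g x + ?e"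
      by (rule mid3_between) (use near_grid_shifts[OF xp \<delta>(1-3)] near[of "- s"] near[of 0] near[of s] s0 in auto)
    then show ?thesis by linarith
  qed
  with R show ?case by blast
qed


text \<open>With \<open>a\<close> the cell centre, \<open>x p - a p = \<rho> * s x p\<close> where
  \<open>s\<close> lies in \<open>[-1, 1]\<close>. Each Taylor term is thus \<open>U\<close> times a
  table entry times a monomial in \<open>s\<close>, and the monomial networks run side by
  side.\<close>

lemma taylor_network:
  assumes N: "N \<ge> 1" and M: "M \<ge> 1" and K: "K \<ge> 1" "K ^ length cs \<le> (N*M)^2" and \<delta>: "0 < \<delta>" "\<delta> \<le> 1/3"
    and U: "U > 0"
  shows "\<exists>\<phi>. reach \<Omega> ((k + 1) * length cs ^ k * (12 * N * length cs)) (M*(m+6) + 2 + k * (m+1)) (coords (set cs)) {\<phi>} \<and>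
    (\<forall>x\<in>\<Omega>. (\<forall>q\<in>set cs. \<not> near_grid K \<delta> (x q)) \<longrightarrow>
      \<bar>\<phi> x - g x\<bar> \<le> real (length cs) powr (if k = 0 then \<beta> / 2 else 1) * (U * (1 / (2 * real K)) powr \<beta>)
        + real ((k + 1) * length cs ^ k) * (U * (2 / (2 * real N) ^ m + real k / (4 * (2 * real N) ^ (2 * m)))))"
proof -
  let ?D = "length cs" and ?M = "{n\<in>MI. sum n (set cs) \<le> k}"
  define G where "G = {x\<in>\<Omega>. \<forall>q\<in>set cs. \<not> near_grid K \<delta> (x q)}"
  define \<theta> where "\<theta> = (\<lambda>(x :: 'a \<Rightarrow> real) p. if p \<in> set cs then cell K (x p) else 0)"
  define \<rho> where "\<rho> = 1 / (2 * real K)"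
  define ctr where "ctr t p = (if p \<in> set cs then (real (t p) + 1/2) / real K else 0)" for t :: "'a \<Rightarrow> nat" and p
  define F where "F n = (\<Prod>p\<in>set cs. fact (n p) :: real)" for n :: "'a \<Rightarrow> nat"
  \<comment> \<open>Dividing by \<open>U\<close> and absorbing the half-width \<rho> and the
    factorials brings coefficients into \<open>[-1, 1]\<close>. The default 0 keeps them bounded for
    vectors \<open>t\<close> whose centre is outside the cube.\<close>
  define C where "C n t = (if ctr t \<in> \<Omega> then D n (ctr t) * \<rho> ^ sum n (set cs) / (F n * U) else 0)" for n t
  define s where "s = (\<lambda>x c. 2 * (real K * x c - real (\<theta> x c)) - 1)"
  define E where "E = 2 / (2 * real N) ^ m + real k / (4 * (2 * real N) ^ (2 * m))"
  have K0: "real K \<ge> 1" using K by simp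
  have \<rho>: "0 < \<rho>" "\<rho> \<le> 1" using K0 by (auto simp: \<rho>_def divide_le_eq)
  have F: "1 \<le> F n" for n unfolding F_def by (intro prod_ge_1) (simp add: fact_ge_1)
  have C1: "\<bar>C n t\<bar> \<le> 1" if n: "n \<in> ?M" for n t
  proof (cases "ctr t \<in> \<Omega>")
    case True
    have "\<bar>D n (ctr t)\<bar> * \<rho> ^ sum n (set cs) \<le> U * 1"
      using deriv_bound[of n "ctr t"] n True \<rho> by (intro mult_mono power_le_one) auto
    also have "\<dots> \<le> F n * U" using F[of n] U by simp
    finally have "\<bar>D n (ctr t)\<bar> * \<rho> ^ sum n (set cs) \<le> F n * U" .
    then show ?thesis using True F[of n] U \<rho> by (simp add: C_def abs_mult power_abs divide_le_eq)
  qed (simp add: C_def)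
  have "\<exists>\<phi>. reach G (12 * N * ?D) (M*(m+6) + 2 + k * (m+1)) (coords (set cs)) {\<phi>} \<and>
    (\<forall>x\<in>G. \<bar>\<phi> x - C n (\<theta> x) * (\<Prod>c\<leftarrow>mi_list cs n. s x c)\<bar> \<le> E)" if n: "n \<in> ?M" for n
  proof -
    have len: "length (mi_list cs n) \<le> k" using n by (simp add: length_mi_list[OF dist])
    have "\<exists>\<phi>. reach G (12 * N * ?D) (M*(m+6) + 2 + length (mi_list cs n) * (m+1)) (coords (set cs)) {\<phi>} \<and>
      (\<forall>x\<in>G. \<bar>\<phi> x - C n (\<theta> x) * (\<Prod>c\<leftarrow>mi_list cs n. s x c)\<bar>
        \<le> 2 / (2 * real N) ^ m + real (length (mi_list cs n)) / (4 * (2 * real N) ^ (2 * m)))"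
      unfolding s_def \<theta>_def
      by (rule reach_monomial[OF N M dist ne K \<delta> _ C1[OF n] set_mi_list])
        (auto simp: G_def \<Omega>_def cube_def)
    then obtain \<phi> where \<phi>: "reach G (12 * N * ?D) (M*(m+6) + 2 + length (mi_list cs n) * (m+1)) (coords (set cs)) {\<phi>}"
      "\<And>x. x\<in>G \<Longrightarrow> \<bar>\<phi> x - C n (\<theta> x) * (\<Prod>c\<leftarrow>mi_list cs n. s x c)\<bar>
        \<le> 2 / (2 * real N) ^ m + real (length (mi_list cs n)) / (4 * (2 * real N) ^ (2 * m))"
      by blast
    have "real (length (mi_list cs n)) / (4 * (2 * real N) ^ (2 * m)) \<le> real k / (4 * (2 * real N) ^ (2 * m))"
      using len by (intro divide_right_mono) auto
    \<comment> \<open>Monomials of lower degree are padded to the depth of degree \<open>k\<close>,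
      since parallel networks need equal depth.\<close>
    moreover have "reach G (12 * N * ?D) (M*(m+6) + 2 + k * (m+1)) (coords (set cs)) {\<phi>}"
      by (rule reach_pad[OF \<phi>(1)]) (use mult_le_mono1[OF len, of "m + 1"] in linarith)+
    ultimately show ?thesis using \<phi>(2) unfolding E_def by (intro exI[of _ \<phi>]) force
  qed
  then have "\<forall>n\<in>?M. \<exists>\<phi>. reach G (12 * N * ?D) (M*(m+6) + 2 + k * (m+1)) (coords (set cs)) {\<phi>} \<and>
    (\<forall>x\<in>G. \<bar>\<phi> x - C n (\<theta> x) * (\<Prod>c\<leftarrow>mi_list cs n. s x c)\<bar> \<le> E)" by (rule ballI)
  then obtain \<phi> where \<phi>_all: "\<forall>n\<in>?M. reach G (12 * N * ?D) (M*(m+6) + 2 + k * (m+1)) (coords (set cs)) {\<phi> n} \<and>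
    (\<forall>x\<in>G. \<bar>\<phi> n x - C n (\<theta> x) * (\<Prod>c\<leftarrow>mi_list cs n. s x c)\<bar> \<le> E)"
    by (rule bchoice[THEN exE])
  have \<phi>: "reach G (12 * N * ?D) (M*(m+6) + 2 + k * (m+1)) (coords (set cs)) {\<phi> n}"
    "x \<in> G \<Longrightarrow> \<bar>\<phi> n x - C n (\<theta> x) * (\<Prod>c\<leftarrow>mi_list cs n. s x c)\<bar> \<le> E" if n: "n \<in> ?M" for n x
  proof -
    note P = bspec[OF \<phi>_all n]
    show "reach G (12 * N * ?D) (M*(m+6) + 2 + k * (m+1)) (coords (set cs)) {\<phi> n}"
      by (rule conjunct1[OF P])
    show "\<bar>\<phi> n x - C n (\<theta> x) * (\<Prod>c\<leftarrow>mi_list cs n. s x c)\<bar> \<le> E" if "x \<in> G"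
      by (rule bspec[OF conjunct2[OF P] that])
  qed
  define \<Phi> where "\<Phi> x = (\<Sum>n\<in>?M. U * \<phi> n x)" for x
  have cardM: "card ?M \<le> (k + 1) * ?D ^ k" by (rule card_multi_indices_le[OF dist ne])
  have "reach G (card ?M * (12 * N * ?D)) (M*(m+6) + 2 + k * (m+1)) (coords (set cs)) (\<Union>n\<in>?M. {\<phi> n})"
    by (rule reach_UN_const[OF finite_MI \<phi>(1)])
  moreover have "\<Phi> \<in> aff G (\<Union>n\<in>?M. {\<phi> n})"
    unfolding \<Phi>_def[abs_def] by (intro aff_sum aff_scale aff_base) blast
  ultimately have "reach G (card ?M * (12 * N * ?D)) (M*(m+6) + 2 + k * (m+1)) (coords (set cs)) {\<Phi>}"
    using reach_out by blast
  then have "reach G ((k + 1) * ?D ^ k * (12 * N * ?D)) (M*(m+6) + 2 + k * (m+1)) (coords (set cs)) {\<Phi>}"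
    by (rule reach_width) (rule mult_le_mono1[OF cardM])
  \<comment> \<open>The network must be defined off \<open>G\<close> before the median can query it
    at bad points.\<close>
  from reach_extend[OF _ this, of "coords (set cs)"]
  obtain X where X: "\<And>x. x \<in> G \<Longrightarrow> X \<Phi> x = \<Phi> x"
    "reach UNIV ((k + 1) * ?D ^ k * (12 * N * ?D)) (M*(m+6) + 2 + k * (m+1)) (coords (set cs)) {X \<Phi>}"
    by (auto 4 4)
  have "\<bar>X \<Phi> x - g x\<bar> \<le> real ?D powr (if k = 0 then \<beta> / 2 else 1) * (U * \<rho> powr \<beta>) + real ((k + 1) * ?D ^ k) * (U * E)"
    if x: "x \<in> G" for x
  proof -
    have x\<Omega>: "x \<in> \<Omega>" using x by (simp add: G_def)
    have x01: "0 \<le> x p" "x p \<le> 1" if "p \<in> set cs" for p using x\<Omega> that by (auto simp: \<Omega>_def cube_def)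
    have cb: "cell K (x p) < K" "real (\<theta> x p) \<le> real K * x p" "real K * x p \<le> real (\<theta> x p) + 1"
      if "p \<in> set cs" for p using cell_bounds[OF K(1) x01[OF that]] that by (auto simp: \<theta>_def)
    define a where "a = ctr (\<theta> x)"
    have a\<Omega>: "a \<in> \<Omega>"
    proof -
      have "0 \<le> a p \<and> a p \<le> 1" if p: "p \<in> set cs" for p
      proof -
        have "real (cell K (x p)) + 1 \<le> real K" using cb(1)[OF p] by linarith
        then show ?thesis using p K0 by (auto simp: a_def ctr_def \<theta>_def divide_le_eq)
      qed
      then show ?thesis by (auto simp: \<Omega>_def cube_def a_def ctr_def)
    qed
    have diff: "x p - a p = \<rho> * s x p" if p: "p \<in> set cs" for p
      using p K0 by (simp add: a_def ctr_def \<rho>_def s_def field_simps)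
    have s1: "\<bar>s x p\<bar> \<le> 1" if "p \<in> set cs" for p using cb(2,3)[OF that] by (auto simp: s_def abs_le_iff)
    have "\<bar>x p - a p\<bar> \<le> \<rho>" if p: "p \<in> set cs" for p
      using s1[OF p] \<rho> by (simp add: diff[OF p] abs_mult mult_left_le)
    note T = taylor_bound[OF x\<Omega> a\<Omega> \<rho>(1) this]
    have monomial: "D n a * (\<Prod>p\<in>set cs. (x p - a p) ^ n p / fact (n p)) = U * (C n (\<theta> x) * (\<Prod>c\<leftarrow>mi_list cs n. s x c))"
      if n: "n \<in> ?M" for n
    proof -
      have "(\<Prod>p\<in>set cs. (x p - a p) ^ n p / fact (n p)) = (\<Prod>p\<in>set cs. \<rho> ^ n p * s x p ^ n p / fact (n p))"
        by (rule prod.cong) (auto simp: diff power_mult_distrib)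
      also have "\<dots> = \<rho> ^ sum n (set cs) * (\<Prod>p\<in>set cs. s x p ^ n p) / F n"
        by (simp add: prod_dividef prod.distrib power_sum F_def)
      finally show ?thesis using a\<Omega> U F[of n] by (simp add: C_def a_def[symmetric] prod_mi_list[OF dist])
    qed
    let ?t = "\<lambda>n. C n (\<theta> x) * (\<Prod>c\<leftarrow>mi_list cs n. s x c)"
    have "\<bar>\<Phi> x - (\<Sum>n\<in>?M. U * ?t n)\<bar> \<le> (\<Sum>n\<in>?M. U * E)"
    proof -
      have "\<bar>\<Phi> x - (\<Sum>n\<in>?M. U * ?t n)\<bar> = \<bar>\<Sum>n\<in>?M. U * (\<phi> n x - ?t n)\<bar>"
        by (simp add: \<Phi>_def sum_subtractf[symmetric] right_diff_distrib)
      also have "\<dots> \<le> (\<Sum>n\<in>?M. \<bar>U * (\<phi> n x - ?t n)\<bar>)" by (rule sum_abs)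
      also have "\<dots> \<le> (\<Sum>n\<in>?M. U * E)"
        using \<phi>(2)[OF _ x] U by (intro sum_mono) (auto simp: abs_mult intro!: mult_left_mono)
      finally show ?thesis .
    qed
    also have "\<dots> \<le> real ((k + 1) * ?D ^ k) * (U * E)"
    proof -
      have "0 \<le> E" by (simp add: E_def)
      then show ?thesis using cardM U by (simp only: sum_constant) (intro mult_right_mono of_nat_mono; simp)
    qed
    finally have 1: "\<bar>\<Phi> x - (\<Sum>n\<in>?M. U * ?t n)\<bar> \<le> real ((k + 1) * ?D ^ k) * (U * E)" .
    have "(\<Sum>n\<in>?M. U * ?t n) = (\<Sum>n\<in>?M. D n a * (\<Prod>p\<in>set cs. (x p - a p) ^ n p / fact (n p)))"
      by (rule sum.cong) (use monomial in auto)
    then show ?thesis using 1 T X(1)[OF x] by linarith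
  qed
  moreover have "reach \<Omega> ((k + 1) * ?D ^ k * (12 * N * ?D)) (M*(m+6) + 2 + k * (m+1)) (coords (set cs)) {X \<Phi>}"
    by (rule reach_subdomain[OF X(2)]) simp
  ultimately show ?thesis unfolding E_def \<rho>_def G_def by blast
qed

text \<open>The strip width \<delta> has no lower limit, as its inverse is merely a weight;
  \<open>s\<close> is taken so small that all \<open>D\<close> shifts together cost at most
  \<tau>.\<close>

lemma small_increment_exists:
  assumes "\<tau> > 0" "K \<ge> 1" "U > 0"
  shows "\<exists>s \<delta>. 0 < \<delta> \<and> \<delta> \<le> 1/3 \<and> real K * s = \<delta> \<and> s \<le> 1 \<and> real (length cs) * (U * s powr \<omega>) \<le> \<tau>"
proof -
  define c where "c = \<tau> / (real (length cs) * U)"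
  define s where "s = min (1 / (3 * real K)) (c powr (1 / \<omega>))"
  have D: "real (length cs) > 0" using ne by simp
  have c: "c > 0" using assms D by (simp add: c_def)
  have K: "real K \<ge> 1" using assms by simp
  have s: "s > 0" using c K by (simp add: s_def)
  have sK: "real K * s \<le> 1/3"
  proof -
    have "real K * s \<le> real K * (1 / (3 * real K))" using K by (intro mult_left_mono) (auto simp: s_def)
    then show ?thesis using K by simp
  qed
  have "1 * s \<le> real K * s" using K s by (intro mult_right_mono) auto
  then have "s \<le> 1" using sK by linarith
  moreover have "s powr \<omega> \<le> (c powr (1 / \<omega>)) powr \<omega>"
    using s \<omega>(1) by (intro powr_mono2) (auto simp: s_def)
  then have "s powr \<omega> \<le> c" using c \<omega>(1) by (simp add: powr_powr)
  then have "real (length cs) * (U * s powr \<omega>) \<le> \<tau>" using D assms by (simp add: c_def field_simps)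
  ultimately show ?thesis using s sK K by (intro exI[of _ s] exI[of _ "real K * s"]) auto
qed

lemma scalar_network:
  assumes N: "N \<ge> 1" and M: "M \<ge> 1" and K: "K \<ge> 1" "K ^ length cs \<le> (N*M)^2" and U: "U > 0" and \<tau>: "\<tau> > 0"
  shows "\<exists>\<psi>. reach \<Omega> (3 ^ length cs * ((k + 1) * length cs ^ k * (12 * N * length cs)))
      (M*(m+6) + 2 + k * (m+1) + 3 * length cs) (coords (set cs)) {\<psi>} \<and>
    (\<forall>x\<in>\<Omega>. \<bar>\<psi> x - g x\<bar> \<le> real (length cs) powr (if k = 0 then \<beta> / 2 else 1) * (U * (1 / (2 * real K)) powr \<beta>)
        + real ((k + 1) * length cs ^ k) * (U * (2 / (2 * real N) ^ m + real k / (4 * (2 * real N) ^ (2 * m)))) + \<tau>)"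
proof -
  obtain s \<delta> where \<delta>: "0 < \<delta>" "\<delta> \<le> 1/3" "real K * s = \<delta>" "s \<le> 1" "real (length cs) * (U * s powr \<omega>) \<le> \<tau>"
    using small_increment_exists[OF \<tau> K(1) U] by blast
  define e where "e = real (length cs) powr (if k = 0 then \<beta> / 2 else 1) * (U * (1 / (2 * real K)) powr \<beta>)
        + real ((k + 1) * length cs ^ k) * (U * (2 / (2 * real N) ^ m + real k / (4 * (2 * real N) ^ (2 * m))))"
  obtain \<phi> where \<phi>: "reach \<Omega> ((k + 1) * length cs ^ k * (12 * N * length cs)) (M*(m+6) + 2 + k * (m+1)) (coords (set cs)) {\<phi>}"
    "\<forall>x\<in>\<Omega>. (\<forall>q\<in>set cs. \<not> near_grid K \<delta> (x q)) \<longrightarrow> \<bar>\<phi> x - g x\<bar> \<le> e"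
    using taylor_network[OF N M K \<delta>(1,2) U, of m] unfolding e_def by (elim exE conjE)
  have W: "length cs + 2 \<le> (k + 1) * length cs ^ k * (12 * N * length cs)"
  proof -
    have l: "1 \<le> length cs" using ne by (simp add: Suc_le_eq)
    have "1 * 1 \<le> (k + 1) * length cs ^ k" using l by (intro mult_le_mono) auto
    then have "1 * (12 * 1 * length cs) \<le> (k + 1) * length cs ^ k * (12 * N * length cs)"
      using N by (intro mult_le_mono order_refl) auto
    then show ?thesis using l by linarith
  qed
  have app: "\<bar>\<phi> x - g x\<bar> \<le> e" if "x \<in> \<Omega>" "\<And>q. q \<in> set cs \<Longrightarrow> \<not> near_grid K \<delta> (x q)" for x
    using \<phi>(2) that by simp
  have "\<exists>\<psi>. reach \<Omega> (3 ^ length cs * ((k + 1) * length cs ^ k * (12 * N * length cs)))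
      (M*(m+6) + 2 + k * (m+1) + 3 * length cs) (coords (set cs)) {\<psi>} \<and>
    (\<forall>x\<in>\<Omega>. (\<forall>q\<in>set cs - set cs. \<not> near_grid K \<delta> (x q)) \<longrightarrow> \<bar>\<psi> x - g x\<bar> \<le> e + real (length cs) * (U * s powr \<omega>))"
    by (rule median_correction[OF W \<phi>(1) \<delta>(1-4) _ order_refl]) (rule app)
  then obtain \<psi> where \<psi>: "reach \<Omega> (3 ^ length cs * ((k + 1) * length cs ^ k * (12 * N * length cs)))
      (M*(m+6) + 2 + k * (m+1) + 3 * length cs) (coords (set cs)) {\<psi>}"
    "\<forall>x\<in>\<Omega>. (\<forall>q\<in>set cs - set cs. \<not> near_grid K \<delta> (x q)) \<longrightarrow> \<bar>\<psi> x - g x\<bar> \<le> e + real (length cs) * (U * s powr \<omega>)"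
    by (elim exE conjE)
  have "\<bar>\<psi> x - g x\<bar> \<le> e + \<tau>" if "x \<in> \<Omega>" for x
    using bspec[OF \<psi>(2) that] \<delta>(5) by simp
  then show ?thesis using \<psi>(1) unfolding e_def by (intro exI[of _ \<psi>] conjI ballI)
qed

end

section \<open>From reachable functions to ParaRNNs\<close>

lemma aff_coeffs:
  fixes d :: nat
  assumes "h \<in> aff G (e ` {..<d})"
  shows "\<exists>a b. \<forall>x\<in>G. h x = (\<Sum>j<d. a j * e j x) + b"
  using assms
proof (induction rule: aff.induct)
  case (aff_base f)
  then obtain i where i: "i < d" "f = e i" by auto
  have "f x = (\<Sum>j<d. (if j = i then 1 else 0) * e j x) + 0" for x
    using i by (simp add: if_distrib[of "\<lambda>c. c * _"] cong: if_cong)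
  then show ?case by (intro exI[of _ "\<lambda>j. if j = i then 1 else 0"] exI[of _ 0] ballI)
next
  case (aff_const c)
  show ?case by (intro exI[of _ "\<lambda>_. 0"] exI[of _ c]) simp
next
  case (aff_add f g)
  then obtain a b a' b' where "\<forall>x\<in>G. f x = (\<Sum>j<d. a j * e j x) + b" "\<forall>x\<in>G. g x = (\<Sum>j<d. a' j * e j x) + b'"
    by blast
  then have "\<forall>x\<in>G. f x + g x = (\<Sum>j<d. (a j + a' j) * e j x) + (b + b')"
    by (simp add: distrib_right sum.distrib)
  then show ?case by (intro exI[of _ "\<lambda>j. a j + a' j"] exI[of _ "b + b'"])
next
  case (aff_scale f c)
  then obtain a b where "\<forall>x\<in>G. f x = (\<Sum>j<d. a j * e j x) + b" by blast
  then have "\<forall>x\<in>G. c * f x = (\<Sum>j<d. (c * a j) * e j x) + c * b"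
    by (simp add: distrib_left sum_distrib_left mult.assoc)
  then show ?case by (intro exI[of _ "\<lambda>j. c * a j"] exI[of _ "c * b"])
next
  case (aff_cong f g)
  then show ?case by simp
qed

definition run_layers :: "nat \<Rightarrow> ((nat \<Rightarrow> nat \<Rightarrow> real) \<times> (nat \<Rightarrow> nat \<Rightarrow> real) \<times> (nat \<Rightarrow> real)) list
    \<Rightarrow> (nat \<Rightarrow> nat \<Rightarrow> real) \<Rightarrow> nat \<Rightarrow> nat \<Rightarrow> real" where
  "run_layers d layers u = foldl (\<lambda>u (Wh, Wx, b). rnn_state d Wh Wx b u) u layers"

lemma run_layers_Nil [simp]: "run_layers d [] u = u"
  and run_layers_Cons [simp]: "run_layers d ((Wh, Wx, b) # ls) u = run_layers d ls (rnn_state d Wh Wx b u)"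
  by (simp_all add: run_layers_def)

lemma rnn_state_memoryless:
  assumes "t \<ge> 1"
  shows "rnn_state d (\<lambda>_ _. 0) Wx b u t i = relu ((\<Sum>j<d. Wx i j * u t j) + b i)"
  using assms by (cases t) (simp_all add: mat_vec_def)

text \<open>With zero recurrent matrices a layer reads only the current time, so the claim holds at
  every \<open>t \<ge> 1\<close> at which the features \<open>e\<close> are present, whatever is
  stored at other times.\<close>

lemma layers_of_reach:
  assumes "W \<le> d"
  shows "reach G W l S B \<Longrightarrow> S \<subseteq> aff G (e ` {..<d}) \<Longrightarrow>
    \<exists>ls e'. length ls = l \<and> (\<forall>(Wh, Wx, b)\<in>set ls. Wh = (\<lambda>_ _. 0)) \<and> B \<subseteq> aff G (e' ` {..<d}) \<and>
      (\<forall>x\<in>G. \<forall>u t. 1 \<le> t \<longrightarrow> (\<forall>j<d. u t j = e j x) \<longrightarrow> (\<forall>j<d. run_layers d ls u t j = e' j x))"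
proof (induction l arbitrary: S e)
  case 0
  have "B \<subseteq> aff G (e ` {..<d})" using 0 aff_trans by fastforce
  then show ?case by (intro exI[of _ "[]"] exI[of _ e]) auto
next
  case (Suc l)
  obtain A where A: "finite A" "card A \<le> W"
    "\<forall>g\<in>A. \<exists>h\<in>aff G S. \<forall>x\<in>G. g x = relu (h x)" "reach G W l A B"
    using Suc.prems(1) by (auto simp: reach.simps(2))
  obtain f where f: "bij_betw f {0..<card A} A" using ex_bij_betw_nat_finite[OF A(1)] by blast
  \<comment> \<open>Neurons in excess of the features hold 0, which fills the layer up to width
    \<open>d\<close>.\<close>
  define e1 where "e1 j = (if j < card A then f j else (\<lambda>_. 0))" for j
  have "\<exists>w b. \<forall>x\<in>G. e1 j x = relu ((\<Sum>i<d. w i * e i x) + b)" for j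
  proof (cases "j < card A")
    case True
    then have "f j \<in> A" using f by (auto simp: bij_betw_def)
    then obtain h where h: "h \<in> aff G S" "\<forall>x\<in>G. f j x = relu (h x)" using A(3) by blast
    have "h \<in> aff G (e ` {..<d})" using aff_trans[OF h(1) Suc.prems(2)] .
    then obtain a b where "\<forall>x\<in>G. h x = (\<Sum>i<d. a i * e i x) + b" using aff_coeffs by blast
    then show ?thesis using h(2) True by (intro exI[of _ a] exI[of _ b]) (auto simp: e1_def)
  next
    case False
    then show ?thesis by (intro exI[of _ "\<lambda>_. 0"] exI[of _ 0]) (simp add: e1_def relu_def)
  qed
  then obtain Wx b where Wb: "\<And>j x. x \<in> G \<Longrightarrow> e1 j x = relu ((\<Sum>i<d. Wx j i * e i x) + b j)"
    by metis
  have "A \<subseteq> aff G (e1 ` {..<d})"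
  proof
    fix g assume "g \<in> A"
    then have "g \<in> f ` {0..<card A}" using bij_betw_imp_surj_on[OF f] by simp
    then obtain j where "j < card A" "g = f j" by auto
    then show "g \<in> aff G (e1 ` {..<d})" using A(2) assms by (intro aff_base) (auto simp: e1_def intro!: image_eqI[of _ _ j])
  qed
  from Suc.IH[OF A(4) this] obtain ls e' where ls: "length ls = l" "\<forall>(Wh, Wx, b)\<in>set ls. Wh = (\<lambda>_ _. 0)"
    "B \<subseteq> aff G (e' ` {..<d})"
    "\<forall>x\<in>G. \<forall>u t. 1 \<le> t \<longrightarrow> (\<forall>j<d. u t j = e1 j x) \<longrightarrow> (\<forall>j<d. run_layers d ls u t j = e' j x)"
    by (elim exE conjE)
  let ?ls = "((\<lambda>_ _. 0), Wx, b) # ls"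
  have "\<forall>j<d. run_layers d ?ls u t j = e' j x" if x: "x \<in> G" and t: "1 \<le> t" and u: "\<forall>j<d. u t j = e j x" for x u t
  proof -
    have "rnn_state d (\<lambda>_ _. 0) Wx b u t j = e1 j x" for j
      using u by (simp add: rnn_state_memoryless[OF t] Wb[OF x])
    then show ?thesis using ls(4) x t by simp
  qed
  then show ?case using ls(1-3) by (intro exI[of _ ?ls] exI[of _ e']) auto
qed

text \<open>Inverse of the Vandermonde matrix: \<open>V k\<close> is the coefficient of order
  \<open>m\<close> of the Lagrange basis polynomial \<open>L k\<close>, and the identity compares
  coefficients in the interpolation of the monomial of degree \<open>j\<close>.\<close>

lemma coefficient_extraction:
  fixes a :: "nat \<Rightarrow> real"
  assumes inj: "inj_on a {..<T}" and m: "m < T"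
  shows "\<exists>V. \<forall>j<T. (\<Sum>k<T. V k * a k ^ j) = (if j = m then 1 else 0)"
proof -
  define L where "L k = (\<Prod>i\<in>{..<T} - {k}. smult (1 / (a k - a i)) [:- a i, 1:])" for k
  have L: "poly (L k) (a i) = (if i = k then 1 else 0)" if "k < T" "i < T" for k i
  proof (cases "i = k")
    case True
    have "poly (smult (1 / (a k - a i)) [:- a i, 1:]) (a k) = 1" if "i \<in> {..<T} - {k}" for i
    proof -
      have "a k - a i \<noteq> 0" using inj that \<open>k < T\<close> by (auto simp: inj_on_def)
      then show ?thesis by (simp add: diff_divide_distrib[symmetric])
    qed
    then show ?thesis using True unfolding L_def poly_prod by simp
  next
    case False
    then show ?thesis using that by (auto simp: L_def poly_prod intro!: prod_zero)
  qed
  have deg: "degree (L k) < T" if "k < T" for k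
  proof -
    have "degree (L k) \<le> (\<Sum>i\<in>{..<T} - {k}. degree (smult (1 / (a k - a i)) [:- a i, 1:]))"
      unfolding L_def using degree_prod_sum_le[of "{..<T} - {k}" "\<lambda>i. smult (1 / (a k - a i)) [:- a i, 1:]"]
      by (simp add: comp_def)
    also have "\<dots> \<le> (\<Sum>i\<in>{..<T} - {k}. 1)" by (intro sum_mono) simp
    also have "\<dots> = T - 1" using that by simp
    finally show ?thesis using that by linarith
  qed
  have "(\<Sum>k<T. coeff (L k) m * a k ^ j) = (if j = m then 1 else 0)" if j: "j < T" for j
  proof -
    let ?p = "\<Sum>k<T. smult (a k ^ j) (L k)"
    have "monom 1 j = ?p"
    proof (rule poly_eqI_degree[where A = "a ` {..<T}"])
      fix x assume "x \<in> a ` {..<T}"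
      then obtain i where i: "i < T" "x = a i" by auto
      have "poly ?p x = (\<Sum>k<T. if i = k then a k ^ j else 0)"
        unfolding poly_sum using L i by (intro sum.cong) auto
      then show "poly (monom 1 j) x = poly ?p x" using i by (simp add: poly_monom)
    next
      have c: "card (a ` {..<T}) = T" using inj by (simp add: card_image)
      show "degree (monom (1::real) j) < card (a ` {..<T})" using j by (simp add: c degree_monom_eq)
      have "degree ?p \<le> T - 1"
      proof (rule degree_sum_le)
        fix k assume "k \<in> {..<T}"
        then show "degree (smult (a k ^ j) (L k)) \<le> T - 1"
          using deg[of k] degree_smult_le[of "a k ^ j" "L k"] by simp
      qed simp
      then show "degree ?p < card (a ` {..<T})" using m c by simp
    qed
    from arg_cong[OF this, of "\<lambda>p. coeff p m"] show ?thesis by (simp add: coeff_sum mult.commute)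
  qed
  then show ?thesis by (intro exI[of _ "\<lambda>k. coeff (L k) m"] allI impI)
qed

text \<open>The decay rates \<open>1, \<dots>, T\<close> of the \<open>T\<close> copies of each input coordinate are distinct, so that
  all past inputs are recovered linearly from the final state by inverting a Vandermonde system.\<close>

definition gather_rec :: "nat \<Rightarrow> nat \<Rightarrow> nat \<Rightarrow> real" where
  "gather_rec T i j = (if i = j then real (i mod T + 1) else 0)"

definition gather_in :: "nat \<Rightarrow> nat \<Rightarrow> nat \<Rightarrow> nat \<Rightarrow> real" where
  "gather_in din T i j = (if i < din * T \<and> j = i div T then 1 else 0)"

definition gathered :: "nat \<Rightarrow> nat \<Rightarrow> nat \<Rightarrow> (nat \<times> nat \<Rightarrow> real) \<Rightarrow> nat \<Rightarrow> real" where
  "gathered din T t X i = (if i < din * T then \<Sum>s=1..t. real (i mod T + 1) ^ (t - s) * X (i div T, s) else 0)"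

definition embed_input :: "nat \<Rightarrow> nat \<Rightarrow> real" where
  "embed_input i j = (if i = j then 1 else 0)"

text \<open>Inputs in the cube and all weights are nonnegative, so ReLU acts as the identity and the
  recurrence unrolls to a sum weighted by powers of the decay rate.\<close>

lemma gather_state:
  assumes T: "T \<ge> 1" and d: "din \<le> d" and X: "X \<in> cube ({..<din} \<times> {1..T})" and i: "i < d"
  shows "t \<le> T \<Longrightarrow> rnn_state d (gather_rec T) (gather_in din T) (\<lambda>_. 0)
      (\<lambda>t. mat_vec din embed_input (\<lambda>i. X (i, t))) t i = gathered din T t X i"
  using i
proof (induction t arbitrary: i)
  case 0
  then show ?case by (simp add: gathered_def)
next
  case (Suc t)
  let ?u = "\<lambda>t. mat_vec din embed_input (\<lambda>i. X (i, t))"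
  let ?h = "rnn_state d (gather_rec T) (gather_in din T) (\<lambda>_. 0) ?u t"
  have X0: "0 \<le> X (j, s)" if "j < din" "1 \<le> s" "s \<le> T" for j s using X that by (auto simp: cube_def)
  have u: "?u s j = (if j < din then X (j, s) else 0)" for s j
    by (simp add: mat_vec_def embed_input_def if_distrib[of "\<lambda>c. c * _"] cong: if_cong)
  have "mat_vec d (gather_rec T) ?h i = (\<Sum>j<d. if j = i then real (i mod T + 1) * ?h i else 0)"
    unfolding mat_vec_def by (rule sum.cong) (auto simp: gather_rec_def)
  then have rec: "mat_vec d (gather_rec T) ?h i = real (i mod T + 1) * gathered din T t X i"
    using Suc by simp
  have inp: "mat_vec d (gather_in din T) (?u (Suc t)) i = (if i < din * T then X (i div T, Suc t) else 0)"
  proof (cases "i < din * T")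
    case True
    then have lt: "i div T < din" by (simp add: less_mult_imp_div_less)
    have "mat_vec d (gather_in din T) (?u (Suc t)) i = (\<Sum>j<d. if j = i div T then ?u (Suc t) (i div T) else 0)"
      unfolding mat_vec_def by (rule sum.cong) (use True in \<open>auto simp: gather_in_def\<close>)
    also have "\<dots> = ?u (Suc t) (i div T)" using lt d by simp
    finally show ?thesis using True lt u by simp
  next
    case False
    then show ?thesis by (simp add: mat_vec_def gather_in_def)
  qed
  show ?case
  proof (cases "i < din * T")
    case True
    then have lt: "i div T < din" by (simp add: less_mult_imp_div_less)
    let ?a = "real (i mod T + 1)"
    have eq: "gathered din T (Suc t) X i = ?a * gathered din T t X i + X (i div T, Suc t)"
      using True by (simp add: gathered_def sum_distrib_left Suc_diff_le mult.assoc)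
    have "0 \<le> gathered din T (Suc t) X i"
      unfolding gathered_def if_P[OF True]
      by (rule sum_nonneg, rule mult_nonneg_nonneg) (use X0[OF lt] Suc.prems in auto)
    then show ?thesis using eq rec inp True by (simp add: relu_def)
  next
    case False
    then show ?thesis using rec inp by (simp add: gathered_def relu_def)
  qed
qed

text \<open>Neurons \<open>i * T + k\<close> with \<open>k < T\<close> see \<open>X (i, s)\<close>
  with weight \<open>(k + 1) ^ (T - s)\<close>; extracting the power \<open>T - s\<close> isolates
  it.\<close>

lemma coords_gathered:
  assumes T: "T \<ge> 1" and d: "din * T \<le> d"
  shows "(\<lambda>p X. X p) ` ({..<din} \<times> {1..T}) \<subseteq> aff G ((\<lambda>i X. gathered din T T X i) ` {..<d})"
proof
  fix h :: "(nat \<times> nat \<Rightarrow> real) \<Rightarrow> real" assume "h \<in> (\<lambda>p X. X p) ` ({..<din} \<times> {1..T})"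
  then obtain i s where ih: "i < din" "1 \<le> s" "s \<le> T" "h = (\<lambda>X. X (i, s))" by auto
  have "inj_on (\<lambda>k. real (k + 1)) {..<T}" by (auto simp: inj_on_def)
  moreover have "T - s < T" using ih by linarith
  ultimately obtain V where V: "\<And>j. j < T \<Longrightarrow> (\<Sum>k<T. V k * real (k + 1) ^ j) = (if j = T - s then 1 else 0)"
    using coefficient_extraction by metis
  have idx: "i * T + k < din * T" if "k < T" for k
  proof -
    have "i * T + k < Suc i * T" using that by simp
    also have "\<dots> \<le> din * T" using ih by (intro mult_le_mono1) simp
    finally show ?thesis .
  qed
  have "(\<lambda>X. \<Sum>k<T. V k * gathered din T T X (i * T + k)) \<in> aff G ((\<lambda>i X. gathered din T T X i) ` {..<d})"
  proof (intro aff_sum aff_scale aff_base)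
    fix k assume "k \<in> {..<T}"
    then have "i * T + k \<in> {..<d}" using idx[of k] d by simp
    then show "(\<lambda>X. gathered din T T X (i * T + k)) \<in> (\<lambda>i X. gathered din T T X i) ` {..<d}" by (rule imageI)
  qed
  moreover have "(\<Sum>k<T. V k * gathered din T T X (i * T + k)) = X (i, s)" for X :: "nat \<times> nat \<Rightarrow> real"
  proof -
    have "(\<Sum>k<T. V k * gathered din T T X (i * T + k)) =
        (\<Sum>k<T. \<Sum>r=1..T. V k * real (k + 1) ^ (T - r) * X (i, r))"
      using idx by (intro sum.cong) (auto simp: gathered_def sum_distrib_left mult.assoc)
    also have "\<dots> = (\<Sum>r=1..T. (\<Sum>k<T. V k * real (k + 1) ^ (T - r)) * X (i, r))"
      by (subst sum.swap) (simp add: sum_distrib_right)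
    also have "\<dots> = (\<Sum>r=1..T. if r = s then X (i, s) else 0)"
    proof (rule sum.cong)
      fix r assume r: "r \<in> {1..T}"
      then have "T - r < T" "(T - r = T - s) = (r = s)" using ih by auto
      then show "(\<Sum>k<T. V k * real (k + 1) ^ (T - r)) * X (i, r) = (if r = s then X (i, s) else 0)"
        using V[of "T - r"] by simp
    qed simp
    also have "\<dots> = X (i, s)" using ih by simp
    finally show ?thesis .
  qed
  ultimately show "h \<in> aff G ((\<lambda>i X. gathered din T T X i) ` {..<d})" unfolding ih(4) by simp
qed

section \<open>The clipped read-out\<close>

definition clip :: "real \<Rightarrow> real \<Rightarrow> real" where
  "clip U y = relu y - relu (y - U) - relu (- y) + relu (- y - U)"

text \<open>Truncation to \<open>[-U, U]\<close> moves no point away from a target in that interval,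
  so clipping never increases the error.\<close>

lemma clip_bounds:
  assumes "U \<ge> 0"
  shows "\<bar>clip U y\<bar> \<le> U" and "\<bar>v\<bar> \<le> U \<Longrightarrow> \<bar>clip U y - v\<bar> \<le> \<bar>y - v\<bar>"
  using assms by (auto simp: clip_def relu_def max_def abs_if split: if_splits)

text \<open>The gathering layer adds one to the depth and is diagonal, hence block diagonal for
  every \<open>ds\<close>. The clipped form of the output holds for all inputs and times, also off
  the cube, which gives the uniform bound \<open>U\<close>.\<close>

lemma pararnn_realization:
  fixes y :: "nat \<Rightarrow> (nat \<times> nat \<Rightarrow> real) \<Rightarrow> real"
  assumes T: "T \<ge> 1" and U: "U \<ge> 0" and d: "W \<le> d" "din * T \<le> d" "4 * dout \<le> d"
    and r: "reach (cube ({..<din} \<times> {1..T})) W l ((\<lambda>p X. X p) ` ({..<din} \<times> {1..T})) (y ` {..<dout})"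
  shows "\<exists>\<phi>\<in>pararnn_class din dout d ds (l + 1) U T.
    \<forall>X\<in>cube ({..<din} \<times> {1..T}). \<forall>i<dout. \<phi> X i = clip U (y i X)"
proof -
  let ?G = "cube ({..<din} \<times> {1..T})"
  have "din * 1 \<le> din * T" using T by (rule mult_le_mono2)
  then have din: "din \<le> d" using d(2) by linarith
  let ?e = "\<lambda>i X. gathered din T T X i"
  have "\<exists>ls e'. length ls = l \<and> (\<forall>(Wh, Wx, b)\<in>set ls. Wh = (\<lambda>_ _. 0)) \<and> y ` {..<dout} \<subseteq> aff ?G (e' ` {..<d}) \<and>
      (\<forall>x\<in>?G. \<forall>u t. 1 \<le> t \<longrightarrow> (\<forall>j<d. u t j = ?e j x) \<longrightarrow> (\<forall>j<d. run_layers d ls u t j = e' j x))"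
    by (rule layers_of_reach[OF d(1) r coords_gathered[OF T d(2)]])
  then obtain ls e' where ls: "length ls = l" "\<forall>(Wh, Wx, b)\<in>set ls. Wh = (\<lambda>_ _. 0)"
    "y ` {..<dout} \<subseteq> aff ?G (e' ` {..<d})"
    "\<forall>x\<in>?G. \<forall>u t. 1 \<le> t \<longrightarrow> (\<forall>j<d. u t j = ?e j x) \<longrightarrow> (\<forall>j<d. run_layers d ls u t j = e' j x)"
    by (elim exE conjE)
  have "\<exists>a b. \<forall>X\<in>?G. y i X = (\<Sum>j<d. a j * e' j X) + b" if "i < dout" for i
    by (rule aff_coeffs) (use ls(3) that in blast)
  then obtain a b where ab: "\<And>i X. i < dout \<Longrightarrow> X \<in> ?G \<Longrightarrow> y i X = (\<Sum>j<d. a i j * e' j X) + b i"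
    by metis
  \<comment> \<open>Units \<open>4 * i\<close> to \<open>4 * i + 3\<close> compute the four ReLU
    terms of \<open>clip\<close>: the sign of the argument changes with the second pair, odd units
    subtract \<open>U\<close>, and \<open>Q\<close> supplies the signs +, -, -, +.\<close>
  define Wf where "Wf q j = (if q mod 4 < 2 then a (q div 4) j else - a (q div 4) j)" for q j
  define bf where "bf q = (if q mod 4 < 2 then b (q div 4) else - b (q div 4)) - (if odd q then U else 0)" for q
  define Q where "Q i q = (if q div 4 = i then (if q mod 4 = 0 \<or> q mod 4 = 3 then 1 else -1) else 0 :: real)" for i q :: nat
  define N where "N = \<lparr>rnn_P = embed_input, rnn_layers = (gather_rec T, gather_in din T, \<lambda>_. 0) # ls,
    rnn_Wf = Wf, rnn_bf = bf, rnn_Q = Q\<rparr>"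
  let ?u0 = "\<lambda>X t. mat_vec din embed_input (\<lambda>i. X (i, t))"
  define h where "h X = run_layers d ls (rnn_state d (gather_rec T) (gather_in din T) (\<lambda>_. 0) (?u0 X))" for X
  have eval: "pararnn_eval din d N X t i = clip U ((\<Sum>j<d. a i j * h X t j) + b i)" if i: "i < dout" for X t i
  proof -
    let ?y = "(\<Sum>j<d. a i j * h X t j) + b i"
    have "pararnn_eval din d N X t i = (\<Sum>q<d. Q i q * relu (mat_vec d Wf (h X t) q + bf q))"
      by (simp add: pararnn_eval_def N_def Let_def mat_vec_def h_def run_layers_def)
    also have "\<dots> = (\<Sum>q\<in>{4*i, 4*i+1, 4*i+2, 4*i+3}. Q i q * relu (mat_vec d Wf (h X t) q + bf q))"
    proof (rule sum.mono_neutral_right)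
      show "\<forall>q\<in>{..<d} - {4*i, 4*i+1, 4*i+2, 4*i+3}. Q i q * relu (mat_vec d Wf (h X t) q + bf q) = 0"
      proof
        fix q assume "q \<in> {..<d} - {4*i, 4*i+1, 4*i+2, 4*i+3}"
        then have "q div 4 \<noteq> i" by auto
        then show "Q i q * relu (mat_vec d Wf (h X t) q + bf q) = 0" by (simp add: Q_def)
      qed
    qed (use i d(3) in auto)
    also have "\<dots> = clip U ?y"
    proof -
      have "(4*i+1) div 4 = i" "(4*i+2) div 4 = i" "(4*i+3) div 4 = i"
        "(4*i+1) mod 4 = 1" "(4*i+2) mod 4 = 2" "(4*i+3) mod 4 = 3" by presburger+
      then show ?thesis
        by (simp add: Q_def Wf_def bf_def mat_vec_def clip_def sum_negf algebra_simps)
    qed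
    finally show ?thesis .
  qed
  have "(\<lambda>X. pararnn_eval din d N X T) \<in> pararnn_class din dout d ds (l + 1) U T"
  proof -
    have "length (rnn_layers N) = l + 1" using ls(1) by (simp add: N_def)
    moreover have "\<forall>(Wh, Wx, b)\<in>set (rnn_layers N). block_diag d ds Wh"
      using ls(2) by (auto simp: N_def block_diag_def gather_rec_def)
    moreover have "\<forall>X t i. 1 \<le> t \<and> t \<le> T \<and> i < dout \<longrightarrow> \<bar>pararnn_eval din d N X t i\<bar> \<le> U"
      using eval clip_bounds(1)[OF U] by simp
    ultimately show ?thesis unfolding pararnn_class_def by blast
  qed
  moreover have "pararnn_eval din d N X T i = clip U (y i X)" if X: "X \<in> ?G" and i: "i < dout" for X i
  proof -
    have "\<forall>j<d. rnn_state d (gather_rec T) (gather_in din T) (\<lambda>_. 0) (?u0 X) T j = ?e j X"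
      using gather_state[OF T din X _ order_refl] by blast
    then have "\<forall>j<d. h X T j = e' j X" using ls(4) X T unfolding h_def by blast
    then show ?thesis using eval[OF i] ab[OF i X] by simp
  qed
  ultimately show ?thesis by (intro bexI[of _ "\<lambda>X. pararnn_eval din d N X T"] ballI allI impI)
qed

section \<open>Rates and budgets\<close>

text \<open>Rounding \<open>r\<close> down to \<open>K\<close> loses at most a factor 2, which the
  half-width \<open>1 / (2 * K)\<close> of a cell makes up.\<close>

lemma cell_count_exists:
  fixes P D :: nat
  assumes P: "P \<ge> 1" and D: "D \<ge> 1" and \<beta>: "\<beta> > 0"
  shows "\<exists>K\<ge>1. K ^ D \<le> P^2 \<and> (1 / (2 * real K)) powr \<beta> \<le> real P powr (- 2 * \<beta> / real D)"
proof -
  define r where "r = real P powr (2 / real D)"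
  define K where "K = nat \<lfloor>r\<rfloor>"
  have r: "1 \<le> r" using P by (simp add: r_def ge_one_powr_ge_zero)
  have K: "real K \<le> r" "r < real K + 1" "1 \<le> K" using r by (auto simp: K_def le_nat_iff)
  have "real K ^ D \<le> r ^ D" using K by (intro power_mono) auto
  also have "\<dots> = r powr real D" using r by (simp add: powr_realpow)
  also have "\<dots> = real P powr 2" using D by (simp add: r_def powr_powr)
  also have "\<dots> = real P ^ 2" using P by (simp add: powr_numeral)
  finally have "real (K ^ D) \<le> real (P ^ 2)" by simp
  then have KD: "K ^ D \<le> P ^ 2" by (simp only: of_nat_le_iff)
  have "1 \<le> real K" using K(3) by simp
  then have "r \<le> 2 * real K" using K(2) by linarith
  then have "1 / (2 * real K) \<le> 1 / r" using r by (intro divide_left_mono) auto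
  then have "(1 / (2 * real K)) powr \<beta> \<le> (1 / r) powr \<beta>" using K \<beta> by (intro powr_mono2) auto
  also have "1 / r = real P powr (- (2 / real D))" by (simp add: r_def powr_minus_divide)
  also have "\<dots> powr \<beta> = real P powr (- 2 * \<beta> / real D)" by (simp add: powr_powr)
  finally show ?thesis using K(3) KD by blast
qed

text \<open>In \<open>(2 * N) ^ (2 * q * \<Lambda>)\<close> the powers of \<open>N\<close> cover
  \<open>N ^ (2 * q)\<close>, while the powers of 2 cover \<open>M ^ (2 * q)\<close> because
  \<open>M \<le> 2 ^ \<Lambda>\<close>.\<close>

lemma precision_bound:
  fixes N M D q \<Lambda> :: nat
  assumes N: "N \<ge> 1" and M: "M \<ge> 1" and D: "D \<ge> 1" and \<beta>: "0 < \<beta>" "\<beta> \<le> real q" and \<Lambda>: "8 * real M \<le> 2 ^ \<Lambda>" "\<Lambda> \<ge> 1"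
  shows "1 / (2 * real N) ^ (2 * q * \<Lambda>) \<le> real (N * M) powr (- 2 * \<beta> / real D)"
proof -
  have "1 * 1 \<le> N * M" using N M by (rule mult_le_mono)
  then have b: "1 \<le> real N" "1 \<le> real M" "1 \<le> real (N * M)"
    using N M by (simp_all flip: of_nat_mult)
  have "2 * \<beta> / real D \<le> 2 * real q / 1" using D \<beta> by (intro frac_le) auto
  then have "real (N * M) powr (2 * \<beta> / real D) \<le> real (N * M) powr real (2 * q)"
    using b by (intro powr_mono) auto
  also have "\<dots> = real N ^ (2 * q) * real M ^ (2 * q)"
    using b powr_realpow[of "real (N * M)" "2 * q"] by (simp add: power_mult_distrib)
  also have "\<dots> \<le> real N ^ (2 * q * \<Lambda>) * (2 ^ \<Lambda>) ^ (2 * q)"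
  proof (rule mult_mono)
    show "real N ^ (2 * q) \<le> real N ^ (2 * q * \<Lambda>)" using b \<Lambda> by (intro power_increasing) auto
    have "real M \<le> 2 ^ \<Lambda>" using \<Lambda>(1) b by linarith
    then show "real M ^ (2 * q) \<le> (2 ^ \<Lambda>) ^ (2 * q)" by (intro power_mono) auto
  qed auto
  also have "\<dots> = (2 * real N) ^ (2 * q * \<Lambda>)"
    by (simp add: power_mult_distrib power_mult[symmetric] mult_ac)
  finally have le: "real (N * M) powr (2 * \<beta> / real D) \<le> (2 * real N) ^ (2 * q * \<Lambda>)" .
  have "1 / (2 * real N) ^ (2 * q * \<Lambda>) \<le> 1 / real (N * M) powr (2 * \<beta> / real D)"
    by (rule divide_left_mono[OF le]) (use b in auto)
  also have "\<dots> = real (N * M) powr (- (2 * \<beta> / real D))" by (simp only: powr_minus_divide)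
  finally show ?thesis by simp
qed

lemma log_ceiling:
  assumes "n \<ge> (1::nat)"
  shows "8 * real n \<le> 2 ^ nat \<lceil>log 2 (8 * real n)\<rceil>" "1 \<le> nat \<lceil>log 2 (8 * real n)\<rceil>"
proof -
  let ?l = "log 2 (8 * real n)"
  have "log 2 2 \<le> ?l" using assms by (subst log_le_cancel_iff) auto
  then have l: "1 \<le> ?l" by simp
  then show "1 \<le> nat \<lceil>?l\<rceil>" by linarith
  have "8 * real n = 2 powr ?l" using assms by simp
  also have "\<dots> \<le> 2 powr real (nat \<lceil>?l\<rceil>)" using l by (intro powr_mono) linarith+
  also have "\<dots> = 2 ^ nat \<lceil>?l\<rceil>" by (simp add: powr_realpow)
  finally show "8 * real n \<le> 2 ^ nat \<lceil>?l\<rceil>" .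
qed

text \<open>With \<open>m = 2 * q * \<Lambda>\<close>, the terms account for cell finding and
  lookup, products, medians and the gathering layer. They amount to at most
  \<open>14 * Z + 3 * D\<close>.\<close>

lemma depth_budget:
  fixes k q M \<Lambda> D :: nat
  assumes "k \<le> q" "1 \<le> q" "1 \<le> M" "1 \<le> \<Lambda>"
  shows "M * (2 * q * \<Lambda> + 6) + 2 + k * (2 * q * \<Lambda> + 1) + 3 * D + 1 \<le> 42 * q^2 * M * \<Lambda> + 6 * D"
proof -
  define Z where "Z = q * q * M * \<Lambda>"
  have "k * (2 * q * \<Lambda> + 1) \<le> q * (2 * q * \<Lambda> + 1)" using assms(1) by (rule mult_le_mono1)
  also have "\<dots> = 2 * (q * q * 1 * \<Lambda>) + q * 1 * 1 * 1" by simp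
  also have "\<dots> \<le> 2 * Z + Z" unfolding Z_def
    using assms by (intro add_mono mult_le_mono order_refl) auto
  finally have 1: "k * (2 * q * \<Lambda> + 1) \<le> 3 * Z" by simp
  have "M * (2 * q * \<Lambda> + 6) = 2 * (1 * q * M * \<Lambda>) + 6 * (1 * 1 * M * 1)" by (simp add: algebra_simps)
  also have "\<dots> \<le> 2 * Z + 6 * Z" unfolding Z_def
    using assms by (intro add_mono mult_le_mono order_refl) auto
  finally have 2: "M * (2 * q * \<Lambda> + 6) \<le> 8 * Z" by simp
  have "1 * 1 * 1 * 1 \<le> Z" unfolding Z_def using assms by (intro mult_le_mono) auto
  moreover have "42 * q^2 * M * \<Lambda> = 42 * Z" by (simp add: Z_def power2_eq_square)
  ultimately show ?thesis using 1 2 by linarith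
qed

text \<open>The factors are outputs, shifted copies, monomials and the width of one monomial
  network. The other two claims make room for the gathering layer and for four units per clipped
  output.\<close>

lemma width_budget:
  fixes k q' din T N dout \<Lambda> ds :: nat
  assumes "k \<le> q'" "1 \<le> din" "1 \<le> T" "1 \<le> N" "1 \<le> \<Lambda>"
  defines "d \<equiv> 76 * (q' + 1)^2 * 3^(din * T) * din^(q' + 2) * dout * T^(q' + 1) * N * \<Lambda> + ds"
  shows "dout * (3 ^ (din * T) * ((k + 1) * (din * T) ^ k * (12 * N * (din * T)))) \<le> d"
    and "1 \<le> dout \<Longrightarrow> din * T \<le> d" and "4 * dout \<le> d"
proof -
  define X where "X = 3^(din * T) * (din * T)^(q' + 1) * dout * N"
  have d: "d = 76 * ((q' + 1)^2 * X * din * \<Lambda>) + ds"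
    by (simp add: d_def X_def power_mult_distrib mult_ac)
  have X: "(q' + 1) * X \<le> (q' + 1)^2 * X * din * \<Lambda>"
  proof -
    have "(q' + 1) * 1 * X * 1 * 1 \<le> (q' + 1) * (q' + 1) * X * din * \<Lambda>"
      using assms by (intro mult_le_mono order_refl) auto
    then show ?thesis by (simp add: power2_eq_square)
  qed
  have "(k + 1) * (din * T) ^ k \<le> (q' + 1) * (din * T) ^ q'"
    using assms by (intro mult_le_mono power_increasing) auto
  then have "dout * (3 ^ (din * T) * ((k + 1) * (din * T) ^ k * (12 * N * (din * T))))
      \<le> dout * (3 ^ (din * T) * ((q' + 1) * (din * T) ^ q' * (12 * N * (din * T))))"
    by (rule mult_le_mono2[OF mult_le_mono2[OF mult_le_mono1]])
  also have "\<dots> = 12 * ((q' + 1) * X)" by (simp add: X_def algebra_simps)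
  also have "\<dots> \<le> d" using X d by linarith
  finally show "dout * (3 ^ (din * T) * ((k + 1) * (din * T) ^ k * (12 * N * (din * T)))) \<le> d" .
  have X1: "X \<le> d" using X d by simp
  have p: "din * T \<le> (din * T)^(q' + 1)" "1 \<le> (din * T)^(q' + 1)"
    using assms self_le_power[of "din * T" "q' + 1"] by auto
  show "din * T \<le> d" if "1 \<le> dout"
  proof -
    have "1 * (din * T) * 1 * 1 \<le> X" unfolding X_def using assms that p(1) by (intro mult_le_mono) auto
    then show ?thesis using X1 by linarith
  qed
  have "1 * 1 * dout * 1 \<le> X" unfolding X_def using assms p(2) by (intro mult_le_mono) auto
  then show "4 * dout \<le> d" using X d by simp
qed

text \<open>The summands are the Taylor error, the table and product errors over all monomials, and
  the allowance for the median shifts; together they stay below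
  \<open>4 * (q' + 1)^2 * P * U * R\<close>.\<close>

lemma error_budget:
  fixes k q' D :: nat and \<beta> U R e1 e2 e3 :: real
  assumes k: "k \<le> q'" "k = 0 \<longrightarrow> \<beta> \<le> 1" "k \<ge> 1 \<longrightarrow> 1 < \<beta>" and D: "D \<ge> 1" and U: "U > 0" and \<beta>: "\<beta> > 0"
    and R: "0 \<le> R" and e: "0 \<le> e1" "e1 \<le> R" "e2 \<le> R" "e3 \<le> R"
  shows "real D powr (if k = 0 then \<beta> / 2 else 1) * (U * e1) + real ((k + 1) * D ^ k) * (U * (2 * e2 + real k / 4 * e3)) + U * R
    \<le> 19 * U * (real q' + 1)^2 * real D powr (real q' + max \<beta> 1 / 2) * R"
proof -
  define P where "P = real D powr (real q' + max \<beta> 1 / 2)"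
  have D1: "1 \<le> real D" using D by simp
  have P1: "1 \<le> P" unfolding P_def using D1 \<beta> by (intro ge_one_powr_ge_zero) auto
  have UR: "0 \<le> U * R" using U R by simp
  have "(if k = 0 then \<beta> / 2 else 1) \<le> real q' + max \<beta> 1 / 2"
    using k by (cases "k = 0") (auto simp: max_def)
  then have a: "real D powr (if k = 0 then \<beta> / 2 else 1) \<le> P" unfolding P_def using D1 by (intro powr_mono) auto
  have "real D ^ k = real D powr real k" using D1 by (simp add: powr_realpow)
  also have "\<dots> \<le> P" unfolding P_def using D1 k(1) \<beta> by (intro powr_mono) auto
  finally have b: "real D ^ k \<le> P" .
  have t1: "real D powr (if k = 0 then \<beta> / 2 else 1) * (U * e1) \<le> P * (U * R)"
    using a e U P1 by (intro mult_mono) auto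
  have "2 * e2 + real k / 4 * e3 \<le> 2 * R + real k / 4 * R"
    using e by (intro add_mono mult_left_mono) auto
  also have "\<dots> \<le> 2 * (real k + 1) * R" using R by (simp add: algebra_simps)
  finally have "U * (2 * e2 + real k / 4 * e3) \<le> U * (2 * (real k + 1) * R)"
    using U by (intro mult_left_mono) auto
  then have B: "U * (2 * e2 + real k / 4 * e3) \<le> 2 * (real k + 1) * (U * R)" by (simp only: mult_ac)
  have "(real k + 1) * real D ^ k \<le> (real k + 1) * P" using b by (rule mult_left_mono) simp
  then have A: "real ((k + 1) * D ^ k) \<le> (real k + 1) * P"
    by (simp only: of_nat_mult of_nat_add of_nat_power of_nat_1)
  have "real ((k + 1) * D ^ k) * (U * (2 * e2 + real k / 4 * e3)) \<le> ((real k + 1) * P) * (2 * (real k + 1) * (U * R))"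
    by (rule order_trans[OF mult_left_mono[OF B] mult_right_mono[OF A]]) (use UR in auto)
  also have "\<dots> = 2 * (real k + 1)^2 * (P * (U * R))" by (simp add: power2_eq_square)
  also have "\<dots> \<le> 2 * (real q' + 1)^2 * (P * (U * R))"
    using k(1) UR P1 by (intro mult_right_mono mult_left_mono power_mono) auto
  finally have t2: "real ((k + 1) * D ^ k) * (U * (2 * e2 + real k / 4 * e3)) \<le> 2 * (real q' + 1)^2 * (P * (U * R))" .
  have PUR: "0 \<le> P * (U * R)" "U * R \<le> P * (U * R)" using P1 UR mult_right_mono[OF P1 UR] by auto
  have "1 \<le> (real q' + 1)^2" by simp
  from mult_right_mono[OF this PUR(1)] have "P * (U * R) \<le> (real q' + 1)^2 * (P * (U * R))" by simp
  then have "P * (U * R) + 2 * (real q' + 1)^2 * (P * (U * R)) + U * R \<le> 19 * (real q' + 1)^2 * (P * (U * R))"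
    using PUR by linarith
  then show ?thesis using t1 t2 unfolding P_def[symmetric] by (simp add: mult_ac)
qed

theorem theorem3:
  fixes din dout T ds I J :: nat and \<beta> U :: real
    and f :: "(nat \<times> nat \<Rightarrow> real) \<Rightarrow> nat \<Rightarrow> real"
  assumes "din \<ge> 1" "dout \<ge> 1" "T \<ge> 1" "\<beta> > 0" "U > 0" "ds \<ge> 1"
    and "f \<in> holder_class [(i, t). t \<leftarrow> [1..<T+1], i \<leftarrow> [0..<din]] dout \<beta> U"
    and "I \<ge> 1" "J \<ge> 1"
    and "L = 42 * (nat \<lfloor>\<beta>\<rfloor> + 1)^2 * I * nat \<lceil>log 2 (8 * real I)\<rceil> + 6 * din * T"
    and "d = 76 * (nat \<lfloor>\<beta>\<rfloor> + 1)^2 * 3^(din * T) * din^(nat \<lfloor>\<beta>\<rfloor> + 2) * dout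
             * T^(nat \<lfloor>\<beta>\<rfloor> + 1) * J * nat \<lceil>log 2 (8 * real J)\<rceil> + ds"
    and "ds dvd d"
  shows "\<exists>\<phi> \<in> pararnn_class din dout d ds L U T.
           \<forall>X \<in> cube ({..<din} \<times> {1..T}). \<forall>i < dout.
             \<bar>\<phi> X i - f X i\<bar>
               \<le> 19 * U * (real (nat \<lfloor>\<beta>\<rfloor>) + 1)^2
                  * real (din * T) powr (real (nat \<lfloor>\<beta>\<rfloor>) + max \<beta> 1 / 2)
                  * real (J * I) powr (- 2 * \<beta> / real (din * T))"
proof -
  define cs where "cs = [(i, t). t \<leftarrow> [1..<T+1], i \<leftarrow> [0..<din]]"
  define q' where "q' = nat \<lfloor>\<beta>\<rfloor>"
  define \<kappa> where "\<kappa> = holder_k \<beta>"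
  define \<Lambda> where "\<Lambda> = nat \<lceil>log 2 (8 * real I)\<rceil>"
  \<comment> \<open>As \<open>q' + 1\<close> exceeds \<beta>, this many digits in radix
    \<open>2 * J\<close> reach precision \<open>R\<close>.\<close>
  define m where "m = 2 * (q' + 1) * \<Lambda>"
  define D where "D = din * T"
  define R where "R = real (J * I) powr (- 2 * \<beta> / real D)"
  define bnd where "bnd = 19 * U * (real q' + 1)^2 * real D powr (real q' + max \<beta> 1 / 2) * R"
  have set_cs: "set cs = {..<din} \<times> {1..T}" by (auto simp: cs_def)
  have "f \<in> holder_class cs dout \<beta> U" using assms(7) by (simp only: cs_def)
  then have dist: "distinct cs" and
    holder: "\<And>i. i < dout \<Longrightarrow> holder_function cs (\<lambda>x. f x i) \<beta> U"
  proof -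
    assume h: "f \<in> holder_class cs dout \<beta> U"
    then show d: "distinct cs" by (simp add: holder_class_def)
    have "(0, 1) \<in> set cs" unfolding set_cs using assms(1,3) by simp
    then have "cs \<noteq> []" by auto
    then show "holder_function cs (\<lambda>x. f x i) \<beta> U" if "i < dout" for i
      using h that assms(4) unfolding holder_class_def by unfold_locales blast+
  qed
  have len: "length cs = D" using distinct_card[OF dist] unfolding set_cs D_def by simp
  have D: "D \<ge> 1" using assms by (simp add: D_def)
  have q': "real q' \<le> \<beta>" "\<beta> < real q' + 1" unfolding q'_def using assms(4) by linarith+
  have kr: "real \<kappa> = real_of_int (\<lceil>\<beta>\<rceil> - 1)" using assms(4) by (simp add: \<kappa>_def holder_k_def)
  have kb: "real \<kappa> < \<beta>" "\<beta> \<le> real \<kappa> + 1" using kr by linarith+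
  then have "real \<kappa> < real (q' + 1)" using q' by simp
  then have \<kappa>: "\<kappa> \<le> q'" unfolding of_nat_less_iff by simp
  have k01: "\<kappa> = 0 \<longrightarrow> \<beta> \<le> 1" using kb by auto
  have k1: "\<kappa> \<ge> 1 \<longrightarrow> 1 < \<beta>" using kb(1) by linarith
  have \<Lambda>: "8 * real I \<le> 2 ^ \<Lambda>" "1 \<le> \<Lambda>" using log_ceiling[OF assms(8)] by (auto simp: \<Lambda>_def)
  have R: "0 < R" using assms by (simp add: R_def)
  obtain K where K: "K \<ge> 1" "K ^ D \<le> (J * I)^2" "(1 / (2 * real K)) powr \<beta> \<le> R"
    using cell_count_exists[of "J * I" D \<beta>] assms D unfolding R_def by auto
  have prec: "1 / (2 * real J) ^ m \<le> R"
    unfolding m_def R_def by (rule precision_bound) (use assms D q' \<Lambda> in auto)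
  have prec2: "1 / (2 * real J) ^ (2 * m) \<le> R"
  proof -
    have "(2 * real J) ^ m \<le> (2 * real J) ^ (2 * m)" using assms(9) by (intro power_increasing) auto
    then have "1 / (2 * real J) ^ (2 * m) \<le> 1 / (2 * real J) ^ m" using assms(9) by (intro divide_left_mono) auto
    then show ?thesis using prec by linarith
  qed
  let ?G = "cube ({..<din} \<times> {1..T})"
  let ?W = "3 ^ D * ((\<kappa> + 1) * D ^ \<kappa> * (12 * J * D))" and ?l = "I*(m+6) + 2 + \<kappa> * (m+1) + 3 * D"
  have "\<exists>\<psi>. reach ?G ?W ?l ((\<lambda>p X. X p) ` ({..<din} \<times> {1..T})) {\<psi>} \<and> (\<forall>X\<in>?G. \<bar>\<psi> X - f X i\<bar> \<le> bnd)"
    if i: "i < dout" for i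
  proof -
    interpret holder_function cs "\<lambda>x. f x i" \<beta> U by (rule holder[OF i])
    have kk: "k = \<kappa>" unfolding \<kappa>_def k_def ..
    have "\<exists>\<psi>. reach ?G ?W ?l ((\<lambda>p X. X p) ` ({..<din} \<times> {1..T})) {\<psi>} \<and>
      (\<forall>X\<in>?G. \<bar>\<psi> X - f X i\<bar> \<le> real D powr (if \<kappa> = 0 then \<beta> / 2 else 1) * (U * (1 / (2 * real K)) powr \<beta>)
        + real ((\<kappa> + 1) * D ^ \<kappa>) * (U * (2 / (2 * real J) ^ m + real \<kappa> / (4 * (2 * real J) ^ (2 * m)))) + U * R)"
      \<comment> \<open>The allowance \<tau> is set to \<open>U * R\<close>, of the same order as
        the remaining errors.\<close>
      using scalar_network[OF assms(9) assms(8) K(1) _ assms(5), of "U * R" m] K(2) assms(5) R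
      unfolding kk len \<Omega>_def set_cs coords_def by simp
    moreover have "real D powr (if \<kappa> = 0 then \<beta> / 2 else 1) * (U * (1 / (2 * real K)) powr \<beta>)
        + real ((\<kappa> + 1) * D ^ \<kappa>) * (U * (2 / (2 * real J) ^ m + real \<kappa> / (4 * (2 * real J) ^ (2 * m)))) + U * R \<le> bnd"
      using error_budget[OF \<kappa> k01 k1 D assms(5,4) less_imp_le[OF R] _ K(3) prec prec2]
      unfolding bnd_def by simp
    ultimately show ?thesis by (meson order_trans)
  qed
  then have "\<forall>i\<in>{..<dout}. \<exists>\<psi>. reach ?G ?W ?l ((\<lambda>p X. X p) ` ({..<din} \<times> {1..T})) {\<psi>} \<and> (\<forall>X\<in>?G. \<bar>\<psi> X - f X i\<bar> \<le> bnd)"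
    by simp
  then obtain \<psi> where \<psi>: "\<forall>i\<in>{..<dout}. reach ?G ?W ?l ((\<lambda>p X. X p) ` ({..<din} \<times> {1..T})) {\<psi> i} \<and> (\<forall>X\<in>?G. \<bar>\<psi> i X - f X i\<bar> \<le> bnd)"
    by (rule bchoice[THEN exE])
  have "reach ?G (card {..<dout} * ?W) ?l ((\<lambda>p X. X p) ` ({..<din} \<times> {1..T})) (\<Union>i\<in>{..<dout}. {\<psi> i})"
    by (rule reach_UN_const) (use \<psi> in auto)
  then have r: "reach ?G (dout * ?W) ?l ((\<lambda>p X. X p) ` ({..<din} \<times> {1..T})) (\<psi> ` {..<dout})"
    by (simp add: UNION_singleton_eq_range)
  have depth: "?l + 1 \<le> L"
    using depth_budget[of \<kappa> "q' + 1" I \<Lambda> D] \<kappa> \<Lambda> assms(8,10)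
    unfolding m_def q'_def[symmetric] \<Lambda>_def[symmetric] D_def by (simp add: mult.assoc)
  \<comment> \<open>The class fixes the number of layers exactly; one of the \<open>L\<close> is
    reserved for gathering.\<close>
  have "reach ?G (dout * ?W) (L - 1) ((\<lambda>p X. X p) ` ({..<din} \<times> {1..T})) (\<psi> ` {..<dout})"
    by (rule reach_pad[OF r]) (use depth in auto)
  then have "\<exists>\<phi>\<in>pararnn_class din dout d ds (L - 1 + 1) U T. \<forall>X\<in>?G. \<forall>i<dout. \<phi> X i = clip U (\<psi> i X)"
  proof (rule pararnn_realization[OF assms(3) less_imp_le[OF assms(5)], rotated 3])
    note w = width_budget[OF \<kappa> assms(1,3,9) log_ceiling(2)[OF assms(9)], of dout ds, folded q'_def]
    show "dout * ?W \<le> d" using w(1) unfolding assms(11) q'_def D_def .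
    show "din * T \<le> d" using w(2)[OF assms(2)] unfolding assms(11) q'_def .
    show "4 * dout \<le> d" using w(3) unfolding assms(11) q'_def .
  qed
  moreover have "L - 1 + 1 = L" using depth by simp
  ultimately obtain \<phi> where \<phi>: "\<phi> \<in> pararnn_class din dout d ds L U T" "\<forall>X\<in>?G. \<forall>i<dout. \<phi> X i = clip U (\<psi> i X)"
    by auto
  have "\<bar>\<phi> X i - f X i\<bar> \<le> bnd" if X: "X \<in> ?G" and i: "i < dout" for X i
  proof -
    interpret holder_function cs "\<lambda>x. f x i" \<beta> U by (rule holder[OF i])
    \<comment> \<open>The derivative of order zero is part of the norm, so \<open>f\<close> itself
      takes values in \<open>[-U, U]\<close> and clipping is harmless.\<close>
    have "\<bar>mi_deriv cs (\<lambda>_. 0) (\<lambda>x. f x i) X\<bar> \<le> U"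
      by (rule deriv_bound) (use X in \<open>auto simp: multi_indices_def \<Omega>_def set_cs\<close>)
    then have "\<bar>f X i\<bar> \<le> U" by (simp add: D_zero)
    then have "\<bar>clip U (\<psi> i X) - f X i\<bar> \<le> \<bar>\<psi> i X - f X i\<bar>"
      using clip_bounds(2)[of U] assms(5) by simp
    also have "\<dots> \<le> bnd" using \<psi> X i by simp
    finally show ?thesis using \<phi>(2) X i by simp
  qed
  then show ?thesis using \<phi>(1) unfolding bnd_def R_def q'_def D_def by (intro bexI[of _ \<phi>] ballI allI impI)
qed

end
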